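(* Assume (A1), (A2), (A4), (A5) of the context, and let $F$ be strongly convex with parameter $\mu>0$ in the sense of the context. Let $\theta>0$, $\nu>0$, $x_0\in\mathbb{R}^d$, and fix one of the gradient estimation methods FD, GS, SS, RC, RS. Let $\{x_k : k\in\mathbb{Z}_{++}\}$ be generated by $x_{k+1}=x_k-\alpha_k g_{S_k,T_k}(x_k)$, where $|S_k|$ is chosen so that Condition 1, Condition 2 or Condition 3 holds with constant $\theta$ at every iteration, $|T_k|=N$ for all $k\in\mathbb{Z}_+$ ($N=d$ for FD, $N\le d$ for RC and RS), and $\alpha_k=\bar\alpha$ for all $k\in\mathbb{Z}_+$, where, with $\Omega_1=\frac{1}{4(1+\theta^2)L_{\nabla F}}$, $$\bar\alpha=\Omega_1\ (\mathrm{FD}),\qquad \bar\alpha=\tfrac{N}{N+4.5d}\,\Omega_1\ (\mathrm{GS}\text{ and }\mathrm{SS}),\qquad \bar\alpha=\tfrac{N}{d}\,\Omega_1\ (\mathrm{RC}\text{ and }\mathrm{RS}).$$ Then the iterates converge linearly in expectation to a neighborhood of the solution: for all $k\in\mathbb{Z}_+$, $$\mathbb{E}[F(x_k)-F(x^* )]\le(1-\rho)^k\left(F(x_0)-F(x^* )-\eta\right)+\eta ,$$ where, with $\Omega_3=\frac{\mu}{8(1+\theta^2)L_{\nabla F}}$ and $\Omega_4=\frac{3L_{\nabla F}^2\nu^2 d}{8\mu}$, the rate constant $\rho$ and neighborhood size $\eta$ are - FD: $\rho=\Omega_3$, $\eta=\Omega_4$; - GS: $\rho=\frac{N}{N+4.5d}\Omega_3$,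 $\eta=\frac{8N+24d+(d+2)(d+4)}{2N+9d}\Omega_4$; - SS: $\rho=\frac{N}{N+4.5d}\Omega_3$, $\eta=\frac{8N+24d+d^2}{(2N+9d)d}\Omega_4$; - RC: $\rho=\frac{N}{d}\Omega_3$, $\eta=\Omega_4$; - RS: $\rho=\frac{N}{d}\Omega_3$, $\eta=\Omega_4$.
   Context: **Problem and notation.** $\mathbb{Z}_+=\{0,1,2,\dots\}$, $\mathbb{Z}_{++}=\{1,2,\dots\}$, $\|\cdot\|$ is the Euclidean norm. $\zeta$ is a random variable with associated probability space $(\Xi,\mathcal{F},P)$, $f:\mathbb{R}^d\times\Xi\to\mathbb{R}$, and $F(x)=\mathbb{E}_\zeta[f(x,\zeta)]$ is continuously differentiable on $\mathbb{R}^d$; $x^*$ denotes a minimizer of $F$. $\mathbb{E}[\cdot]$ is total expectation. **Gradient estimator.** At iteration $k$, given a sample set $S_k=\{\zeta_1,\dots,\zeta_{|S_k|}\}$, put $F_{S_k}(x)=\frac{1}{|S_k|}\sum_{\zeta_i\in S_k}f(x,\zeta_i)$. Given a finite collection $T_k$ of direction vectors, a sampling radius $\nu>0$ and a scaling $\gamma_k>0$, put $$g_{S_k,T_k}(x_k)=\gamma_k\sum_{u_j\in T_k}\frac{F_{S_k}(x_k+\nu u_j)-F_{S_k}(x_k)}{\nu}\,u_j ,$$ and let $g_{\zeta_i,T_k}(x_k)$ be the same expression with $F_{S_k}$ replaced by $f(\cdot,\zeta_i)$. **Methods.** FD: $\gamma_k=1$, $T_k=\{e_1,\dots,e_d\}$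 (canonical basis, deterministic, $|T_k|=d$). GS: $\gamma_k=1/|T_k|$, $u_j$ i.i.d. $\mathcal{N}(0,I)$. SS: $\gamma_k=d/|T_k|$, $u_j$ i.i.d. uniform on the unit sphere of $\mathbb{R}^d$. RC: $\gamma_k=d/|T_k|$, $T_k$ sampled uniformly without replacement from $\{e_1,\dots,e_d\}$, $|T_k|\le d$. RS: $\gamma_k=d/|T_k|$, $T_k$ sampled uniformly without replacement from a random orthonormal basis $\tilde T_k$ of $\mathbb{R}^d$, $|T_k|\le d$. The directions are drawn afresh at each iteration; $|T_k|$ is non-random. **Conditional expectations.** $\mathcal{F}_k$ is the $\sigma$-algebra generated by $x_0$ and all direction and sample sets used before iteration $k$; $\mathcal{F}_{k+1/2}$ is generated by $\mathcal{F}_k$ and $T_k$. $\mathbb{E}_k[\cdot]=\mathbb{E}_{T_k}[\cdot]=\mathbb{E}[\cdot\mid\mathcal{F}_k]$, $\mathbb{E}_{S_k}[\cdot]=\mathbb{E}[\cdot\mid\mathcal{F}_{k+1/2}]$. $\mathbb{E}_{\zeta_i}$ is expectation over a single sample $\zeta_i$ of $\zeta$, with $x_k,T_k$ held fixed. $g_{T_k}(x_k)=\mathbb{E}_{S_k}[g_{S_k,T_k}(x_k)]$ and $g(x_k)=\mathbb{E}_{T_k}[g_{T_k}(x_k)]$. **Assumptions.** (A1) At every iteration, $S_k$ consists of i.i.d. samples of $\zeta$, so $\mathbb{E}_{\zeta_i}[f(x,\zeta_i)]=F(x)$ for all $x$ and $\zeta_i\in S_k$. (A2) At every iteration, the vectors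 in $T_k$ are chosen independently of the samples of $\zeta$ in $S_k$ (the size $|S_k|$ may depend on $x_k$ and $T_k$). (A4) For every $\zeta$, $f(\cdot,\zeta)$ is continuously differentiable with $\|\nabla f(x,\zeta)-\nabla f(y,\zeta)\|\le L_{\nabla f}\|x-y\|$ for all $x,y$, $L_{\nabla f}<\infty$. This implies $\|\nabla F(x)-\nabla F(y)\|\le L_{\nabla F}\|x-y\|$ for all $x,y$ with some constant $L_{\nabla F}\le L_{\nabla f}$; $L_{\nabla F}>0$ denotes such a constant. (A5) There are $\beta_1,\beta_2\ge0$ with $\mathbb{E}_{\zeta_i}[\|\nabla f(x,\zeta_i)-\nabla F(x)\|^2]\le\beta_1\|\nabla F(x)\|^2+\beta_2$ for all $x\in\mathbb{R}^d$. **Sample size conditions** (with $\theta>0$). Write $V_k=\mathbb{E}_{\zeta_i}[\|g_{\zeta_i,T_k}(x_k)-g_{T_k}(x_k)\|^2]$. Condition 1: $V_k/|S_k|\le\theta^2\|g_{T_k}(x_k)\|^2$. Condition 2: $V_k/|S_k|\le\theta^2\,\mathbb{E}_{T_k}[\|g_{T_k}(x_k)\|^2]$. Condition 3: $\mathbb{E}_{T_k}[V_k]/|S_k|\le\theta^2\,\mathbb{E}_{T_k}[\|g_{T_k}(x_k)\|^2]$. **Strong convexity.** $F$ is called strongly convex with parameter $\mu>0$ if $\|\nabla F(x)\|^2\ge2\mu(F(x)-F(x^* ))$ for all $x\in\mathbb{R}^d$, where $x^*$ is the optimal solution. It is understood that $\mu\le L_{\nabla F}$ (automatic unless $F$ is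 constant). *)

theory Defs
  imports "HOL-Probability.Probability"
begin

datatype estimator = FD | GS | SS | RC | RS

text \<open>
  The directions of one iteration are a family \<open>u\<close> with indices \<open>j < N\<close>, so that repeated
  directions count with multiplicity; \<open>c\<close> is the scaling and \<open>\<nu>\<close> the sampling radius.
\<close>

definition grad_est ::
    "real \<Rightarrow> real \<Rightarrow> nat \<Rightarrow> (nat \<Rightarrow> real ^ 'd) \<Rightarrow> (real ^ 'd \<Rightarrow> real) \<Rightarrow> real ^ 'd \<Rightarrow> real ^ 'd" where
  "grad_est c \<nu> N u \<phi> x = c *\<^sub>R (\<Sum>j<N. ((\<phi> (x + \<nu> *\<^sub>R u j) - \<phi> x) / \<nu>) *\<^sub>R u j)"

fun scaling :: "estimator \<Rightarrow> nat \<Rightarrow> nat \<Rightarrow> real" where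
  "scaling FD N d = 1"
| "scaling GS N d = 1 / real N"
| "scaling SS N d = real d / real N"
| "scaling RC N d = real d / real N"
| "scaling RS N d = real d / real N"

text \<open>
  The normalized surface measure of the unit sphere, obtained by projecting the uniform
  distribution on the unit ball radially (\<open>sgn x = x / norm x\<close>; the value at the origin is
  irrelevant).
\<close>

definition uniform_sphere :: "(real ^ 'd) measure" where
  "uniform_sphere = distr (uniform_measure lborel (ball 0 1)) borel sgn"

text \<open>
  \<open>u\<close> enumerates \<open>N\<close> vectors sampled uniformly without replacement from the family \<open>B\<close> of
  distinct vectors: the set of chosen indices is uniform among the index sets of size \<open>N\<close> and
  independent of \<open>B\<close>. The order in which the chosen vectors are listed is arbitrary.
\<close>

definition sampled_without_replacement ::
    "'w measure \<Rightarrow> nat \<Rightarrow> ('d::finite \<Rightarrow> 'w \<Rightarrow> real ^ 'd) \<Rightarrow> (nat \<Rightarrow> 'w \<Rightarrow> real ^ 'd) \<Rightarrow> bool" where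
  "sampled_without_replacement M N B u \<longleftrightarrow>
     (\<exists>J :: 'w \<Rightarrow> 'd set.
        J \<in> measurable M (count_space UNIV) \<and>
        distr M (count_space UNIV) J = measure_pmf (pmf_of_set {A. card A = N}) \<and>
        prob_space.indep_set M
          (sets (vimage_algebra (space M) (\<lambda>\<omega> i. B i \<omega>) (PiM UNIV (\<lambda>_. borel))))
          (sets (vimage_algebra (space M) J (count_space UNIV))) \<and>
        (\<forall>\<omega>\<in>space M. bij_betw (\<lambda>j. u j \<omega>) {..<N} ((\<lambda>i. B i \<omega>) ` J \<omega>)))"

text \<open>
  The law of the \<open>N\<close> directions of one iteration. In the case \<open>RS\<close> the random orthonormal basis
  may have any distribution.
\<close>

fun directions :: "estimator \<Rightarrow> 'w measure \<Rightarrow> nat \<Rightarrow> (nat \<Rightarrow> 'w \<Rightarrow> real ^ 'd::finite) \<Rightarrow> bool" where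
  "directions FD M N u \<longleftrightarrow> N = CARD('d) \<and>
     (\<exists>e. bij_betw e {..<N} (Basis :: (real ^ 'd) set) \<and> (\<forall>j<N. \<forall>\<omega>\<in>space M. u j \<omega> = e j))"
| "directions GS M N u \<longleftrightarrow>
     prob_space.indep_vars M (\<lambda>_. borel) u {..<N} \<and>
     (\<forall>j<N. distributed M lborel (u j) (\<lambda>v. ennreal (\<Prod>i\<in>UNIV. std_normal_density (v $ i))))"
| "directions SS M N u \<longleftrightarrow>
     prob_space.indep_vars M (\<lambda>_. borel) u {..<N} \<and>
     (\<forall>j<N. distr M borel (u j) = uniform_sphere)"
| "directions RC M N u \<longleftrightarrow> N \<le> CARD('d) \<and>
     sampled_without_replacement M N (\<lambda>i \<omega>. axis i 1) u"
| "directions RS M N u \<longleftrightarrow> N \<le> CARD('d) \<and>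
     (\<exists>B :: 'd \<Rightarrow> 'w \<Rightarrow> real ^ 'd.
        (\<forall>\<omega>\<in>space M. \<forall>i j. B i \<omega> \<bullet> B j \<omega> = (if i = j then 1 else 0)) \<and>
        sampled_without_replacement M N B u)"

text \<open>
  The \<open>\<sigma>\<close>-algebra generated by the directions of the iterations \<open>l < a\<close> and the sample sets of
  the iterations \<open>l < b\<close>, where the sample set of iteration \<open>l\<close> consists of \<open>Z l i\<close> with
  \<open>i < n l\<close>. The events \<open>{i < n l, Z l i \<in> A}\<close> generate both the random size (take \<open>A\<close> to be
  the whole space) and the members of the sample set.
  With \<open>\<H> = history M P N U Z n\<close> and a deterministic starting point, \<open>\<F>\<^sub>k\<close> is
  \<open>\<H> k k\<close> and \<open>\<F>\<close> at \<open>k + 1/2\<close> is \<open>\<H> (Suc k) k\<close>.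
\<close>

definition history ::
    "'w measure \<Rightarrow> 'z measure \<Rightarrow> nat \<Rightarrow> (nat \<Rightarrow> nat \<Rightarrow> 'w \<Rightarrow> real ^ 'd) \<Rightarrow> (nat \<Rightarrow> nat \<Rightarrow> 'w \<Rightarrow> 'z) \<Rightarrow>
     (nat \<Rightarrow> 'w \<Rightarrow> nat) \<Rightarrow> nat \<Rightarrow> nat \<Rightarrow> 'w measure" where
  "history M P N U Z n a b = sigma (space M)
     ({U l j -` A \<inter> space M | l j A. l < a \<and> j < N \<and> A \<in> sets borel} \<union>
      {{\<omega> \<in> space M. i < n l \<omega> \<and> Z l i \<omega> \<in> A} | l i A. l < b \<and> A \<in> sets P})"

text \<open>The library has conditional expectation for real random variables only.\<close>

definition vec_cond_exp ::
    "'w measure \<Rightarrow> 'w measure \<Rightarrow> ('w \<Rightarrow> real ^ 'd) \<Rightarrow> 'w \<Rightarrow> real ^ 'd" where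
  "vec_cond_exp M G X = (\<lambda>\<omega>. \<chi> i. real_cond_exp M G (\<lambda>\<omega>'. X \<omega>' $ i) \<omega>)"

definition Omega1 :: "real \<Rightarrow> real \<Rightarrow> real" where
  "Omega1 \<theta> L = 1 / (4 * (1 + \<theta>\<^sup>2) * L)"

definition Omega3 :: "real \<Rightarrow> real \<Rightarrow> real \<Rightarrow> real" where
  "Omega3 \<theta> L \<mu> = \<mu> / (8 * (1 + \<theta>\<^sup>2) * L)"

definition Omega4 :: "real \<Rightarrow> real \<Rightarrow> real \<Rightarrow> nat \<Rightarrow> real" where
  "Omega4 L \<mu> \<nu> d = 3 * L\<^sup>2 * \<nu>\<^sup>2 * real d / (8 * \<mu>)"

fun step_size :: "estimator \<Rightarrow> nat \<Rightarrow> nat \<Rightarrow> real \<Rightarrow> real \<Rightarrow> real" where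
  "step_size FD N d \<theta> L = Omega1 \<theta> L"
| "step_size GS N d \<theta> L = real N / (real N + 4.5 * real d) * Omega1 \<theta> L"
| "step_size SS N d \<theta> L = real N / (real N + 4.5 * real d) * Omega1 \<theta> L"
| "step_size RC N d \<theta> L = real N / real d * Omega1 \<theta> L"
| "step_size RS N d \<theta> L = real N / real d * Omega1 \<theta> L"

fun rate :: "estimator \<Rightarrow> nat \<Rightarrow> nat \<Rightarrow> real \<Rightarrow> real \<Rightarrow> real \<Rightarrow> real" where
  "rate FD N d \<theta> L \<mu> = Omega3 \<theta> L \<mu>"
| "rate GS N d \<theta> L \<mu> = real N / (real N + 4.5 * real d) * Omega3 \<theta> L \<mu>"
| "rate SS N d \<theta> L \<mu> = real N / (real N + 4.5 * real d) * Omega3 \<theta> L \<mu>"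
| "rate RC N d \<theta> L \<mu> = real N / real d * Omega3 \<theta> L \<mu>"
| "rate RS N d \<theta> L \<mu> = real N / real d * Omega3 \<theta> L \<mu>"

fun neighborhood :: "estimator \<Rightarrow> nat \<Rightarrow> nat \<Rightarrow> real \<Rightarrow> real \<Rightarrow> real \<Rightarrow> real" where
  "neighborhood FD N d L \<mu> \<nu> = Omega4 L \<mu> \<nu> d"
| "neighborhood GS N d L \<mu> \<nu> =
     (8 * real N + 24 * real d + (real d + 2) * (real d + 4)) / (2 * real N + 9 * real d)
       * Omega4 L \<mu> \<nu> d"
| "neighborhood SS N d L \<mu> \<nu> =
     (8 * real N + 24 * real d + (real d)\<^sup>2) / ((2 * real N + 9 * real d) * real d)
       * Omega4 L \<mu> \<nu> d"
| "neighborhood RC N d L \<mu> \<nu> = Omega4 L \<mu> \<nu> d"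
| "neighborhood RS N d L \<mu> \<nu> = Omega4 L \<mu> \<nu> d"

end

theory Submission
  imports Defs
begin

text \<open>
  Conditionally on the past and on the current directions, the sample average is an unbiased
  estimate of the finite-difference estimator of \<open>F\<close>, and the sample size conditions bound its
  variance, in expectation, by \<open>\<theta>\<^sup>2\<close> times the expected squared norm of that estimator. The descent
  inequality for functions with Lipschitz gradient therefore reduces the theorem to a lower bound,
  for fixed \<open>x\<close>, of \<open>E[\<nabla>F \<bullet> g] - \<kappa> E[|g|\<^sup>2]\<close> with \<open>g\<close> the estimator of \<open>F\<close>. For orthonormal directions this
  bound holds coordinate by coordinate. For isotropic directions it follows from an estimate of the
  bias \<open>E[g] - \<nabla>F\<close>, which is of order \<open>L \<nu> d^(1/2)\<close> (Gaussian) or \<open>L \<nu>\<close> (sphere); the sharp dependence on the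
  dimension comes from Stein's identity and from the invariance under reflections, respectively.
\<close>

section \<open>Functions with Lipschitz gradient\<close>

text \<open>Write \<alpha> for the step size. The descent inequality and the sampling error leave
  the weight \<kappa> = \<alpha> L (1 + \<theta>^2) / 2 on the squared estimator, and
  \<open>Omega1\<close> is chosen so that \<kappa> = b / 8, with b equal to 1, N / (N + 4.5 d) or N
  / d. The lower bound aimed at is |grad F|^2 / 4 - \<mu> \<eta> / 2: strong convexity turns its
  first term into \<mu> / 2 times the gap, so one step contracts the gap by \<rho> = \<alpha> \<mu>
  / 2 towards the fixed point \<eta>. As N grows, \<eta> tends to a constant times L^2 \<nu>^2 d /
  \<mu> (Gaussian) or L^2 \<nu>^2 / \<mu> (sphere); averaging more directions cannot repair a crude
  bias estimate, which is why the bias needs its sharp order. Two obstacles shape the probabilistic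
  part. The sample size may depend on the current directions, so in the third size condition its
  reciprocal cannot be pulled out of the conditional expectation given the past. Integrability of
  the gap at the iterates is not given; it is carried through the induction, where it controls the
  squared gradient and, by independence and sixth moments of the directions, the estimators.\<close>

lemma lipschitz_gradient_bound:
  fixes F :: "'a::real_inner \<Rightarrow> real"
  assumes G: "\<And>y. GDERIV F y :> g y"
    and L: "\<And>y y'. norm (g y - g y') \<le> L * norm (y - y')"
  shows "\<bar>F (x + h) - F x - g x \<bullet> h\<bar> \<le> L / 2 * (norm h)\<^sup>2"
proof -
  have D: "((\<lambda>t. F (x + t *\<^sub>R h)) has_real_derivative (g (x + t *\<^sub>R h) \<bullet> h)) (at t)" for t :: real
  proof -
    have "((\<lambda>t. F (x + t *\<^sub>R h)) has_derivative (\<lambda>s. (s *\<^sub>R h) \<bullet> g (x + t *\<^sub>R h))) (at t)"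
      by (rule has_derivative_compose[of "\<lambda>t. x + t *\<^sub>R h" "\<lambda>s. s *\<^sub>R h" t UNIV F])
         (auto intro!: derivative_eq_intros simp: G[unfolded gderiv_def])
    then show ?thesis
      by (rule has_derivative_imp_has_field_derivative) (simp add: inner_commute)
  qed
  have b: "\<bar>g (x + t *\<^sub>R h) \<bullet> h - g x \<bullet> h\<bar> \<le> L * t * (norm h)\<^sup>2" if "t \<ge> 0" for t
  proof -
    have "\<bar>(g (x + t *\<^sub>R h) - g x) \<bullet> h\<bar> \<le> norm (g (x + t *\<^sub>R h) - g x) * norm h"
      by (rule Cauchy_Schwarz_ineq2)
    also have "\<dots> \<le> (L * norm (t *\<^sub>R h)) * norm h"
      using L[of "x + t *\<^sub>R h" x] by (intro mult_right_mono) auto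
    finally show ?thesis using that by (simp add: inner_diff_left power2_eq_square mult_ac)
  qed
  \<comment> \<open>The quadratic corrections make the error monotone in \<open>t\<close> on the
    unit interval, by \<open>b\<close>; comparing the endpoints \<open>0\<close> and
    \<open>1\<close> gives the two halves of the absolute value.\<close>
  have "F (x + 1 *\<^sub>R h) - 1 * (g x \<bullet> h) - L / 2 * 1\<^sup>2 * (norm h)\<^sup>2
      \<le> F (x + 0 *\<^sub>R h) - 0 * (g x \<bullet> h) - L / 2 * 0\<^sup>2 * (norm h)\<^sup>2"
    by (rule DERIV_nonpos_imp_nonincreasing[of 0 1 "\<lambda>t. F (x + t *\<^sub>R h) - t * (g x \<bullet> h) - L / 2 * t\<^sup>2 * (norm h)\<^sup>2"])
       (use b in \<open>auto intro!: exI derivative_eq_intros D simp: abs_le_iff algebra_simps\<close>)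
  moreover have "F (x + 0 *\<^sub>R h) - 0 * (g x \<bullet> h) + L / 2 * 0\<^sup>2 * (norm h)\<^sup>2
      \<le> F (x + 1 *\<^sub>R h) - 1 * (g x \<bullet> h) + L / 2 * 1\<^sup>2 * (norm h)\<^sup>2"
    by (rule DERIV_nonneg_imp_nondecreasing[of 0 1 "\<lambda>t. F (x + t *\<^sub>R h) - t * (g x \<bullet> h) + L / 2 * t\<^sup>2 * (norm h)\<^sup>2"])
       (use b in \<open>auto intro!: exI derivative_eq_intros D simp: abs_le_iff algebra_simps\<close>)
  ultimately show ?thesis unfolding abs_le_iff by (simp add: algebra_simps)
qed

text \<open>A gradient step with factor 1 / L lowers \<open>F\<close> by at least |g x|^2 / (2 L)
  and cannot lead below \<open>m\<close>. This makes the squared gradient at an iterate integrable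
  as soon as the gap is.\<close>

lemma gradient_square_le:
  fixes F :: "'a::real_inner \<Rightarrow> real"
  assumes G: "\<And>y. GDERIV F y :> g y"
    and L: "\<And>y y'. norm (g y - g y') \<le> L * norm (y - y')" "0 < L"
    and m: "\<And>y. m \<le> F y"
  shows "(norm (g x))\<^sup>2 \<le> 2 * L * (F x - m)"
proof -
  have "m \<le> F (x + (- 1 / L) *\<^sub>R g x)" by (rule m)
  also have "\<dots> \<le> F x - (norm (g x))\<^sup>2 / L + L / 2 * ((norm (g x))\<^sup>2 / L\<^sup>2)"
    using lipschitz_gradient_bound[OF G L(1), of x "(- 1 / L) *\<^sub>R g x"] \<open>0 < L\<close>
    by (simp add: power_mult_distrib power_divide abs_le_iff power2_norm_eq_inner)
  also have "\<dots> = F x - (norm (g x))\<^sup>2 / (2 * L)"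
    using \<open>0 < L\<close> by (simp add: field_simps power2_eq_square)
  finally show ?thesis using \<open>0 < L\<close> by (simp add: field_simps)
qed

section \<open>Independence\<close>

context prob_space
begin

text \<open>The identity map, read as a random element with values in \<open>G\<close>, carries all
  information of \<open>G\<close>. Pairing it with \<open>X\<close> turns independence into a
  product law, so that conditioning on \<open>G\<close> becomes Fubini with the outcome
  frozen.\<close>

lemma distr_pair_subalgebra:
  assumes sub: "subalgebra M G" and X[measurable]: "X \<in> measurable M T"
    and ind: "indep_set (sets G) (sets (vimage_algebra (space M) X T))"
  shows "distr M (G \<Otimes>\<^sub>M T) (\<lambda>\<omega>. (\<omega>, X \<omega>)) = restr_to_subalg M G \<Otimes>\<^sub>M distr M T X"
proof -
  have id[measurable]: "(\<lambda>\<omega>. \<omega>) \<in> measurable M G"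
    using sub by (auto simp: measurable_def subalgebra_def)
  interpret R: prob_space "restr_to_subalg M G"
    by (rule prob_space_restr_to_subalg[OF sub prob_space_axioms])
  interpret Q: prob_space "distr M T X" by (rule prob_space_distr[OF X])
  note [measurable_cong] = sets_restr_to_subalg[OF sub]
  show ?thesis
  proof (rule pair_measure_eqI[symmetric])
    fix A B assume "A \<in> sets (restr_to_subalg M G)" and "B \<in> sets (distr M T X)"
    then have A[measurable]: "A \<in> sets G" and B[measurable]: "B \<in> sets T"
      by (simp_all add: sets_restr_to_subalg[OF sub])
    have "A \<subseteq> space M" using sets.sets_into_space[OF A] sub by (simp add: subalgebra_def)
    then have "(\<lambda>\<omega>. (\<omega>, X \<omega>)) -` (A \<times> B) \<inter> space M = A \<inter> (X -` B \<inter> space M)" by auto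
    moreover have "prob (A \<inter> (X -` B \<inter> space M)) = prob A * prob (X -` B \<inter> space M)"
      using ind A B by (simp add: indep_sets2_eq in_vimage_algebra)
    ultimately show "emeasure (restr_to_subalg M G) A * emeasure (distr M T X) B
        = emeasure (distr M (G \<Otimes>\<^sub>M T) (\<lambda>\<omega>. (\<omega>, X \<omega>))) (A \<times> B)"
      by (simp add: emeasure_restr_to_subalg[OF sub] emeasure_distr emeasure_eq_measure ennreal_mult)
  qed (unfold_locales, simp_all cong: sets_pair_measure_cong add: sets_restr_to_subalg[OF sub])
qed

section \<open>Integrating out an independent variable\<close>

context
  fixes G T X
  assumes sub: "subalgebra M G" and X[measurable]: "X \<in> measurable M T"
    and ind: "indep_set (sets G) (sets (vimage_algebra (space M) X T))"
begin

text \<open>The version for nonnegative functions, from which integrability itself is obtained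
  later.\<close>

lemma nn_integral_independent:
  assumes h[measurable]: "case_prod h \<in> borel_measurable (G \<Otimes>\<^sub>M T)"
  shows "(\<integral>\<^sup>+\<omega>. h \<omega> (X \<omega>) \<partial>M) = (\<integral>\<^sup>+\<omega>. (\<integral>\<^sup>+\<omega>'. h \<omega> (X \<omega>') \<partial>M) \<partial>M)"
proof -
  have id[measurable]: "(\<lambda>\<omega>. \<omega>) \<in> measurable M G"
    using sub by (auto simp: measurable_def subalgebra_def)
  interpret R: prob_space "restr_to_subalg M G"
    by (rule prob_space_restr_to_subalg[OF sub prob_space_axioms])
  interpret Q: prob_space "distr M T X" by (rule prob_space_distr[OF X])
  note [measurable_cong] = sets_restr_to_subalg[OF sub]
  have "(\<integral>\<^sup>+\<omega>. h \<omega> (X \<omega>) \<partial>M) = (\<integral>\<^sup>+p. case_prod h p \<partial>distr M (G \<Otimes>\<^sub>M T) (\<lambda>\<omega>. (\<omega>, X \<omega>)))"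
    by (subst nn_integral_distr) auto
  also have "\<dots> = (\<integral>\<^sup>+\<omega>. (\<integral>\<^sup>+t. h \<omega> t \<partial>distr M T X) \<partial>restr_to_subalg M G)"
    unfolding distr_pair_subalgebra[OF sub X ind]
    by (subst Q.nn_integral_fst[symmetric]) simp_all
  also have "\<dots> = (\<integral>\<^sup>+\<omega>. (\<integral>\<^sup>+t. h \<omega> t \<partial>distr M T X) \<partial>M)"
    by (rule nn_integral_subalgebra2[OF sub]) measurable
  also have "\<dots> = (\<integral>\<^sup>+\<omega>. (\<integral>\<^sup>+\<omega>'. h \<omega> (X \<omega>') \<partial>M) \<partial>M)"
    using sub by (intro nn_integral_cong nn_integral_distr) (auto simp: subalgebra_def)
  finally show ?thesis .
qed

lemma
  fixes h :: "_ \<Rightarrow> _ \<Rightarrow> real"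
  assumes h[measurable]: "case_prod h \<in> borel_measurable (G \<Otimes>\<^sub>M T)"
    and int: "integrable M (\<lambda>\<omega>. h \<omega> (X \<omega>))"
  shows borel_measurable_integral_independent: "(\<lambda>\<omega>. LINT \<omega>'|M. h \<omega> (X \<omega>')) \<in> borel_measurable G"
    and integrable_integral_independent: "integrable M (\<lambda>\<omega>. LINT \<omega>'|M. h \<omega> (X \<omega>'))"
    and integral_independent: "(LINT \<omega>|M. h \<omega> (X \<omega>)) = (LINT \<omega>|M. LINT \<omega>'|M. h \<omega> (X \<omega>'))"
proof -
  have id[measurable]: "(\<lambda>\<omega>. \<omega>) \<in> measurable M G"
    using sub by (auto simp: measurable_def subalgebra_def)
  interpret R: prob_space "restr_to_subalg M G"
    by (rule prob_space_restr_to_subalg[OF sub prob_space_axioms])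
  interpret Q: prob_space "distr M T X" by (rule prob_space_distr[OF X])
  interpret RQ: pair_sigma_finite "restr_to_subalg M G" "distr M T X" ..
  note [measurable_cong] = sets_restr_to_subalg[OF sub]
  have inner: "(LINT \<omega>'|M. h \<omega> (X \<omega>')) = (LINT t|distr M T X. h \<omega> t)" if "\<omega> \<in> space M" for \<omega>
    using that sub by (subst integral_distr) (auto simp: subalgebra_def)
  have sp: "space G = space M" using sub by (simp add: subalgebra_def)
  have [measurable]: "(\<lambda>\<omega>. LINT t|distr M T X. h \<omega> t) \<in> borel_measurable G"
    by measurable
  then show 1: "(\<lambda>\<omega>. LINT \<omega>'|M. h \<omega> (X \<omega>')) \<in> borel_measurable G"
    by (subst measurable_cong[OF inner]) (simp_all add: sp)
  have K: "integrable (restr_to_subalg M G \<Otimes>\<^sub>M distr M T X) (case_prod h)"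
    unfolding distr_pair_subalgebra[OF sub X ind, symmetric]
    using int by (subst integrable_distr_eq) auto
  have "integrable M (\<lambda>\<omega>. LINT t|distr M T X. h \<omega> t)"
    using RQ.integrable_fst'[OF K] by (intro integrable_from_subalg[OF sub]) simp
  then show "integrable M (\<lambda>\<omega>. LINT \<omega>'|M. h \<omega> (X \<omega>'))"
    by (subst Bochner_Integration.integrable_cong[OF refl inner]) simp_all
  have "(LINT \<omega>|M. h \<omega> (X \<omega>)) = (LINT p|distr M (G \<Otimes>\<^sub>M T) (\<lambda>\<omega>. (\<omega>, X \<omega>)). case_prod h p)"
    by (subst integral_distr) auto
  also have "\<dots> = (LINT \<omega>|restr_to_subalg M G. LINT t|distr M T X. h \<omega> t)"
    unfolding distr_pair_subalgebra[OF sub X ind] RQ.integral_fst'[OF K, symmetric] by simp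
  also have "\<dots> = (LINT \<omega>|M. LINT t|distr M T X. h \<omega> t)"
    by (rule integral_subalgebra2[OF sub]) measurable
  also have "\<dots> = (LINT \<omega>|M. LINT \<omega>'|M. h \<omega> (X \<omega>'))"
    by (intro Bochner_Integration.integral_cong inner[symmetric]) auto
  finally show "(LINT \<omega>|M. h \<omega> (X \<omega>)) = (LINT \<omega>|M. LINT \<omega>'|M. h \<omega> (X \<omega>'))" .
qed

text \<open>Multiplying \<open>h\<close> by the indicator of an event of \<open>G\<close> keeps its
  form, so the defining identity of the conditional expectation is again an instance of
  \<open>integral_independent\<close>.\<close>

lemma real_cond_exp_independent:
  fixes h :: "_ \<Rightarrow> _ \<Rightarrow> real"
  assumes h[measurable]: "case_prod h \<in> borel_measurable (G \<Otimes>\<^sub>M T)"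
    and int: "integrable M (\<lambda>\<omega>. h \<omega> (X \<omega>))"
  shows "AE \<omega> in M. real_cond_exp M G (\<lambda>\<omega>. h \<omega> (X \<omega>)) \<omega> = (LINT \<omega>'|M. h \<omega> (X \<omega>'))"
proof -
  interpret finite_measure_subalgebra M G by unfold_locales (rule sub)
  show ?thesis
  proof (rule real_cond_exp_charact)
    fix A assume A[measurable]: "A \<in> sets G"
    have AM: "A \<in> sets M" using A sub by (auto simp: subalgebra_def)
    have "(LINT \<omega>|M. indicator A \<omega> * h \<omega> (X \<omega>))
        = (LINT \<omega>|M. LINT \<omega>'|M. indicator A \<omega> * h \<omega> (X \<omega>'))"
      using integrable_mult_indicator[OF AM int]
      by (intro integral_independent[of "\<lambda>\<omega> t. indicator A \<omega> * h \<omega> t"]) simp_all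
    then show "(\<integral>\<omega>\<in>A. h \<omega> (X \<omega>) \<partial>M) = (\<integral>\<omega>\<in>A. (LINT \<omega>'|M. h \<omega> (X \<omega>')) \<partial>M)"
      by (simp add: set_lebesgue_integral_def)
  qed (use int borel_measurable_integral_independent[OF h int] integrable_integral_independent[OF h int] in auto)
qed

end

section \<open>Square integrability and second moments\<close>

lemma square_integrable_imp_integrable_norm:
  fixes f :: "'a \<Rightarrow> 'b::euclidean_space"
  assumes "f \<in> borel_measurable M" "integrable M (\<lambda>\<omega>. (norm (f \<omega>))\<^sup>2)"
  shows "integrable M f"
proof (rule Bochner_Integration.integrable_bound[of M "\<lambda>\<omega>. 1 + (norm (f \<omega>))\<^sup>2"])
  show "AE \<omega> in M. norm (f \<omega>) \<le> norm (1 + (norm (f \<omega>))\<^sup>2)"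
  proof (intro AE_I2)
    fix \<omega>
    have "0 \<le> (norm (f \<omega>) - 1 / 2)\<^sup>2" by simp
    then have "norm (f \<omega>) \<le> 1 + (norm (f \<omega>))\<^sup>2" by (simp add: power2_diff power_divide)
    then show "norm (f \<omega>) \<le> norm (1 + (norm (f \<omega>))\<^sup>2)" by simp
  qed
qed (use assms in auto)

lemma square_integrable_inner:
  fixes f g :: "'a \<Rightarrow> 'b::euclidean_space"
  assumes [measurable]: "f \<in> borel_measurable M" "g \<in> borel_measurable M"
    and "integrable M (\<lambda>\<omega>. (norm (f \<omega>))\<^sup>2)" "integrable M (\<lambda>\<omega>. (norm (g \<omega>))\<^sup>2)"
  shows "integrable M (\<lambda>\<omega>. f \<omega> \<bullet> g \<omega>)"
proof (rule Bochner_Integration.integrable_bound[of M "\<lambda>\<omega>. (norm (f \<omega>))\<^sup>2 + (norm (g \<omega>))\<^sup>2"])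
  show "AE \<omega> in M. norm (f \<omega> \<bullet> g \<omega>) \<le> norm ((norm (f \<omega>))\<^sup>2 + (norm (g \<omega>))\<^sup>2)"
  proof (intro AE_I2)
    fix \<omega>
    have "\<bar>f \<omega> \<bullet> g \<omega>\<bar> \<le> norm (f \<omega>) * norm (g \<omega>)" by (rule Cauchy_Schwarz_ineq2)
    also have "\<dots> \<le> 2 * norm (f \<omega>) * norm (g \<omega>)" by simp
    also have "\<dots> \<le> (norm (f \<omega>))\<^sup>2 + (norm (g \<omega>))\<^sup>2" by (rule sum_squares_bound)
    finally show "norm (f \<omega> \<bullet> g \<omega>) \<le> norm ((norm (f \<omega>))\<^sup>2 + (norm (g \<omega>))\<^sup>2)" by simp
  qed
qed (use assms in auto)

lemma indep_vars_integral_inner: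
  fixes X :: "'i \<Rightarrow> 'a \<Rightarrow> 'b::euclidean_space"
  assumes ind: "indep_vars (\<lambda>_. borel) X I" and ij: "i \<in> I" "j \<in> I" "i \<noteq> j"
    and int: "integrable M (X i)" "integrable M (X j)"
  shows "expectation (\<lambda>\<omega>. X i \<omega> \<bullet> X j \<omega>) = expectation (X i) \<bullet> expectation (X j)"
proof -
  have b: "indep_vars (\<lambda>_. borel) (\<lambda>k \<omega>. X k \<omega> \<bullet> b) {i, j}" for b
    using ij by (intro indep_vars_compose2[OF indep_vars_subset[OF ind]]) auto
  have Xb: "integrable M (\<lambda>\<omega>. X k \<omega> \<bullet> b)" if "k \<in> {i, j}" for k b
    using that int by auto
  have int': "integrable M (\<lambda>\<omega>. (X i \<omega> \<bullet> b) * (X j \<omega> \<bullet> b))"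
    and E: "expectation (\<lambda>\<omega>. (X i \<omega> \<bullet> b) * (X j \<omega> \<bullet> b)) = (expectation (X i) \<bullet> b) * (expectation (X j) \<bullet> b)" for b
    using indep_vars_integrable[OF _ b Xb] indep_vars_lebesgue_integral[OF _ b Xb] ij(3) int by simp_all
  have "expectation (\<lambda>\<omega>. X i \<omega> \<bullet> X j \<omega>) = expectation (\<lambda>\<omega>. \<Sum>b\<in>Basis. (X i \<omega> \<bullet> b) * (X j \<omega> \<bullet> b))"
    by (simp add: euclidean_inner[symmetric])
  also have "\<dots> = (\<Sum>b\<in>Basis. (expectation (X i) \<bullet> b) * (expectation (X j) \<bullet> b))"
    by (subst Bochner_Integration.integral_sum) (simp_all add: int' E)
  also have "\<dots> = expectation (X i) \<bullet> expectation (X j)"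
    by (rule euclidean_inner[symmetric])
  finally show ?thesis .
qed

text \<open>The double sum of inner products has \<open>n\<close> diagonal and
  \<open>n * (n - 1)\<close> off-diagonal terms. It is applied to the direction terms, whose mean
  carries the bias, and to the centred sample terms, whose mean vanishes.\<close>

lemma iid_sum_second_moment:
  fixes X :: "nat \<Rightarrow> 'a \<Rightarrow> 'b::euclidean_space"
  assumes ind: "indep_vars (\<lambda>_. borel) X {..<n}"
    and law: "\<And>j. j < n \<Longrightarrow> distr M borel (X j) = D"
    and sq: "integrable D (\<lambda>v. (norm v)\<^sup>2)"
  shows "integrable M (\<lambda>\<omega>. (norm (\<Sum>j<n. X j \<omega>))\<^sup>2)"
    and "expectation (\<lambda>\<omega>. (norm (\<Sum>j<n. X j \<omega>))\<^sup>2)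
       = real n * (LINT v|D. (norm v)\<^sup>2) + real n * (real n - 1) * (norm (LINT v|D. v))\<^sup>2"
    and "expectation (\<lambda>\<omega>. \<Sum>j<n. X j \<omega>) = real n *\<^sub>R (LINT v|D. v)"
    and "integrable M (\<lambda>\<omega>. \<Sum>j<n. X j \<omega>)"
proof -
  have rv[measurable]: "X j \<in> borel_measurable M" if "j < n" for j
    using ind that by (auto simp: indep_vars_def)
  have sqX: "integrable M (\<lambda>\<omega>. (norm (X j \<omega>))\<^sup>2)"
    and EsqX: "expectation (\<lambda>\<omega>. (norm (X j \<omega>))\<^sup>2) = (LINT v|D. (norm v)\<^sup>2)"
    and EX: "expectation (X j) = (LINT v|D. v)" if "j < n" for j
    using sq that rv[OF that] unfolding law[OF that, symmetric]
    by (auto simp: integrable_distr_eq integral_distr)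
  have intX: "integrable M (X j)" if "j < n" for j
    using square_integrable_imp_integrable_norm[OF rv sqX] that by auto
  have inn: "integrable M (\<lambda>\<omega>. X i \<omega> \<bullet> X j \<omega>)" if "i < n" "j < n" for i j
    using that by (intro square_integrable_inner rv sqX)
  have prod: "expectation (\<lambda>\<omega>. X i \<omega> \<bullet> X j \<omega>) = (if i = j then (LINT v|D. (norm v)\<^sup>2) else (norm (LINT v|D. v))\<^sup>2)"
    if "i < n" "j < n" for i j
  proof (cases "i = j")
    case True
    then show ?thesis using EsqX[OF that(1)] by (simp add: power2_norm_eq_inner)
  next
    case False
    then show ?thesis
      using that by (simp add: indep_vars_integral_inner[OF ind] intX EX power2_norm_eq_inner)
  qed
  have eq: "(norm (\<Sum>j<n. X j \<omega>))\<^sup>2 = (\<Sum>i<n. \<Sum>j<n. X i \<omega> \<bullet> X j \<omega>)" for \<omega>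
    unfolding power2_norm_eq_inner inner_sum_left unfolding inner_sum_right ..
  show "integrable M (\<lambda>\<omega>. (norm (\<Sum>j<n. X j \<omega>))\<^sup>2)"
    unfolding eq by (intro Bochner_Integration.integrable_sum inn) auto
  have "expectation (\<lambda>\<omega>. (norm (\<Sum>j<n. X j \<omega>))\<^sup>2) = (\<Sum>i<n. \<Sum>j<n. expectation (\<lambda>\<omega>. X i \<omega> \<bullet> X j \<omega>))"
    unfolding eq using inn by (subst Bochner_Integration.integral_sum)
      (auto intro!: sum.cong Bochner_Integration.integral_sum Bochner_Integration.integrable_sum)
  also have "\<dots> = (\<Sum>i<n. \<Sum>j<n. (norm (LINT v|D. v))\<^sup>2
      + (if i = j then (LINT v|D. (norm v)\<^sup>2) - (norm (LINT v|D. v))\<^sup>2 else 0))"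
    by (intro sum.cong) (auto simp: prod)
  also have "\<dots> = real n * (LINT v|D. (norm v)\<^sup>2) + real n * (real n - 1) * (norm (LINT v|D. v))\<^sup>2"
    by (simp add: sum.distrib algebra_simps)
  finally show "expectation (\<lambda>\<omega>. (norm (\<Sum>j<n. X j \<omega>))\<^sup>2)
       = real n * (LINT v|D. (norm v)\<^sup>2) + real n * (real n - 1) * (norm (LINT v|D. v))\<^sup>2" .
  show "expectation (\<lambda>\<omega>. \<Sum>j<n. X j \<omega>) = real n *\<^sub>R (LINT v|D. v)"
    by (simp add: intX EX sum_constant_scaleR)
  show "integrable M (\<lambda>\<omega>. \<Sum>j<n. X j \<omega>)"
    by (intro Bochner_Integration.integrable_sum) (simp add: intX)
qed

end

section \<open>Invariance of Lebesgue measure\<close>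

lemma nn_integral_lborel_translation:
  fixes c :: "'a::euclidean_space"
  assumes "f \<in> borel_measurable borel"
  shows "(\<integral>\<^sup>+y. f (y + c) \<partial>lborel) = (\<integral>\<^sup>+y. f y \<partial>lborel)"
  using assms by (subst (2) lborel_affine[of 1 c]) (simp_all add: density_1 nn_integral_distr add.commute)

lemma nn_integral_lborel_uminus:
  fixes f :: "'a::euclidean_space \<Rightarrow> ennreal"
  assumes "f \<in> borel_measurable borel"
  shows "(\<integral>\<^sup>+y. f (- y) \<partial>lborel) = (\<integral>\<^sup>+y. f y \<partial>lborel)"
  using assms by (subst (2) lborel_affine[of "-1" 0]) (simp_all add: density_1 nn_integral_distr)

text \<open>
  The uniqueness argument for Haar measure, applied to the image measure of an orthogonal map;
  the normalization is determined by the unit ball, which the map preserves.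
\<close>

lemma distr_lborel_orthogonal_transformation:
  fixes T :: "'a::euclidean_space \<Rightarrow> 'a"
  assumes T: "orthogonal_transformation T"
  shows "distr lborel borel T = lborel"
proof (rule measure_eqI)
  have [simp]: "norm (T x) = norm x" for x
    by (rule orthogonal_transformation_norm[OF T])
  have lin: "linear T" by (rule orthogonal_transformation_linear[OF T])
  have [measurable]: "T \<in> borel_measurable borel"
    using lin by (intro borel_measurable_continuous_onI linear_continuous_on) (simp add: linear_conv_bounded_linear)
  \<comment> \<open>Writing \<open>y\<close> as \<open>T (S y)\<close> turns a translation after
    \<open>T\<close> into one before \<open>T\<close>, so the image measure inherits translation
    invariance.\<close>
  obtain S where S: "T (S y) = y" for y
    using orthogonal_transformation_surj[OF T] by (metis surjD)
  have TS: "T (x + S y) = T x + y" for x y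
    by (simp add: linear_add[OF lin] S)
  have T_transl: "(\<integral>\<^sup>+x. \<phi> (T x + y) \<partial>lborel) = (\<integral>\<^sup>+x. \<phi> (T x) \<partial>lborel)"
    if [measurable]: "\<phi> \<in> borel_measurable borel" for \<phi> :: "'a \<Rightarrow> ennreal" and y
    using nn_integral_lborel_translation[of "\<lambda>x. \<phi> (T x)" "S y"] by (simp add: TS)
  have [measurable]: "ball 0 1 \<in> sets (borel :: 'a measure)" by simp
  let ?f = "indicator (ball 0 1) :: 'a \<Rightarrow> ennreal"
  let ?b = "emeasure lborel (ball (0 :: 'a) 1)"
  have b1: "(\<integral>\<^sup>+x. ?f (T x) \<partial>lborel) = ?b"
    by (simp add: indicator_def flip: nn_integral_indicator)
  have b2: "(\<integral>\<^sup>+x. ?f x \<partial>lborel) = ?b" by simp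
  fix A assume "A \<in> sets (distr lborel borel T)"
  then have [measurable]: "A \<in> sets borel" by simp
  let ?g = "indicator A :: 'a \<Rightarrow> ennreal"
  \<comment> \<open>The same double integral is evaluated in two ways: \<open>A\<close> is first
    translated by \<open>T x\<close>, then, after exchanging the integrals and shifting
    \<open>x\<close> back, the ball is translated instead. The outcome is the measure of the ball
    times the image measure of \<open>A\<close>.\<close>
  have "?b * (\<integral>\<^sup>+y. ?g y \<partial>lborel) = (\<integral>\<^sup>+x. ?f (T x) \<partial>lborel) * (\<integral>\<^sup>+y. ?g y \<partial>lborel)"
    by (simp only: b1)
  also have "\<dots> = (\<integral>\<^sup>+x. ?f (T x) * (\<integral>\<^sup>+y. ?g y \<partial>lborel) \<partial>lborel)"
    by (rule nn_integral_multc[symmetric]) measurable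
  also have "\<dots> = (\<integral>\<^sup>+x. ?f (T x) * (\<integral>\<^sup>+y. ?g (y + T x) \<partial>lborel) \<partial>lborel)"
    by (simp only: nn_integral_lborel_translation borel_measurable_indicator \<open>A \<in> sets borel\<close>)
  also have "\<dots> = (\<integral>\<^sup>+x. (\<integral>\<^sup>+y. ?f (T x) * ?g (T x + y) \<partial>lborel) \<partial>lborel)"
    by (subst nn_integral_cmult[symmetric]) (simp_all add: add.commute)
  also have "\<dots> = (\<integral>\<^sup>+y. (\<integral>\<^sup>+x. ?f (T x) * ?g (T x + y) \<partial>lborel) \<partial>lborel)"
    by (rule lborel_pair.Fubini') measurable
  also have "\<dots> = (\<integral>\<^sup>+y. (\<integral>\<^sup>+x. ?f (T x - y) * ?g (T x) \<partial>lborel) \<partial>lborel)"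
  proof (rule nn_integral_cong)
    fix y
    show "(\<integral>\<^sup>+x. ?f (T x) * ?g (T x + y) \<partial>lborel) = (\<integral>\<^sup>+x. ?f (T x - y) * ?g (T x) \<partial>lborel)"
      using T_transl[of "\<lambda>v. ?f (v - y) * ?g v" y] by simp
  qed
  also have "\<dots> = (\<integral>\<^sup>+x. (\<integral>\<^sup>+y. ?f (T x - y) * ?g (T x) \<partial>lborel) \<partial>lborel)"
    by (rule lborel_pair.Fubini') measurable
  also have "\<dots> = (\<integral>\<^sup>+x. (\<integral>\<^sup>+y. ?f (T x - y) \<partial>lborel) * ?g (T x) \<partial>lborel)"
    by (simp add: nn_integral_multc)
  also have "\<dots> = (\<integral>\<^sup>+x. ?b * ?g (T x) \<partial>lborel)"
  proof (intro nn_integral_cong arg_cong2[where f="(*)"] refl)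
    fix x
    have "(\<integral>\<^sup>+y. ?f (T x - y) \<partial>lborel) = (\<integral>\<^sup>+y. ?f (T x + y) \<partial>lborel)"
      using nn_integral_lborel_uminus[of "\<lambda>y. ?f (T x + y)"] by simp
    also have "\<dots> = ?b"
      using nn_integral_lborel_translation[of ?f "T x"] by (simp add: add.commute)
    finally show "(\<integral>\<^sup>+y. ?f (T x - y) \<partial>lborel) = ?b" .
  qed
  also have "\<dots> = ?b * (\<integral>\<^sup>+x. ?g x \<partial>distr lborel borel T)"
    by (subst nn_integral_distr, measurable) (rule nn_integral_cmult, measurable)
  finally have "?b * emeasure lborel A = ?b * emeasure (distr lborel borel T) A" by simp
  moreover have "?b \<noteq> 0" "?b \<noteq> \<infinity>"
    using content_ball_gt_0_iff[of "0 :: 'a" 1] by (auto simp: measure_def)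
  ultimately show "emeasure (distr lborel borel T) A = emeasure lborel A"
    by (simp add: ennreal_mult_cancel_left)
qed simp

section \<open>Forward differences along orthonormal directions\<close>

lemma forward_difference_error:
  fixes F :: "'a::real_inner \<Rightarrow> real"
  assumes G: "\<And>y. GDERIV F y :> g y"
    and L: "\<And>y y'. norm (g y - g y') \<le> L * norm (y - y')" and "0 < \<nu>"
  shows "\<bar>(F (x + \<nu> *\<^sub>R u) - F x) / \<nu> - g x \<bullet> u\<bar> \<le> L * \<nu> / 2 * (norm u)\<^sup>2"
proof -
  have "(F (x + \<nu> *\<^sub>R u) - F x) / \<nu> - g x \<bullet> u = (F (x + \<nu> *\<^sub>R u) - F x - g x \<bullet> (\<nu> *\<^sub>R u)) / \<nu>"
    using \<open>0 < \<nu>\<close> by (simp add: field_simps)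
  also have "\<bar>\<dots>\<bar> \<le> (L / 2 * (norm (\<nu> *\<^sub>R u))\<^sup>2) / \<nu>"
    using divide_right_mono[OF lipschitz_gradient_bound[OF G L, of x "\<nu> *\<^sub>R u"], of \<nu>] \<open>0 < \<nu>\<close> by simp
  also have "\<dots> = L * \<nu> / 2 * (norm u)\<^sup>2"
    using \<open>0 < \<nu>\<close> by (simp add: power_mult_distrib power2_eq_square)
  finally show ?thesis .
qed

lemma norm_sum_orthonormal:
  fixes B :: "'i \<Rightarrow> 'a::real_inner"
  assumes fin: "finite I" and B: "\<And>i j. i \<in> I \<Longrightarrow> j \<in> I \<Longrightarrow> B i \<bullet> B j = (if i = j then 1 else 0)"
  shows "(norm (\<Sum>i\<in>I. t i *\<^sub>R B i))\<^sup>2 = (\<Sum>i\<in>I. (t i)\<^sup>2)"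
proof -
  have "(norm (\<Sum>i\<in>I. t i *\<^sub>R B i))\<^sup>2 = (\<Sum>i\<in>I. \<Sum>j\<in>I. t i * (t j * (B i \<bullet> B j)))"
    unfolding power2_norm_eq_inner inner_sum_left unfolding inner_sum_right
    by (intro sum.cong refl) simp
  also have "\<dots> = (\<Sum>i\<in>I. \<Sum>j\<in>I. if i = j then t i * t j else 0)"
    by (intro sum.cong) (auto simp: B)
  finally show ?thesis using fin by (simp add: power2_eq_square)
qed

lemma Parseval:
  fixes B :: "'i \<Rightarrow> 'a::euclidean_space"
  assumes card: "card I = DIM('a)" and B: "\<And>i j. i \<in> I \<Longrightarrow> j \<in> I \<Longrightarrow> B i \<bullet> B j = (if i = j then 1 else 0)"
  shows "(\<Sum>i\<in>I. (v \<bullet> B i)\<^sup>2) = (norm v)\<^sup>2"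
proof -
  have fin: "finite I" using card by (metis DIM_positive card_gt_0_iff)
  have inj: "inj_on B I" by (rule inj_onI) (metis B zero_neq_one)
  have orth: "pairwise orthogonal (B ` I)"
    using B by (auto simp: pairwise_def orthogonal_def)
  have "independent (B ` I)"
    using orth B by (intro pairwise_orthogonal_independent) force+
  then have span: "span (B ` I) = UNIV"
    using card card_image[OF inj] by (metis dim_UNIV dim_eq_full dim_eq_card_independent)
  have "v = (\<Sum>b\<in>B ` I. (v \<bullet> b) *\<^sub>R b)"
    using orth fin B span by (intro orthonormal_basis_expand[symmetric]) (auto simp: norm_eq_1)
  also have "\<dots> = (\<Sum>i\<in>I. (v \<bullet> B i) *\<^sub>R B i)"
    by (simp add: sum.reindex[OF inj])
  finally show ?thesis using norm_sum_orthonormal[OF fin B, of "\<lambda>i. v \<bullet> B i"] by simp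
qed

text \<open>With \<open>r = D - a\<close> the two sides differ by a positive form in
  \<open>a\<close> and \<open>r\<close> plus \<open>3 / 4\<close> of the slack between
  \<open>r\<close> and \<open>e\<close>, both squared. The form is 3/8 (a + r)^2 + 1/4 (a^2 + r^2),
  and the weight \<open>3 / 4\<close> is the one that enters \<open>Omega4\<close>.\<close>

lemma coordinate_difference_bound:
  fixes a D :: real
  assumes "\<bar>D - a\<bar> \<le> e"
  shows "a\<^sup>2 / 4 - 3 / 4 * e\<^sup>2 \<le> D * a - D\<^sup>2 / 8"
proof -
  define r where "r = D - a"
  have 1: "r\<^sup>2 \<le> e\<^sup>2" using assms unfolding r_def by (intro abs_le_square_iff[THEN iffD1]) simp
  have 2: "0 \<le> 5 / 8 * (a\<^sup>2 + r\<^sup>2) + 3 / 4 * (a * r)"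
  proof -
    have "0 \<le> (a + r)\<^sup>2" by simp
    then have "0 \<le> a\<^sup>2 + r\<^sup>2 + 2 * (a * r)" by (simp add: power2_sum)
    moreover have "0 \<le> a\<^sup>2" "0 \<le> r\<^sup>2" by simp_all
    moreover have "5 / 8 * (a\<^sup>2 + r\<^sup>2) + 3 / 4 * (a * r) = 3 / 8 * (a\<^sup>2 + r\<^sup>2 + 2 * (a * r)) + 1 / 4 * (a\<^sup>2 + r\<^sup>2)"
      by (simp add: field_simps)
    ultimately show ?thesis by simp
  qed
  have 3: "D * a - D\<^sup>2 / 8 - (a\<^sup>2 / 4 - 3 / 4 * e\<^sup>2)
      = 5 / 8 * (a\<^sup>2 + r\<^sup>2) + 3 / 4 * (a * r) + 3 / 4 * (e\<^sup>2 - r\<^sup>2)"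
    by (simp add: r_def power2_eq_square field_simps)
  have "0 \<le> D * a - D\<^sup>2 / 8 - (a\<^sup>2 / 4 - 3 / 4 * e\<^sup>2)"
    unfolding 3 by (rule add_nonneg_nonneg[OF 2]) (use 1 in simp)
  then show ?thesis by (simp only: diff_ge_0_iff_ge)
qed

text \<open>Deleting \<open>i\<close> matches the sets containing \<open>i\<close> with the sets of
  size \<open>N - 1\<close> avoiding it, and N C(d, N) = d C(d - 1, N - 1). This inclusion
  probability is what the sampling methods use of the law of the index set.\<close>

lemma prob_mem_uniform_subset:
  assumes "0 < N" "N \<le> CARD('d::finite)"
  shows "measure (pmf_of_set {A :: 'd set. card A = N}) {A. i \<in> A} = real N / real CARD('d)"
proof -
  let ?S = "{A :: 'd set. card A = N}"
  have cS: "card ?S = CARD('d) choose N"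
    using n_subsets[of "UNIV :: 'd set" N] by simp
  then have ne: "?S \<noteq> {}" using assms by (metis card.empty zero_less_binomial less_irrefl)
  have "?S \<inter> {A. i \<in> A} = insert i ` {A. A \<subseteq> UNIV - {i} \<and> card A = N - 1}"
  proof (intro equalityI subsetI)
    fix A assume "A \<in> ?S \<inter> {A. i \<in> A}"
    then have "A = insert i (A - {i})" "card (A - {i}) = N - 1" by auto
    then show "A \<in> insert i ` {A. A \<subseteq> UNIV - {i} \<and> card A = N - 1}" by blast
  qed (use assms in \<open>auto simp: card_insert_if\<close>)
  moreover have "inj_on (insert i) {A. A \<subseteq> UNIV - {i} \<and> card A = N - 1}"
    by (rule inj_onI) (auto simp: insert_ident subset_Diff_insert)
  ultimately have "card (?S \<inter> {A. i \<in> A}) = (CARD('d) - 1) choose (N - 1)"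
    using n_subsets[of "UNIV - {i}" "N - 1"] by (simp add: card_image)
  then have "real N * real (card ?S) = real CARD('d) * real (card (?S \<inter> {A. i \<in> A}))"
    using times_binomial_minus1_eq[OF assms(1), of "CARD('d)"] by (simp add: cS flip: of_nat_mult)
  moreover have "card ?S > 0" using ne by (simp add: card_gt_0_iff)
  ultimately show ?thesis
    using ne by (simp add: measure_pmf_of_set field_simps)
qed

text \<open>Gives the weight \<open>\<alpha> * L * (1 + \<theta>\<^sup>2) / 2\<close> of the squared
  estimator the value \<open>b / 8\<close> for every step size
  \<open>b * Omega1 \<theta> L\<close>.\<close>

lemma Omega1_scale: "0 < L \<Longrightarrow> Omega1 \<theta> L * L * (1 + \<theta>\<^sup>2) = 1 / 4"
  by (simp add: Omega1_def field_simps power2_eq_square add_pos_nonneg less_imp_neq[symmetric])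

text \<open>The right-hand side is the loss in \<open>coordinate_difference_bound\<close>, summed
  over \<open>d\<close> orthonormal directions with error \<open>e = L * \<nu> / 2\<close>
  each.\<close>

lemma Omega4_scale: "0 < \<mu> \<Longrightarrow> \<mu> * Omega4 L \<mu> \<nu> d / 2 = real d * (3 / 4 * (L * \<nu> / 2)\<^sup>2)"
  by (simp add: Omega4_def field_simps power2_eq_square)

lemma integrable_norm_power_mono:
  fixes f :: "'a \<Rightarrow> 'b::euclidean_space"
  assumes "finite_measure M" and [measurable]: "f \<in> borel_measurable M"
    and int: "integrable M (\<lambda>\<omega>. norm (f \<omega>) ^ n)" and "k \<le> n"
  shows "integrable M (\<lambda>\<omega>. norm (f \<omega>) ^ k)"
proof -
  interpret finite_measure M by fact
  show ?thesis
  proof (rule Bochner_Integration.integrable_bound[of M "\<lambda>\<omega>. 1 + norm (f \<omega>) ^ n"])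
    show "AE \<omega> in M. norm (norm (f \<omega>) ^ k) \<le> norm (1 + norm (f \<omega>) ^ n)"
    proof (intro AE_I2)
      fix \<omega>
      have "norm (f \<omega>) ^ k \<le> 1 + norm (f \<omega>) ^ n"
      proof (cases "norm (f \<omega>) \<le> 1")
        case True
        then show ?thesis using power_le_one[of "norm (f \<omega>)" k] by (simp add: add_increasing2)
      next
        case False
        then have "norm (f \<omega>) ^ k \<le> norm (f \<omega>) ^ n" by (intro power_increasing[OF \<open>k \<le> n\<close>]) simp
        then show ?thesis by linarith
      qed
      then show "norm (norm (f \<omega>) ^ k) \<le> norm (1 + norm (f \<omega>) ^ n)" by simp
    qed
  qed (use int in auto)
qed

text \<open>Free of probability, so that the estimates apply to the expected objective and also to
  each single sample function.\<close>

locale forward_difference =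
  fixes F :: "real ^ 'd \<Rightarrow> real" and gradF :: "real ^ 'd \<Rightarrow> real ^ 'd" and L \<nu> :: real
  assumes gradF: "\<And>y. GDERIV F y :> gradF y"
    and lipschitz: "\<And>y y'. norm (gradF y - gradF y') \<le> L * norm (y - y')"
    and L_pos: "0 < L" and \<nu>_pos: "0 < \<nu>"
begin

definition quot :: "real ^ 'd \<Rightarrow> real ^ 'd \<Rightarrow> real" where
  "quot x u = (F (x + \<nu> *\<^sub>R u) - F x) / \<nu>"

lemma grad_est_quot: "grad_est c \<nu> N u F x = c *\<^sub>R (\<Sum>j<N. quot x (u j) *\<^sub>R u j)"
  by (simp add: grad_est_def quot_def)

lemma quot_error: "\<bar>quot x u - gradF x \<bullet> u\<bar> \<le> L * \<nu> / 2 * (norm u)\<^sup>2"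
  unfolding quot_def by (rule forward_difference_error[OF gradF lipschitz \<nu>_pos])

lemma continuous_F: "continuous_on UNIV F"
  using gradF by (auto intro!: continuous_at_imp_continuous_on has_derivative_continuous simp: gderiv_def)

lemma borel_measurable_quot[measurable]:
  assumes [measurable]: "x \<in> borel_measurable M" "u \<in> borel_measurable M"
  shows "(\<lambda>\<omega>. quot (x \<omega>) (u \<omega>)) \<in> borel_measurable M"
proof -
  have [measurable]: "F \<in> borel_measurable borel" by (rule borel_measurable_continuous_onI[OF continuous_F])
  show ?thesis unfolding quot_def by measurable
qed

lemma quot_square_le: "(quot x u)\<^sup>2 \<le> 2 * (gradF x \<bullet> u)\<^sup>2 + L\<^sup>2 * \<nu>\<^sup>2 / 2 * norm u ^ 4"
proof -
  have "(quot x u - gradF x \<bullet> u)\<^sup>2 \<le> (L * \<nu> / 2 * (norm u)\<^sup>2)\<^sup>2"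
    using power_mono[OF quot_error[of x u], of 2] by simp
  also have "\<dots> = L\<^sup>2 * \<nu>\<^sup>2 / 4 * norm u ^ 4"
    by (simp add: power_mult_distrib power_divide flip: power_mult)
  finally have "2 * (gradF x \<bullet> u)\<^sup>2 + 2 * (quot x u - gradF x \<bullet> u)\<^sup>2 \<le> 2 * (gradF x \<bullet> u)\<^sup>2 + 2 * (L\<^sup>2 * \<nu>\<^sup>2 / 4 * norm u ^ 4)"
    by simp
  moreover have "(quot x u)\<^sup>2 \<le> 2 * (gradF x \<bullet> u)\<^sup>2 + 2 * (quot x u - gradF x \<bullet> u)\<^sup>2"
    using zero_le_power2[of "quot x u - 2 * (gradF x \<bullet> u)"]
    by (simp add: power2_eq_square algebra_simps)
  ultimately show ?thesis by simp
qed

lemma orthonormal_bound: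
  fixes B :: "'i \<Rightarrow> real ^ 'd"
  assumes card: "card I = CARD('d)"
    and B: "\<And>i j. i \<in> I \<Longrightarrow> j \<in> I \<Longrightarrow> B i \<bullet> B j = (if i = j then 1 else 0)"
  shows "(norm (gradF x))\<^sup>2 / 4 - real CARD('d) * (3 / 4 * (L * \<nu> / 2)\<^sup>2)
    \<le> (\<Sum>i\<in>I. quot x (B i) * (gradF x \<bullet> B i) - (quot x (B i))\<^sup>2 / 8)"
proof -
  have "(norm (gradF x))\<^sup>2 / 4 - real CARD('d) * (3 / 4 * (L * \<nu> / 2)\<^sup>2)
      = (\<Sum>i\<in>I. (gradF x \<bullet> B i)\<^sup>2 / 4 - 3 / 4 * (L * \<nu> / 2)\<^sup>2)"
    using Parseval[of I B "gradF x"] card B by (simp add: sum_subtractf flip: sum_divide_distrib)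
  also have "\<dots> \<le> (\<Sum>i\<in>I. quot x (B i) * (gradF x \<bullet> B i) - (quot x (B i))\<^sup>2 / 8)"
  proof (intro sum_mono coordinate_difference_bound)
    fix i assume "i \<in> I"
    then have "norm (B i) = 1" using B[of i i] by (simp add: norm_eq_1)
    then show "\<bar>quot x (B i) - gradF x \<bullet> B i\<bar> \<le> L * \<nu> / 2" using quot_error[of x "B i"] by simp
  qed
  finally show ?thesis .
qed

text \<open>Orthonormality makes the squared norm a sum over the directions, and the weight
  \<open>1 / (8 * c)\<close> lowers its factor from c^2 to c / 8. The expression becomes additive in
  the index set, which is what sampling without replacement calls for.\<close>

lemma orthonormal_estimate:
  fixes B :: "'i \<Rightarrow> real ^ 'd"
  assumes "finite J" and B: "\<And>i j. i \<in> J \<Longrightarrow> j \<in> J \<Longrightarrow> B i \<bullet> B j = (if i = j then 1 else 0)"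
    and u: "bij_betw u {..<N} (B ` J)" and "0 < c"
  shows "gradF x \<bullet> grad_est c \<nu> N u F x - 1 / (8 * c) * (norm (grad_est c \<nu> N u F x))\<^sup>2
    = c * (\<Sum>i\<in>J. quot x (B i) * (gradF x \<bullet> B i) - (quot x (B i))\<^sup>2 / 8)"
proof -
  have inj: "inj_on B J" by (rule inj_onI) (metis B zero_neq_one)
  have "(\<Sum>j<N. quot x (u j) *\<^sub>R u j) = (\<Sum>b\<in>B ` J. quot x b *\<^sub>R b)"
    by (rule sum.reindex_bij_betw[OF u])
  also have "\<dots> = (\<Sum>i\<in>J. quot x (B i) *\<^sub>R B i)"
    by (simp add: sum.reindex[OF inj])
  finally have g: "grad_est c \<nu> N u F x = c *\<^sub>R (\<Sum>i\<in>J. quot x (B i) *\<^sub>R B i)"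
    by (simp add: grad_est_quot)
  have "1 / (8 * c) * (norm (grad_est c \<nu> N u F x))\<^sup>2 = c * (\<Sum>i\<in>J. (quot x (B i))\<^sup>2) / 8"
    using norm_sum_orthonormal[OF assms(1) B, of "\<lambda>i. quot x (B i)"] \<open>0 < c\<close>
    by (simp add: g power_mult_distrib power2_eq_square)
  moreover have "gradF x \<bullet> grad_est c \<nu> N u F x = c * (\<Sum>i\<in>J. quot x (B i) * (gradF x \<bullet> B i))"
    by (simp add: g inner_sum_right)
  ultimately show ?thesis
    by (simp add: sum_subtractf right_diff_distrib flip: sum_divide_distrib)
qed

text \<open>The inclusion probability \<open>1 / c\<close> of each index cancels the factor
  \<open>c\<close>; there remains a sum over a full orthonormal basis, bounded outcome by outcome.
  Linearity of expectation takes care of the dependence between the chosen indices.\<close>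

lemma sampling_bound:
  fixes B :: "'d \<Rightarrow> 'w \<Rightarrow> real ^ 'd"
  assumes "prob_space M" and N: "0 < N" "N \<le> CARD('d)"
    and B: "\<And>\<omega> i j. \<omega> \<in> space M \<Longrightarrow> B i \<omega> \<bullet> B j \<omega> = (if i = j then 1 else 0)"
    and S: "sampled_without_replacement M N B u"
  defines "c \<equiv> real CARD('d) / real N"
  shows "(norm (gradF x))\<^sup>2 / 4 - real CARD('d) * (3 / 4 * (L * \<nu> / 2)\<^sup>2)
    \<le> (LINT \<omega>|M. gradF x \<bullet> grad_est c \<nu> N (\<lambda>j. u j \<omega>) F x
          - 1 / (8 * c) * (norm (grad_est c \<nu> N (\<lambda>j. u j \<omega>) F x))\<^sup>2)"
    and "\<And>\<omega> j. \<omega> \<in> space M \<Longrightarrow> j < N \<Longrightarrow> norm (u j \<omega>) = 1"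
proof -
  interpret prob_space M by fact
  obtain J :: "'w \<Rightarrow> 'd set" where J[measurable]: "J \<in> measurable M (count_space UNIV)"
    and law: "distr M (count_space UNIV) J = measure_pmf (pmf_of_set {A. card A = N})"
    and ind: "indep_set (sets (vimage_algebra (space M) (\<lambda>\<omega> i. B i \<omega>) (PiM UNIV (\<lambda>_. borel))))
          (sets (vimage_algebra (space M) J (count_space UNIV)))"
    and u: "\<And>\<omega>. \<omega> \<in> space M \<Longrightarrow> bij_betw (\<lambda>j. u j \<omega>) {..<N} ((\<lambda>i. B i \<omega>) ` J \<omega>)"
    using S unfolding sampled_without_replacement_def by blast
  show "norm (u j \<omega>) = 1" if "\<omega> \<in> space M" "j < N" for \<omega> j
    using bij_betw_apply[OF u[OF that(1)], of j] that B[OF that(1)] by (auto simp: norm_eq_1)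
  define G where "G = vimage_algebra (space M) (\<lambda>\<omega> i. B i \<omega>) (PiM UNIV (\<lambda>_. borel :: (real ^ 'd) measure))"
  have sub: "subalgebra M G"
    using indep_setD_ev1[OF ind] by (auto simp: subalgebra_def G_def)
  have BG[measurable]: "B i \<in> borel_measurable G" for i
  proof -
    have "(\<lambda>\<omega> i. B i \<omega>) \<in> measurable G (PiM UNIV (\<lambda>_. borel))"
      unfolding G_def by (rule measurable_vimage_algebra1) (simp add: space_PiM)
    from measurable_compose[OF this measurable_component_singleton[of i]] show ?thesis by simp
  qed
  have BM[measurable]: "B i \<in> borel_measurable M" for i
    by (rule measurable_from_subalg[OF sub BG])
  define \<phi> where "\<phi> b = quot x b * (gradF x \<bullet> b) - (quot x b)\<^sup>2 / 8" for b
  have [measurable]: "\<phi> \<in> borel_measurable borel" unfolding \<phi>_def by measurable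
  have int\<phi>: "integrable M (\<lambda>\<omega>. \<phi> (B i \<omega>))" for i
  proof (rule integrable_const_bound[where B="(norm (gradF x) + L * \<nu>)\<^sup>2 * 2"])
    show "AE \<omega> in M. norm (\<phi> (B i \<omega>)) \<le> (norm (gradF x) + L * \<nu>)\<^sup>2 * 2"
    proof (intro AE_I2)
      fix \<omega> assume "\<omega> \<in> space M"
      then have nb: "norm (B i \<omega>) = 1" using B[of \<omega> i i] by (simp add: norm_eq_1)
      let ?K = "norm (gradF x) + L * \<nu>"
      have a: "\<bar>gradF x \<bullet> B i \<omega>\<bar> \<le> norm (gradF x)"
        using Cauchy_Schwarz_ineq2[of "gradF x" "B i \<omega>"] nb by simp
      have p: "0 < L * \<nu>" using L_pos \<nu>_pos by simp
      then have a': "\<bar>gradF x \<bullet> B i \<omega>\<bar> \<le> ?K" using a by linarith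
      have q: "\<bar>quot x (B i \<omega>)\<bar> \<le> ?K"
      proof -
        have "\<bar>quot x (B i \<omega>) - gradF x \<bullet> B i \<omega>\<bar> \<le> L * \<nu> / 2"
          using quot_error[of x "B i \<omega>"] nb by simp
        moreover have "\<bar>quot x (B i \<omega>)\<bar> \<le> \<bar>quot x (B i \<omega>) - gradF x \<bullet> B i \<omega>\<bar> + \<bar>gradF x \<bullet> B i \<omega>\<bar>"
          by arith
        ultimately show ?thesis using a p by linarith
      qed
      have "\<bar>\<phi> (B i \<omega>)\<bar> \<le> \<bar>quot x (B i \<omega>)\<bar> * \<bar>gradF x \<bullet> B i \<omega>\<bar> + \<bar>quot x (B i \<omega>)\<bar>\<^sup>2"
        unfolding \<phi>_def abs_mult[symmetric]
        by (rule order_trans[OF abs_triangle_ineq4]) simp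
      also have "\<dots> \<le> ?K * ?K + ?K\<^sup>2"
        using q a' by (intro add_mono mult_mono power_mono) auto
      finally show "norm (\<phi> (B i \<omega>)) \<le> ?K\<^sup>2 * 2" by (simp add: power2_eq_square)
    qed
  qed measurable
  have c: "0 < c" using N by (simp add: c_def)
  have EJ: "(LINT \<omega>|M. indicator {A. i \<in> A} (J \<omega>)) = 1 / c" for i
  proof -
    have "(LINT \<omega>|M. indicator {A. i \<in> A} (J \<omega>)) = (LINT A|distr M (count_space UNIV) J. indicator {A. i \<in> A} A :: real)"
      by (rule integral_distr[symmetric]) auto
    also have "\<dots> = 1 / c"
      unfolding law using prob_mem_uniform_subset[OF N, of i] by (simp add: c_def)
    finally show ?thesis .
  qed
  have int1: "integrable M (\<lambda>\<omega>. indicator {A. i \<in> A} (J \<omega>) * \<phi> (B i \<omega>))" for i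
    by (rule Bochner_Integration.integrable_bound[OF int\<phi>[of i]]) (auto simp: indicator_def)
  \<comment> \<open>The basis is \<open>G\<close>-measurable and the index set independent of
    \<open>G\<close>, so the indicator averages to \<open>1 / c\<close> with the basis
    frozen.\<close>
  have E1: "(LINT \<omega>|M. indicator {A. i \<in> A} (J \<omega>) * \<phi> (B i \<omega>)) = (LINT \<omega>|M. \<phi> (B i \<omega>)) / c" for i
    using integral_independent[OF sub J ind[folded G_def], of "\<lambda>\<omega> A. indicator {A. i \<in> A} A * \<phi> (B i \<omega>)"] int1[of i]
    by (simp add: EJ)
  have "(norm (gradF x))\<^sup>2 / 4 - real CARD('d) * (3 / 4 * (L * \<nu> / 2)\<^sup>2)
      \<le> (LINT \<omega>|M. (\<Sum>i\<in>UNIV. \<phi> (B i \<omega>)))"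
    using orthonormal_bound[of "UNIV :: 'd set" "\<lambda>i. B i _" x] B int\<phi>
    by (intro integral_ge_const AE_I2) (auto simp: \<phi>_def)
  also have "\<dots> = (\<Sum>i\<in>UNIV. LINT \<omega>|M. \<phi> (B i \<omega>))"
    by (rule Bochner_Integration.integral_sum) (rule int\<phi>)
  also have "\<dots> = c * (\<Sum>i\<in>UNIV. LINT \<omega>|M. indicator {A. i \<in> A} (J \<omega>) * \<phi> (B i \<omega>))"
    unfolding E1 using c by (simp flip: sum_divide_distrib)
  also have "\<dots> = (LINT \<omega>|M. c * (\<Sum>i\<in>UNIV. indicator {A. i \<in> A} (J \<omega>) * \<phi> (B i \<omega>)))"
    unfolding integral_mult_right_zero by (subst Bochner_Integration.integral_sum) (simp_all only: int1)
  also have "\<dots> = (LINT \<omega>|M. gradF x \<bullet> grad_est c \<nu> N (\<lambda>j. u j \<omega>) F x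
          - 1 / (8 * c) * (norm (grad_est c \<nu> N (\<lambda>j. u j \<omega>) F x))\<^sup>2)"
  proof (rule Bochner_Integration.integral_cong[OF refl])
    fix \<omega> assume \<omega>: "\<omega> \<in> space M"
    have "(\<Sum>i\<in>UNIV. indicator {A. i \<in> A} (J \<omega>) * \<phi> (B i \<omega>)) = (\<Sum>i\<in>J \<omega>. \<phi> (B i \<omega>))"
      by (rule sum.mono_neutral_cong_right) (auto simp: indicator_def)
    then show "c * (\<Sum>i\<in>UNIV. indicator {A. i \<in> A} (J \<omega>) * \<phi> (B i \<omega>))
        = gradF x \<bullet> grad_est c \<nu> N (\<lambda>j. u j \<omega>) F x - 1 / (8 * c) * (norm (grad_est c \<nu> N (\<lambda>j. u j \<omega>) F x))\<^sup>2"
      using orthonormal_estimate[of "J \<omega>" "\<lambda>i. B i \<omega>", OF _ _ u[OF \<omega>] c, of x] B[OF \<omega>] by (simp add: \<phi>_def)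
  qed
  finally show "(norm (gradF x))\<^sup>2 / 4 - real CARD('d) * (3 / 4 * (L * \<nu> / 2)\<^sup>2)
    \<le> (LINT \<omega>|M. gradF x \<bullet> grad_est c \<nu> N (\<lambda>j. u j \<omega>) F x
          - 1 / (8 * c) * (norm (grad_est c \<nu> N (\<lambda>j. u j \<omega>) F x))\<^sup>2)" .
qed

end

section \<open>The uniform distribution on the sphere\<close>

text \<open>For \<open>a = 0\<close> the formula gives the identity, so that the map is orthogonal
  for every \<open>a\<close>.\<close>

definition householder :: "'a::real_inner \<Rightarrow> 'a \<Rightarrow> 'a" where
  "householder a v = v - (2 * (a \<bullet> v) / (a \<bullet> a)) *\<^sub>R a"

lemma orthogonal_transformation_householder:
  "orthogonal_transformation (householder (a :: 'a::euclidean_space))"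
proof (cases "a = 0")
  case True
  then show ?thesis by (simp add: householder_def[abs_def])
next
  case False
  have "linear (householder a)"
    by (rule linearI) (simp_all add: householder_def algebra_simps inner_add_right scaleR_add_left add_divide_distrib)
  then show ?thesis
    using False by (simp add: orthogonal_transformation_def householder_def inner_diff_left inner_diff_right inner_commute field_simps)
qed

lemma inner_householder: "v \<bullet> householder a u = householder a v \<bullet> u"
  by (simp add: householder_def inner_diff_left inner_diff_right inner_commute)

lemma householder_self: "householder a a = - a"
  by (cases "a = 0") (simp_all add: householder_def algebra_simps flip: scaleR_2)

text \<open>The mirror is the perpendicular bisector of \<open>v\<close> and \<open>w\<close>. Hence
  a reflection-invariant law has the same second moment along all unit vectors.\<close>

lemma householder_swap:
  assumes "norm v = norm w"
  shows "householder (v - w) v = w"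
proof (cases "v = w")
  case False
  have "v \<bullet> v = w \<bullet> w" using assms by (metis power2_norm_eq_inner)
  then have "(v - w) \<bullet> (v - w) = 2 * ((v - w) \<bullet> v)"
    by (simp add: inner_diff_left inner_diff_right inner_commute)
  moreover have "(v - w) \<bullet> (v - w) \<noteq> 0" using False by (simp only: inner_eq_zero_iff right_minus_eq not_False_eq_True)
  ultimately have c: "2 * ((v - w) \<bullet> v) / ((v - w) \<bullet> (v - w)) = 1" by (metis divide_self)
  show ?thesis unfolding householder_def c by simp
qed (simp add: householder_def)

lemma prob_space_uniform_ball: "prob_space (uniform_measure lborel (ball (0 :: 'a::euclidean_space) 1))"
  using content_ball_gt_0_iff[of "0 :: 'a" 1]
  by (intro prob_space_uniform_measure) (auto simp: measure_def)

lemma borel_measurable_sgn[measurable]: "(sgn :: 'a::euclidean_space \<Rightarrow> 'a) \<in> borel_measurable borel"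
  unfolding sgn_div_norm[abs_def] by measurable

lemma prob_space_uniform_sphere: "prob_space uniform_sphere"
  unfolding uniform_sphere_def
  by (intro prob_space.prob_space_distr[OF prob_space_uniform_ball]) (simp add: uniform_measure_def)

lemma sets_uniform_sphere[measurable_cong]: "sets uniform_sphere = sets borel"
  by (simp add: uniform_sphere_def)

lemma space_uniform_sphere[simp]: "space uniform_sphere = UNIV"
  by (simp add: uniform_sphere_def)

lemma AE_uniform_sphere: "AE u in (uniform_sphere :: (real ^ 'd) measure). norm u = 1"
proof -
  have "AE v in (lborel :: (real ^ 'd) measure). v \<noteq> 0" by (rule AE_lborel_singleton)
  then have "AE v in uniform_measure lborel (ball (0 :: real ^ 'd) 1). norm (sgn v) = 1"
    by (intro AE_uniform_measureI) (auto simp: norm_sgn)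
  then show ?thesis
    unfolding uniform_sphere_def by (subst AE_distr_iff) (simp_all add: uniform_measure_def)
qed

text \<open>An orthogonal map preserves Lebesgue measure and the unit ball, and it commutes with the
  radial projection \<open>sgn\<close>.\<close>

lemma distr_uniform_sphere:
  fixes T :: "real ^ 'd \<Rightarrow> real ^ 'd"
  assumes T: "orthogonal_transformation T"
  shows "distr uniform_sphere borel T = uniform_sphere"
proof -
  have [simp]: "norm (T x) = norm x" for x
    by (rule orthogonal_transformation_norm[OF T])
  have lin: "linear T" by (rule orthogonal_transformation_linear[OF T])
  have T_m[measurable]: "T \<in> borel_measurable borel"
    using lin by (intro borel_measurable_continuous_onI linear_continuous_on) (simp add: linear_conv_bounded_linear)
  let ?b = "ball (0 :: real ^ 'd) 1"
  have [measurable]: "?b \<in> sets borel" by simp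
  let ?u = "uniform_measure lborel ?b"
  have "distr ?u borel T = ?u"
  proof (rule measure_eqI)
    fix A assume "A \<in> sets (distr ?u borel T)"
    then have [measurable]: "A \<in> sets borel" by simp
    have "?b \<inter> T -` A = T -` (?b \<inter> A)" by auto
    then have "emeasure lborel (?b \<inter> T -` A) = emeasure (distr lborel borel T) (?b \<inter> A)"
      by (simp add: emeasure_distr)
    also have "\<dots> = emeasure lborel (?b \<inter> A)" by (simp add: distr_lborel_orthogonal_transformation[OF T])
    finally show "emeasure (distr ?u borel T) A = emeasure ?u A"
      using measurable_sets_borel[OF T_m \<open>A \<in> sets borel\<close>] by (simp add: emeasure_distr)
  qed simp
  moreover have "T \<circ> sgn = sgn \<circ> T"
    by (simp add: fun_eq_iff sgn_div_norm linear_cmul[OF lin])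
  moreover have [measurable]: "T \<in> measurable ?u borel" "sgn \<in> measurable ?u borel"
    by (simp_all add: uniform_measure_def)
  ultimately show ?thesis
    unfolding uniform_sphere_def by (metis distr_distr T_m borel_measurable_sgn)
qed

lemma integral_uniform_sphere_orthogonal:
  fixes \<phi> :: "real ^ 'd \<Rightarrow> real" and T :: "real ^ 'd \<Rightarrow> real ^ 'd"
  assumes T: "orthogonal_transformation T" and [measurable]: "\<phi> \<in> borel_measurable borel"
  shows "(LINT u|(uniform_sphere :: (real ^ 'd) measure). \<phi> (T u)) = (LINT u|uniform_sphere. \<phi> u)"
proof -
  have [measurable]: "T \<in> borel_measurable borel"
    using orthogonal_transformation_linear[OF T]
    by (intro borel_measurable_continuous_onI linear_continuous_on) (simp add: linear_conv_bounded_linear)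
  show ?thesis by (subst (2) distr_uniform_sphere[OF T, symmetric]) (simp add: integral_distr)
qed

lemma integrable_uniform_sphere:
  fixes \<phi> :: "real ^ 'd \<Rightarrow> 'b::{banach, second_countable_topology}"
  assumes "\<phi> \<in> borel_measurable borel" and b: "\<And>u. norm u = 1 \<Longrightarrow> norm (\<phi> u) \<le> C"
  shows "integrable uniform_sphere \<phi>"
proof -
  interpret prob_space "uniform_sphere :: (real ^ 'd) measure" by (rule prob_space_uniform_sphere)
  show ?thesis
    using assms AE_uniform_sphere by (intro integrable_const_bound[where B=C]) (auto simp: measurable_cong_sets[OF sets_uniform_sphere])
qed

lemma integrable_uniform_sphere_inner:
  "integrable uniform_sphere (\<lambda>u :: real ^ 'd. (v \<bullet> u) * (w \<bullet> u))"
proof (rule integrable_uniform_sphere[where C="norm v * norm w"])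
  fix u :: "real ^ 'd" assume "norm u = 1"
  then show "norm ((v \<bullet> u) * (w \<bullet> u)) \<le> norm v * norm w"
    using mult_mono[OF Cauchy_Schwarz_ineq2[of v u] Cauchy_Schwarz_ineq2[of w u]] by (simp add: abs_mult)
qed measurable

text \<open>Reflections make the value the same for all unit vectors, and over an orthonormal basis
  the squares add up to the squared norm of \<open>u\<close>, which is 1 almost surely.\<close>

lemma uniform_sphere_square:
  fixes w :: "real ^ 'd"
  assumes "norm w = 1"
  shows "(LINT u|uniform_sphere. (w \<bullet> u)\<^sup>2) = 1 / real CARD('d)"
proof -
  interpret prob_space "uniform_sphere :: (real ^ 'd) measure" by (rule prob_space_uniform_sphere)
  have eq: "(LINT u|uniform_sphere. (b \<bullet> u)\<^sup>2) = (LINT u|uniform_sphere. (w \<bullet> u)\<^sup>2)" if "b \<in> Basis" for b :: "real ^ 'd"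
    using integral_uniform_sphere_orthogonal[OF orthogonal_transformation_householder[of "w - b"], of "\<lambda>u. (w \<bullet> u)\<^sup>2"]
      householder_swap[of w b] that assms by (simp add: inner_householder)
  have int: "integrable uniform_sphere (\<lambda>u. (b \<bullet> u)\<^sup>2)" for b :: "real ^ 'd"
    using integrable_uniform_sphere_inner[of b b] by (simp add: power2_eq_square)
  have "real CARD('d) * (LINT u|uniform_sphere. (w \<bullet> u)\<^sup>2)
      = (\<Sum>b\<in>(Basis :: (real ^ 'd) set). LINT u|uniform_sphere. (b \<bullet> u)\<^sup>2)"
    using eq by (simp add: DIM_cart)
  also have "\<dots> = (LINT u|(uniform_sphere :: (real ^ 'd) measure). (\<Sum>b\<in>Basis. (b \<bullet> u)\<^sup>2))"
    using int by simp
  also have "\<dots> = (LINT u|(uniform_sphere :: (real ^ 'd) measure). 1)"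
  proof (rule integral_cong_AE)
    show "AE u in (uniform_sphere :: (real ^ 'd) measure). (\<Sum>b\<in>Basis. (b \<bullet> u)\<^sup>2) = 1"
      using AE_uniform_sphere
    proof eventually_elim
      case (elim u)
      then show ?case using euclidean_inner[of u u] by (simp add: norm_eq_1 power2_eq_square inner_commute)
    qed
  qed measurable
  finally show ?thesis using prob_space by (simp add: field_simps)
qed

lemma uniform_sphere_inner:
  fixes v w :: "real ^ 'd"
  shows "(LINT u|uniform_sphere. (v \<bullet> u) * (w \<bullet> u)) = (v \<bullet> w) / real CARD('d)"
proof -
  have sq: "(LINT u|uniform_sphere. (a \<bullet> u) * (a \<bullet> u)) = (a \<bullet> a) / real CARD('d)" for a :: "real ^ 'd"
  proof (cases "a = 0")
    case False
    have "(a \<bullet> u) * (a \<bullet> u) = (a \<bullet> a) * (sgn a \<bullet> u)\<^sup>2" for u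
      using False by (simp add: sgn_div_norm power_mult_distrib power_inverse power2_norm_eq_inner[symmetric] flip: power2_eq_square)
    then show ?thesis using uniform_sphere_square[of "sgn a"] False by (simp add: norm_sgn)
  qed simp
  \<comment> \<open>Polarization reduces the mixed moment to squares.\<close>
  have "(LINT u|uniform_sphere. (v \<bullet> u) * (w \<bullet> u))
    = (LINT u|uniform_sphere. (((v + w) \<bullet> u) * ((v + w) \<bullet> u) - ((v - w) \<bullet> u) * ((v - w) \<bullet> u)) / 4)"
    by (intro Bochner_Integration.integral_cong) (auto simp: inner_add_left inner_diff_left algebra_simps)
  also have "\<dots> = (((v + w) \<bullet> (v + w)) / real CARD('d) - ((v - w) \<bullet> (v - w)) / real CARD('d)) / 4"
    by (simp add: sq integrable_uniform_sphere_inner)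
  also have "\<dots> = (v \<bullet> w) / real CARD('d)"
    by (simp add: inner_add_left inner_diff_left inner_add_right inner_diff_right inner_commute field_simps)
  finally show ?thesis .
qed

section \<open>The linearization error as a function of the direction\<close>

context forward_difference
begin

definition remainder :: "real ^ 'd \<Rightarrow> real ^ 'd \<Rightarrow> real" where
  "remainder x u = quot x u - gradF x \<bullet> u"

text \<open>The factor \<nu> from the chain rule cancels the divisor of \<open>quot\<close>: the
  gradient in \<open>u\<close> is a plain difference of gradients of \<open>F\<close>, of norm at
  most \<open>L * \<nu> * norm u\<close>.\<close>

lemma remainder_has_derivative:
  "((\<lambda>u. remainder x u) has_derivative (\<lambda>h. (gradF (x + \<nu> *\<^sub>R u) - gradF x) \<bullet> h)) (at u within S)"
proof -
  have "((\<lambda>u. F (x + \<nu> *\<^sub>R u)) has_derivative (\<lambda>h. (\<nu> *\<^sub>R h) \<bullet> gradF (x + \<nu> *\<^sub>R u))) (at u within S)"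
    by (rule has_derivative_compose[of "\<lambda>u. x + \<nu> *\<^sub>R u" "\<lambda>h. \<nu> *\<^sub>R h" u S F])
       (use gradF in \<open>auto intro!: derivative_eq_intros simp: gderiv_def\<close>)
  then have "((\<lambda>u. (F (x + \<nu> *\<^sub>R u) - F x) / \<nu>) has_derivative (\<lambda>h. ((\<nu> *\<^sub>R h) \<bullet> gradF (x + \<nu> *\<^sub>R u) - 0) / \<nu>)) (at u within S)"
    by (intro bounded_linear.has_derivative[OF bounded_linear_divide] has_derivative_diff has_derivative_const)
  from has_derivative_diff[OF this bounded_linear_imp_has_derivative[OF bounded_linear_inner_right[of "gradF x"]]]
  show ?thesis
    unfolding remainder_def quot_def using \<nu>_pos by (simp add: inner_diff_right inner_diff_left inner_commute)
qed

text \<open>The gradient of the remainder grows linearly in \<open>u\<close>, hence a Lipschitz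
  constant proportional to the radius. On the unit sphere it is applied with
  \<open>R = 1\<close>.\<close>

lemma remainder_lipschitz:
  assumes "norm u \<le> R" "norm v \<le> R"
  shows "\<bar>remainder x u - remainder x v\<bar> \<le> L * \<nu> * R * norm (u - v)"
proof -
  have "norm (remainder x u - remainder x v) \<le> L * \<nu> * R * norm (u - v)"
  proof (rule differentiable_bound[OF convex_cball[of 0 R] remainder_has_derivative])
    fix y :: "real ^ 'd" assume "y \<in> cball 0 R"
    have "norm (gradF (x + \<nu> *\<^sub>R y) - gradF x) \<le> L * \<nu> * norm y"
      using lipschitz[of "x + \<nu> *\<^sub>R y" x] \<nu>_pos by simp
    also have "\<dots> \<le> L * \<nu> * R"
      using \<open>y \<in> cball 0 R\<close> L_pos \<nu>_pos by (intro mult_left_mono) auto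
    finally have n: "norm (gradF (x + \<nu> *\<^sub>R y) - gradF x) \<le> L * \<nu> * R" .
    show "onorm ((\<bullet>) (gradF (x + \<nu> *\<^sub>R y) - gradF x)) \<le> L * \<nu> * R"
    proof (rule onorm_bound)
      show "0 \<le> L * \<nu> * R" using n norm_ge_zero order_trans by blast
      show "norm ((gradF (x + \<nu> *\<^sub>R y) - gradF x) \<bullet> h) \<le> L * \<nu> * R * norm h" for h
        using order_trans[OF Cauchy_Schwarz_ineq2 mult_right_mono[OF n norm_ge_zero]] by simp
    qed
  qed (use assms in auto)
  then show ?thesis by simp
qed

lemma borel_measurable_remainder[measurable]: "remainder x \<in> borel_measurable borel"
  unfolding remainder_def[abs_def] by measurable

text \<open>
  The reflection in the hyperplane orthogonal to \<open>w\<close> changes the sign of \<open>w \<bullet> u\<close> and preserves the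
  law of \<open>u\<close>, so only the difference of the remainders at the two mirror points contributes.
\<close>

lemma uniform_sphere_remainder:
  "(LINT u|uniform_sphere. remainder x u * (w \<bullet> u)) \<le> L * \<nu> * norm w / real CARD('d)"
proof (cases "w = 0")
  case False
  let ?R = "householder w"
  let ?\<sigma> = "uniform_sphere :: (real ^ 'd) measure"
  have R: "norm (?R u) = norm u" for u
    by (rule orthogonal_transformation_norm[OF orthogonal_transformation_householder])
  have wR: "w \<bullet> ?R u = - (w \<bullet> u)" for u
    by (simp add: inner_householder householder_self)
  have [measurable]: "?R \<in> borel_measurable borel"
    unfolding householder_def[abs_def] by measurable
  have bound: "\<bar>remainder x u\<bar> \<le> L * \<nu> / 2" if "norm u = 1" for u
    using quot_error[of x u] that by (simp add: remainder_def)
  have int: "integrable ?\<sigma> (\<lambda>u. remainder x (T u) * (w \<bullet> u))"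
    if T: "\<And>u. norm (T u) = norm u" and [measurable]: "T \<in> borel_measurable borel" for T
  proof (rule integrable_uniform_sphere[where C="L * \<nu> / 2 * norm w"])
    fix u :: "real ^ 'd" assume "norm u = 1"
    then show "norm (remainder x (T u) * (w \<bullet> u)) \<le> L * \<nu> / 2 * norm w"
      using mult_mono[OF bound[of "T u"] Cauchy_Schwarz_ineq2[of w u]] L_pos \<nu>_pos by (simp add: T abs_mult)
  qed measurable
  have "(LINT u|?\<sigma>. remainder x u * (w \<bullet> u)) = (LINT u|?\<sigma>. remainder x (?R u) * (w \<bullet> ?R u))"
    by (rule integral_uniform_sphere_orthogonal[symmetric, OF orthogonal_transformation_householder]) measurable
  also have "\<dots> = - (LINT u|?\<sigma>. remainder x (?R u) * (w \<bullet> u))"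
    by (simp add: wR)
  finally have "2 * (LINT u|?\<sigma>. remainder x u * (w \<bullet> u))
      = (LINT u|?\<sigma>. remainder x u * (w \<bullet> u)) - (LINT u|?\<sigma>. remainder x (?R u) * (w \<bullet> u))"
    by simp
  also have "\<dots> = (LINT u|?\<sigma>. (remainder x u - remainder x (?R u)) * (w \<bullet> u))"
    using int[of "\<lambda>u. u"] int[of ?R] R by (simp add: left_diff_distrib)
  also have "\<dots> \<le> (LINT u|?\<sigma>. 2 * (L * \<nu>) / norm w * ((w \<bullet> u) * (w \<bullet> u)))"
  proof (rule integral_mono_AE)
    show "integrable ?\<sigma> (\<lambda>u. (remainder x u - remainder x (?R u)) * (w \<bullet> u))"
      using int[of "\<lambda>u. u"] int[of ?R] R by (simp add: left_diff_distrib)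
    show "integrable ?\<sigma> (\<lambda>u. 2 * (L * \<nu>) / norm w * ((w \<bullet> u) * (w \<bullet> u)))"
      by (intro integrable_mult_right integrable_uniform_sphere_inner)
    show "AE u in ?\<sigma>. (remainder x u - remainder x (?R u)) * (w \<bullet> u)
        \<le> 2 * (L * \<nu>) / norm w * ((w \<bullet> u) * (w \<bullet> u))"
      using AE_uniform_sphere
    proof eventually_elim
      case (elim u)
      \<comment> \<open>The mirror points are at distance 2 |w . u| / |w|, so the Lipschitz bound
        supplies a second factor |w . u|. A second moment |w|^2 / d takes the place of a first
        absolute moment of order |w| / sqrt d; this gains the factor sqrt d over the direct
        estimate.\<close>
      have "u - ?R u = (2 * (w \<bullet> u) / (w \<bullet> w)) *\<^sub>R w" by (simp add: householder_def)
      then have n: "norm (u - ?R u) = 2 * \<bar>w \<bullet> u\<bar> / norm w"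
        using False by (simp add: dot_square_norm power2_eq_square abs_mult)
      have "(remainder x u - remainder x (?R u)) * (w \<bullet> u) \<le> \<bar>remainder x u - remainder x (?R u)\<bar> * \<bar>w \<bullet> u\<bar>"
        unfolding abs_mult[symmetric] by (rule abs_ge_self)
      also have "\<dots> \<le> (L * \<nu> * 1 * norm (u - ?R u)) * \<bar>w \<bullet> u\<bar>"
        using elim R[of u] by (intro mult_right_mono remainder_lipschitz) auto
      also have "\<dots> = 2 * (L * \<nu>) / norm w * (\<bar>w \<bullet> u\<bar> * \<bar>w \<bullet> u\<bar>)"
        by (simp add: n)
      finally show ?case by (simp only: abs_mult_self_eq)
    qed
  qed
  also have "\<dots> = 2 * (L * \<nu> * norm w / real CARD('d))"
    using False by (simp add: uniform_sphere_inner dot_square_norm power2_eq_square)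
  finally show ?thesis by simp
qed simp

end

section \<open>The standard Gaussian distribution\<close>

text \<open>
  The integral of \<open>H (v + w) - H v\<close> vanishes because Lebesgue measure is translation invariant; by
  Fubini it is the integral of the derivative of \<open>H\<close> along \<open>w\<close>. No product structure is needed.
\<close>

lemma integral_directional_derivative:
  fixes H :: "'a::euclidean_space \<Rightarrow> real"
  assumes der: "\<And>v. (H has_derivative (\<lambda>h. D v \<bullet> h)) (at v)" and cont: "continuous_on UNIV D"
    and int: "integrable lborel H" "integrable lborel (\<lambda>v. D v \<bullet> w)"
  shows "(LINT v|lborel. D v \<bullet> w) = 0"
proof -
  have transl: "integrable lborel (\<lambda>v. \<phi> (v + c))" "(LINT v|lborel. \<phi> (v + c)) = (LINT v|lborel. \<phi> v)"
    if "integrable lborel \<phi>" for \<phi> :: "'a \<Rightarrow> real" and c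
  proof -
    have [measurable]: "\<phi> \<in> borel_measurable borel" using borel_measurable_integrable[OF that] by simp
    have "lborel = distr lborel borel (\<lambda>v :: 'a. v + c)"
      using lborel_affine[of 1 c] by (simp add: density_1 add.commute)
    then have eq: "distr lborel borel (\<lambda>v :: 'a. v + c) = lborel" by simp
    show "integrable lborel (\<lambda>v. \<phi> (v + c))"
      using that integrable_distr_eq[of "\<lambda>v :: 'a. v + c" lborel borel \<phi>] by (simp add: eq)
    show "(LINT v|lborel. \<phi> (v + c)) = (LINT v|lborel. \<phi> v)"
      using integral_distr[of "\<lambda>v :: 'a. v + c" lborel borel \<phi>] by (simp add: eq)
  qed
  have [measurable]: "D \<in> borel_measurable borel" by (rule borel_measurable_continuous_onI[OF cont])
  have I: "(LINT \<tau>|lborel. indicator {0..1} \<tau> * (D (v + \<tau> *\<^sub>R w) \<bullet> w)) = H (v + w) - H v" for v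
  proof -
    have "(LINT \<tau>|lborel. (D (v + \<tau> *\<^sub>R w) \<bullet> w) * indicator {0..1} \<tau>) = H (v + 1 *\<^sub>R w) - H (v + 0 *\<^sub>R w)"
    proof (rule integral_FTC_Icc_real)
      fix \<tau> :: real
      have "((\<lambda>\<tau>. H (v + \<tau> *\<^sub>R w)) has_derivative (\<lambda>s. D (v + \<tau> *\<^sub>R w) \<bullet> (s *\<^sub>R w))) (at \<tau>)"
        by (rule has_derivative_compose[of "\<lambda>\<tau>. v + \<tau> *\<^sub>R w" "\<lambda>s. s *\<^sub>R w" \<tau> UNIV H])
           (auto intro!: derivative_eq_intros der)
      then show "((\<lambda>\<tau>. H (v + \<tau> *\<^sub>R w)) has_real_derivative D (v + \<tau> *\<^sub>R w) \<bullet> w) (at \<tau>)"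
        by (rule has_derivative_imp_has_field_derivative) simp
      have "continuous_on UNIV (\<lambda>\<tau>. D (v + \<tau> *\<^sub>R w) \<bullet> w)"
        by (intro continuous_on_inner continuous_on_compose2[OF cont] continuous_intros) auto
      then show "isCont (\<lambda>\<tau>. D (v + \<tau> *\<^sub>R w) \<bullet> w) \<tau>"
        by (simp add: continuous_on_eq_continuous_at)
    qed simp
    then show ?thesis by (simp add: mult.commute)
  qed
  let ?h = "\<lambda>\<tau> v. indicator {0..1} \<tau> * (D (v + \<tau> *\<^sub>R w) \<bullet> w) :: real"
  \<comment> \<open>By translation invariance the integral of the absolute value over
    \<open>v\<close> is the same for every \<open>\<tau>\<close> in the unit interval, hence
    integrable in \<open>\<tau>\<close>.\<close>
  have inth: "integrable (lborel \<Otimes>\<^sub>M lborel) (case_prod ?h)"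
  proof (rule lborel_pair.Fubini_integrable)
    have "(\<lambda>\<tau>. LINT v|lborel. norm (?h \<tau> v)) = (\<lambda>\<tau>. indicator {0..1} \<tau> * (LINT v|lborel. \<bar>D v \<bullet> w\<bar>))"
      using transl(2)[OF integrable_abs[OF int(2)]] by (auto simp: fun_eq_iff indicator_def)
    moreover have "integrable lborel (\<lambda>\<tau> :: real. indicator {0..1} \<tau> * (LINT v|lborel. \<bar>D v \<bullet> w\<bar>))"
      by simp
    ultimately show "integrable lborel (\<lambda>\<tau>. LINT v|lborel. norm (case (\<tau>, v) of (\<tau>, v) \<Rightarrow> ?h \<tau> v))"
      by simp
    show "AE \<tau> in lborel. integrable lborel (\<lambda>v. case (\<tau>, v) of (\<tau>, v) \<Rightarrow> ?h \<tau> v)"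
      using transl(1)[OF int(2)] by simp
  qed measurable
  have "(LINT v|lborel. D v \<bullet> w) = (LINT \<tau>|lborel. indicator {0..1::real} \<tau> * (LINT v|lborel. D v \<bullet> w))"
    by simp
  also have "\<dots> = (LINT \<tau>|lborel. LINT v|lborel. ?h \<tau> v)"
    using transl(2)[OF int(2)] by simp
  also have "\<dots> = (LINT v|lborel. LINT \<tau>|lborel. ?h \<tau> v)"
    by (rule lborel_pair.Fubini_integral[symmetric, OF inth])
  also have "\<dots> = (LINT v|lborel. H (v + w) - H v)"
    by (simp only: I)
  also have "\<dots> = 0"
    using transl[OF int(1), of w] int(1) by simp
  finally show ?thesis .
qed

section \<open>The Gaussian density and its moments\<close>

definition gauss :: "real ^ 'd \<Rightarrow> real" where
  "gauss v = (\<Prod>i\<in>UNIV. std_normal_density (v $ i))"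

definition gaussian :: "(real ^ 'd) measure" where
  "gaussian = density lborel (\<lambda>v. ennreal (gauss v))"

lemma gauss_exp: "gauss (v :: real ^ 'd) = (1 / sqrt (2 * pi)) ^ CARD('d) * exp (- (norm v)\<^sup>2 / 2)"
proof -
  have "(norm v)\<^sup>2 = (\<Sum>i\<in>UNIV. (v $ i)\<^sup>2)"
    unfolding power2_norm_eq_inner inner_vec_def by (simp add: power2_eq_square)
  then show ?thesis
    by (simp add: gauss_def std_normal_density_def prod.distrib exp_sum[symmetric] sum_negf sum_divide_distrib
        prod_dividef power_divide)
qed

lemma gauss_pos: "0 < gauss v" by (simp add: gauss_exp)

lemma gauss_has_derivative:
  fixes v :: "real ^ 'd"
  shows "(gauss has_derivative (\<lambda>h. (- gauss v *\<^sub>R v) \<bullet> h)) (at v)"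
proof -
  let ?K = "(1 / sqrt (2 * pi)) ^ CARD('d)"
  have "gauss = (\<lambda>v :: real ^ 'd. ?K * exp (- (v \<bullet> v) / 2))"
    by (simp add: fun_eq_iff gauss_exp power2_norm_eq_inner)
  moreover have "((\<lambda>v :: real ^ 'd. ?K * exp (- (v \<bullet> v) / 2)) has_derivative (\<lambda>h. (- gauss v *\<^sub>R v) \<bullet> h)) (at v)"
    by (auto intro!: derivative_eq_intros simp: fun_eq_iff gauss_exp power2_norm_eq_inner inner_commute)
  ultimately show ?thesis by (simp only:)
qed

lemma continuous_gauss: "continuous_on UNIV gauss"
  by (auto intro!: continuous_at_imp_continuous_on has_derivative_continuous gauss_has_derivative)

lemma borel_measurable_gauss[measurable]: "gauss \<in> borel_measurable borel"
  by (rule borel_measurable_continuous_onI[OF continuous_gauss])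

lemma sets_gaussian[measurable_cong, simp]: "sets gaussian = sets borel"
  by (simp add: gaussian_def)

lemma space_gaussian[simp]: "space gaussian = UNIV"
  by (simp add: gaussian_def)

lemma gaussian_integrable_iff:
  fixes \<phi> :: "real ^ 'd \<Rightarrow> real"
  assumes [measurable]: "\<phi> \<in> borel_measurable borel"
  shows "integrable gaussian \<phi> \<longleftrightarrow> integrable lborel (\<lambda>v. gauss v * \<phi> v)"
  unfolding gaussian_def by (subst integrable_density) (auto intro!: AE_I2 less_imp_le[OF gauss_pos])

lemma gaussian_integral:
  fixes \<phi> :: "real ^ 'd \<Rightarrow> real"
  assumes [measurable]: "\<phi> \<in> borel_measurable borel"
  shows "(LINT v|gaussian. \<phi> v) = (LINT v|lborel. gauss v * \<phi> v)"
  unfolding gaussian_def by (subst integral_density) (auto intro!: AE_I2 less_imp_le[OF gauss_pos])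

text \<open>That \<open>gaussian\<close> is a probability measure is assumed here and follows later
  from the existence of a random direction with this law; the normalizing integral is never
  evaluated.\<close>

context
  assumes prob: "prob_space (gaussian :: (real ^ 'd) measure)"
begin

interpretation gaussian: prob_space "gaussian :: (real ^ 'd) measure" by (rule prob)

text \<open>The density stretched by 2, proportional to exp (- |v|^2 / 8), is integrable by scaling
  and dominates the Gaussian times any even power of the norm. The general exponent \<open>k\<close>
  lies below the even exponent \<open>2 * k\<close>.\<close>

lemma integrable_gaussian_norm: "integrable gaussian (\<lambda>u :: real ^ 'd. norm u ^ k)"
proof -
  have "integrable gaussian (\<lambda>u :: real ^ 'd. norm u ^ (2 * m))" for m
  proof (subst gaussian_integrable_iff, measurable)
    let ?K = "(1 / sqrt (2 * pi)) ^ CARD('d)"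
    let ?e = "\<lambda>v :: real ^ 'd. ?K * exp (- (norm v)\<^sup>2 / 8)"
    have g: "integrable lborel (gauss :: real ^ 'd \<Rightarrow> real)"
      using gaussian_integrable_iff[of "\<lambda>_ :: real ^ 'd. 1"] by simp
    have "integrable (distr lborel borel (\<lambda>v. 2 *\<^sub>R v)) ?e"
      using g by (subst integrable_distr_eq) (simp_all add: gauss_exp[abs_def] power_mult_distrib)
    then have "integrable (density (distr lborel borel (\<lambda>v. 2 *\<^sub>R v)) (\<lambda>_. ennreal (2 ^ CARD('d)))) ?e"
      by (subst integrable_density) auto
    then have e: "integrable lborel ?e"
      using lborel_affine[of 2 "0 :: real ^ 'd"] by (simp add: DIM_cart)
    show "integrable lborel (\<lambda>v :: real ^ 'd. gauss v * norm v ^ (2 * m))"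
    proof (rule Bochner_Integration.integrable_bound[of lborel "\<lambda>v. fact m * 8 ^ m * ?e v"])
      show "AE v in lborel. norm (gauss v * norm (v :: real ^ 'd) ^ (2 * m)) \<le> norm (fact m * 8 ^ m * ?e v)"
      proof (intro AE_I2)
        fix v :: "real ^ 'd"
        define t where "t = (norm v)\<^sup>2"
        have t: "0 \<le> t" by (simp add: t_def)
        \<comment> \<open>A single term of the exponential series bounds the power by exp (t / 8);
          since t / 8 - t / 2 is at most - t / 8, the product stays below the stretched
          density.\<close>
        have "(\<Sum>n\<in>{m}. (t / 8) ^ n /\<^sub>R fact n) \<le> (\<Sum>n. (t / 8) ^ n /\<^sub>R fact n)"
          using t by (intro sum_le_suminf summable_exp_generic) auto
        then have "(t / 8) ^ m /\<^sub>R fact m \<le> exp (t / 8)"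
          by (simp only: exp_def sum.insert sum.empty finite.emptyI empty_iff not_False_eq_True add_0_right)
        then have "t ^ m \<le> fact m * 8 ^ m * exp (t / 8)"
          by (simp add: field_simps)
        then have "?K * exp (- t / 2) * t ^ m \<le> ?K * exp (- t / 2) * (fact m * 8 ^ m * exp (t / 8))"
          by (intro mult_left_mono) auto
        also have "\<dots> = fact m * 8 ^ m * (?K * (exp (- t / 2) * exp (t / 8)))" by simp
        also have "\<dots> \<le> fact m * 8 ^ m * (?K * exp (- t / 8))"
          using t by (intro mult_left_mono) (auto simp flip: exp_add)
        finally have "gauss v * norm v ^ (2 * m) \<le> fact m * 8 ^ m * ?e v"
          by (simp add: gauss_exp t_def power_mult)
        then show "norm (gauss v * norm v ^ (2 * m)) \<le> norm (fact m * 8 ^ m * ?e v)"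
          using gauss_pos[of v] by simp
      qed
    qed (use e in auto)
  qed
  from this[of k] show ?thesis
    by (rule integrable_norm_power_mono[rotated 2]) (auto intro: gaussian.finite_measure_axioms)
qed

lemma integrable_gaussian_bound:
  fixes \<phi> :: "real ^ 'd \<Rightarrow> real"
  assumes [measurable]: "\<phi> \<in> borel_measurable borel" and b: "\<And>u. \<bar>\<phi> u\<bar> \<le> C * norm u ^ k"
  shows "integrable gaussian \<phi>"
  by (rule Bochner_Integration.integrable_bound[OF integrable_mult_right[OF integrable_gaussian_norm[of k], of C]])
     (use order_trans[OF b abs_ge_self] in auto)

text \<open>The gradient of the density at \<open>v\<close> is \<open>- gauss v *\<^sub>R v\<close>,
  so the vanishing integral of the derivative of \<open>gauss v * h v\<close> along \<open>w\<close>
  is the difference of the two sides.\<close>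

lemma gaussian_Stein:
  fixes h :: "real ^ 'd \<Rightarrow> real"
  assumes der: "\<And>v. (h has_derivative (\<lambda>k. D v \<bullet> k)) (at v)" and cont: "continuous_on UNIV D"
    and int: "integrable gaussian h" "integrable gaussian (\<lambda>u. (w \<bullet> u) * h u)" "integrable gaussian (\<lambda>u. D u \<bullet> w)"
  shows "(LINT u|gaussian. (w \<bullet> u) * h u) = (LINT u|gaussian. D u \<bullet> w)"
proof -
  have ch: "continuous_on UNIV h"
    by (auto intro!: continuous_at_imp_continuous_on has_derivative_continuous der)
  have [measurable]: "D \<in> borel_measurable borel" "h \<in> borel_measurable borel"
    by (rule borel_measurable_continuous_onI[OF cont], rule borel_measurable_continuous_onI[OF ch])
  note iff = gaussian_integrable_iff
  have eq: "gauss v *\<^sub>R (D v - h v *\<^sub>R v) \<bullet> w = gauss v * (D v \<bullet> w) - gauss v * ((w \<bullet> v) * h v)" for v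
    by (simp add: inner_diff_left inner_commute algebra_simps)
  have "(LINT v|lborel. gauss v *\<^sub>R (D v - h v *\<^sub>R v) \<bullet> w) = 0"
  proof (rule integral_directional_derivative)
    show "((\<lambda>v. gauss v * h v) has_derivative (\<lambda>k. gauss v *\<^sub>R (D v - h v *\<^sub>R v) \<bullet> k)) (at v)" for v
      by (rule has_derivative_eq_rhs[OF has_derivative_mult[OF gauss_has_derivative der]])
         (simp add: fun_eq_iff inner_diff_left algebra_simps)
    show "continuous_on UNIV (\<lambda>v. gauss v *\<^sub>R (D v - h v *\<^sub>R v))"
      by (intro continuous_intros continuous_gauss cont ch)
    show "integrable lborel (\<lambda>v. gauss v * h v)"
      using int(1) by (simp add: iff)
    show "integrable lborel (\<lambda>v. gauss v *\<^sub>R (D v - h v *\<^sub>R v) \<bullet> w)"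
      unfolding eq using int by (intro Bochner_Integration.integrable_diff) (simp_all add: iff)
  qed
  moreover have "(LINT v|lborel. gauss v *\<^sub>R (D v - h v *\<^sub>R v) \<bullet> w)
    = (LINT u|gaussian. D u \<bullet> w) - (LINT u|gaussian. (w \<bullet> u) * h u)"
    unfolding eq using int by (subst Bochner_Integration.integral_diff) (simp_all add: iff gaussian_integral)
  ultimately show ?thesis by simp
qed

lemma gaussian_inner:
  fixes v w :: "real ^ 'd"
  shows "integrable gaussian (\<lambda>u. (v \<bullet> u) * (w \<bullet> u))" "(LINT u|gaussian. (v \<bullet> u) * (w \<bullet> u)) = v \<bullet> w"
proof -
  have b: "\<bar>(v \<bullet> u) * (w \<bullet> u)\<bar> \<le> norm v * norm w * norm u ^ 2" for v w u :: "real ^ 'd"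
    using mult_mono[OF Cauchy_Schwarz_ineq2[of v u] Cauchy_Schwarz_ineq2[of w u]]
    by (simp add: abs_mult power2_eq_square mult_ac)
  show i: "integrable gaussian (\<lambda>u. (v \<bullet> u) * (w \<bullet> u))"
    by (rule integrable_gaussian_bound[OF _ b]) measurable
  have "(LINT u|gaussian. (v \<bullet> u) * (w \<bullet> u)) = (LINT u|(gaussian :: (real ^ 'd) measure). w \<bullet> v)"
  proof (rule gaussian_Stein[of "\<lambda>u. w \<bullet> u" "\<lambda>_. w" v])
    show "((\<bullet>) w has_derivative (\<bullet>) w) (at u)" for u :: "real ^ 'd"
      by (rule bounded_linear_imp_has_derivative[OF bounded_linear_inner_right])
    have "\<bar>w \<bullet> u\<bar> \<le> norm w * norm u ^ 1" for u using Cauchy_Schwarz_ineq2[of w u] by simp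
    then show "integrable gaussian ((\<bullet>) w)"
      by (intro integrable_gaussian_bound) measurable
    show "integrable gaussian (\<lambda>u. (v \<bullet> u) * (w \<bullet> u))" by (rule i)
  qed simp_all
  then show "(LINT u|gaussian. (v \<bullet> u) * (w \<bullet> u)) = v \<bullet> w"
    using gaussian.prob_space by (simp add: inner_commute)
qed

text \<open>Stein's identity for \<open>(w \<bullet> u) * (u \<bullet> u) ^ Suc k\<close>, with the
  left-hand side left in product form. Summed over a basis it becomes a recursion for the moments of
  the norm.\<close>

lemma gaussian_radial:
  fixes w :: "real ^ 'd"
  shows "(LINT u|gaussian. (w \<bullet> u) * ((w \<bullet> u) * (u \<bullet> u) ^ Suc k))
    = (LINT u|gaussian. (w \<bullet> w) * (u \<bullet> u) ^ Suc k + 2 * real (Suc k) * (w \<bullet> u)\<^sup>2 * (u \<bullet> u) ^ k)"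
    and "integrable gaussian (\<lambda>u. (w \<bullet> u)\<^sup>2 * (u \<bullet> u) ^ k)"
proof -
  have nn: "(u \<bullet> u) ^ k = norm u ^ (2 * k)" for u :: "real ^ 'd" and k
    by (simp add: power_mult power2_norm_eq_inner)
  have b1: "\<bar>(w \<bullet> u) * (u \<bullet> u) ^ k\<bar> \<le> norm w * norm u ^ (Suc (2 * k))" for u and k
    using mult_right_mono[OF Cauchy_Schwarz_ineq2[of w u], of "norm u ^ (2 * k)"] by (simp add: nn abs_mult mult_ac)
  have b2: "\<bar>(w \<bullet> u)\<^sup>2 * (u \<bullet> u) ^ k\<bar> \<le> (norm w)\<^sup>2 * norm u ^ (2 * Suc k)" for u and k
    using mult_right_mono[OF power_mono[OF Cauchy_Schwarz_ineq2[of w u], of 2], of "norm u ^ (2 * k)"]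
    by (simp add: nn abs_mult power2_eq_square mult_ac)
  have i0: "integrable gaussian (\<lambda>u :: real ^ 'd. (u \<bullet> u) ^ k)" for k
    unfolding nn by (rule integrable_gaussian_norm)
  have i2: "integrable gaussian (\<lambda>u. (w \<bullet> u)\<^sup>2 * (u \<bullet> u) ^ k)" for k
    by (rule integrable_gaussian_bound[OF _ b2]) measurable
  show "integrable gaussian (\<lambda>u. (w \<bullet> u)\<^sup>2 * (u \<bullet> u) ^ k)" by (rule i2)
  let ?D = "\<lambda>u. ((u \<bullet> u) ^ Suc k) *\<^sub>R w + ((w \<bullet> u) * (real (Suc k) * (2 * (u \<bullet> u) ^ k))) *\<^sub>R u"
  have eq: "?D u \<bullet> w = (w \<bullet> w) * (u \<bullet> u) ^ Suc k + 2 * real (Suc k) * ((w \<bullet> u)\<^sup>2 * (u \<bullet> u) ^ k)" for u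
    by (simp add: inner_add_left inner_commute power2_eq_square algebra_simps)
  have "(LINT u|gaussian. (w \<bullet> u) * ((w \<bullet> u) * (u \<bullet> u) ^ Suc k)) = (LINT u|gaussian. ?D u \<bullet> w)"
  proof (rule gaussian_Stein)
    show "((\<lambda>u. (w \<bullet> u) * (u \<bullet> u) ^ Suc k) has_derivative (\<lambda>h. ?D u \<bullet> h)) (at u)" for u :: "real ^ 'd"
      by (auto intro!: derivative_eq_intros simp: fun_eq_iff inner_add_left inner_commute algebra_simps simp del: power_Suc)
    show "continuous_on UNIV ?D" by (intro continuous_intros)
    show "integrable gaussian (\<lambda>u. (w \<bullet> u) * (u \<bullet> u) ^ Suc k)"
      by (rule integrable_gaussian_bound[OF _ b1]) measurable
    show "integrable gaussian (\<lambda>u. (w \<bullet> u) * ((w \<bullet> u) * (u \<bullet> u) ^ Suc k))"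
      using i2[of "Suc k"] by (simp add: power2_eq_square mult_ac)
    show "integrable gaussian (\<lambda>u. ?D u \<bullet> w)"
      unfolding eq by (intro Bochner_Integration.integrable_add integrable_mult_right i0 i2)
  qed
  then show "(LINT u|gaussian. (w \<bullet> u) * ((w \<bullet> u) * (u \<bullet> u) ^ Suc k))
    = (LINT u|gaussian. (w \<bullet> w) * (u \<bullet> u) ^ Suc k + 2 * real (Suc k) * (w \<bullet> u)\<^sup>2 * (u \<bullet> u) ^ k)"
    unfolding eq by (simp only: mult.assoc)
qed

text \<open>Over a basis the squares of \<open>b \<bullet> u\<close> sum to
  \<open>u \<bullet> u\<close>; each of the \<open>d\<close> vectors contributes one copy of the
  lower moment, and the derivative of the radial factor contributes \<open>2 * real (Suc k)\<close>
  more. The start value, mean \<open>d\<close> of the squared norm, comes from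
  \<open>gaussian_inner\<close>.\<close>

lemma gaussian_norm_moment_Suc:
  "(LINT u|gaussian. ((u :: real ^ 'd) \<bullet> u) ^ Suc (Suc k)) = (real CARD('d) + 2 * real (Suc k)) * (LINT u|gaussian. ((u :: real ^ 'd) \<bullet> u) ^ Suc k)"
proof -
  have i0: "integrable gaussian (\<lambda>u :: real ^ 'd. (u \<bullet> u) ^ k)" for k
    using integrable_gaussian_norm[of "2 * k"] by (simp add: power_mult power2_norm_eq_inner)
  have s: "(\<Sum>b\<in>Basis. (b \<bullet> u)\<^sup>2) = u \<bullet> u" for u :: "real ^ 'd"
    by (subst (2) euclidean_inner) (simp add: power2_eq_square inner_commute)
  have "(LINT u|gaussian. ((u :: real ^ 'd) \<bullet> u) ^ Suc (Suc k)) = (LINT u|gaussian. (\<Sum>b\<in>Basis. (b \<bullet> (u :: real ^ 'd))\<^sup>2 * (u \<bullet> u) ^ Suc k))"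
    by (simp add: s flip: sum_distrib_right)
  also have "\<dots> = (\<Sum>b\<in>Basis. (LINT u|gaussian. (b \<bullet> (u :: real ^ 'd))\<^sup>2 * (u \<bullet> u) ^ Suc k))"
    by (rule Bochner_Integration.integral_sum) (rule gaussian_radial(2))
  also have "\<dots> = (\<Sum>b\<in>(Basis :: (real ^ 'd) set). (LINT u|gaussian. ((u :: real ^ 'd) \<bullet> u) ^ Suc k) + 2 * real (Suc k) * (LINT u|gaussian. (b \<bullet> (u :: real ^ 'd))\<^sup>2 * (u \<bullet> u) ^ k))"
  proof (rule sum.cong[OF refl])
    fix b :: "real ^ 'd" assume "b \<in> Basis"
    then show "(LINT u|gaussian. (b \<bullet> u)\<^sup>2 * (u \<bullet> u) ^ Suc k) = (LINT u|gaussian. ((u :: real ^ 'd) \<bullet> u) ^ Suc k) + 2 * real (Suc k) * (LINT u|gaussian. (b \<bullet> (u :: real ^ 'd))\<^sup>2 * (u \<bullet> u) ^ k)"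
      using gaussian_radial[of b k] i0[of "Suc k"]
      by (simp add: power2_eq_square mult.assoc del: power_Suc of_nat_Suc)
  qed
  also have "\<dots> = real CARD('d) * (LINT u|gaussian. ((u :: real ^ 'd) \<bullet> u) ^ Suc k)
      + 2 * real (Suc k) * (LINT u|gaussian. (\<Sum>b\<in>Basis. (b \<bullet> (u :: real ^ 'd))\<^sup>2 * (u \<bullet> u) ^ k))"
    by (subst Bochner_Integration.integral_sum, rule gaussian_radial(2))
       (simp add: sum.distrib DIM_cart sum_distrib_left del: of_nat_Suc)
  finally show ?thesis
    by (simp add: s distrib_right del: of_nat_Suc flip: sum_distrib_right)
qed

lemma gaussian_norm_moments:
  "(LINT u|gaussian. (norm (u :: real ^ 'd)) ^ 2) = real CARD('d)"
  "(LINT u|gaussian. (norm (u :: real ^ 'd)) ^ 4) = real CARD('d) * (real CARD('d) + 2)"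
  "(LINT u|gaussian. (norm (u :: real ^ 'd)) ^ 6) = real CARD('d) * (real CARD('d) + 2) * (real CARD('d) + 4)"
proof -
  have n4: "norm u ^ 4 = (u \<bullet> u) ^ Suc (Suc 0)" and n6: "norm u ^ 6 = (u \<bullet> u) ^ Suc (Suc (Suc 0))"
    and n2: "norm u ^ 2 = (u \<bullet> u) ^ Suc 0" for u :: "real ^ 'd"
    by (simp_all add: numeral_eq_Suc flip: power2_norm_eq_inner)
  have "(LINT u|gaussian. (norm (u :: real ^ 'd)) ^ 2) = (LINT u|gaussian. (\<Sum>b\<in>Basis. (b \<bullet> (u :: real ^ 'd)) * (b \<bullet> u)))"
    by (simp add: power2_norm_eq_inner euclidean_inner[symmetric] inner_commute[of _ "_ :: real ^ 'd"])
  also have "\<dots> = real CARD('d)"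
    by (subst Bochner_Integration.integral_sum) (simp_all add: gaussian_inner DIM_cart)
  finally show 1: "(LINT u|gaussian. (norm (u :: real ^ 'd)) ^ 2) = real CARD('d)" .
  show 2: "(LINT u|gaussian. (norm (u :: real ^ 'd)) ^ 4) = real CARD('d) * (real CARD('d) + 2)"
    using 1 unfolding n4 n2 by (simp only: gaussian_norm_moment_Suc) simp
  show "(LINT u|gaussian. (norm (u :: real ^ 'd)) ^ 6) = real CARD('d) * (real CARD('d) + 2) * (real CARD('d) + 4)"
    using 2 unfolding n6 n4 by (simp only: gaussian_norm_moment_Suc[of "Suc 0"]) simp
qed

text \<open>The case \<open>k = 0\<close> of \<open>gaussian_radial\<close>. Cauchy-Schwarz would
  only give d (d + 2) in place of d + 2, too much to be absorbed by the \<open>4.5 * d\<close> in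
  the step size.\<close>

lemma gaussian_inner_norm:
  fixes w :: "real ^ 'd"
  shows "integrable gaussian (\<lambda>u. (w \<bullet> u)\<^sup>2 * (norm u)\<^sup>2)"
    and "(LINT u|gaussian. (w \<bullet> u)\<^sup>2 * (norm u)\<^sup>2) = (real CARD('d) + 2) * (norm w)\<^sup>2"
proof -
  show "integrable gaussian (\<lambda>u. (w \<bullet> u)\<^sup>2 * (norm u)\<^sup>2)"
    using gaussian_radial(2)[of w 1] by (simp add: power2_norm_eq_inner)
  have sq: "integrable gaussian (\<lambda>u :: real ^ 'd. u \<bullet> u)" "(LINT u|gaussian. (u :: real ^ 'd) \<bullet> u) = real CARD('d)"
    using integrable_gaussian_norm[of 2] gaussian_norm_moments(1) by (simp_all add: power2_norm_eq_inner)
  have "(LINT u|gaussian. (w \<bullet> u)\<^sup>2 * (norm u)\<^sup>2) = (LINT u|gaussian. (w \<bullet> u) * ((w \<bullet> u) * (u \<bullet> u) ^ Suc 0))"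
    by (simp add: power2_norm_eq_inner power2_eq_square[of "w \<bullet> _"] mult.assoc)
  also have "\<dots> = (LINT u|gaussian. (w \<bullet> w) * (u \<bullet> u) + 2 * ((w \<bullet> u) * (w \<bullet> u)))"
    unfolding gaussian_radial by (simp add: power2_eq_square mult.assoc)
  also have "\<dots> = (real CARD('d) + 2) * (norm w)\<^sup>2"
    by (simp add: sq gaussian_inner power2_norm_eq_inner distrib_right)
  finally show "(LINT u|gaussian. (w \<bullet> u)\<^sup>2 * (norm u)\<^sup>2) = (real CARD('d) + 2) * (norm w)\<^sup>2" .
qed

end

section \<open>The bias of Gaussian directions\<close>

context forward_difference
begin

lemma continuous_gradF: "continuous_on UNIV gradF"
proof (rule continuous_on_subset[OF lipschitz_on_continuous_on])
  show "L-lipschitz_on UNIV gradF"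
    using lipschitz L_pos by (auto intro!: lipschitz_onI simp: dist_norm)
qed simp

text \<open>Stein's identity trades the factor \<open>w \<bullet> u\<close> for the gradient of the
  remainder, which is linear in the norm of \<open>u\<close>. Only the mean norm enters, at most
  sqrt d, where a direct estimate would bring in the third moment, of order d sqrt d.\<close>

lemma gaussian_remainder:
  assumes prob: "prob_space (gaussian :: (real ^ 'd) measure)"
  shows "(LINT u|gaussian. remainder x u * (w \<bullet> u)) \<le> L * \<nu> * sqrt (real CARD('d)) * norm w"
proof -
  let ?s = "sqrt (real CARD('d))"
  let ?D = "\<lambda>u. gradF (x + \<nu> *\<^sub>R u) - gradF x"
  have D: "norm (?D u) \<le> L * \<nu> * norm u" for u
    using lipschitz[of "x + \<nu> *\<^sub>R u" x] \<nu>_pos by simp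
  have cD: "continuous_on UNIV ?D"
    by (intro continuous_intros continuous_on_compose2[OF continuous_gradF]) auto
  have [measurable]: "?D \<in> borel_measurable borel"
    by (rule borel_measurable_continuous_onI[OF cD])
  have Dw: "\<bar>?D u \<bullet> w\<bar> \<le> (L * \<nu> * norm w) * norm u ^ 1" for u
    using order_trans[OF Cauchy_Schwarz_ineq2 mult_right_mono[OF D[of u] norm_ge_zero[of w]]] by (simp add: mult_ac)
  have rb: "\<bar>remainder x u\<bar> \<le> L * \<nu> / 2 * norm u ^ 2" for u
    using quot_error[of x u] by (simp add: remainder_def)
  have "(LINT u|gaussian. (w \<bullet> u) * remainder x u) = (LINT u|gaussian. ?D u \<bullet> w)"
  proof (rule gaussian_Stein[OF prob])
    show "(remainder x has_derivative (\<lambda>h. ?D u \<bullet> h)) (at u)" for u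
      by (rule remainder_has_derivative)
    show "integrable gaussian (remainder x)"
      by (rule integrable_gaussian_bound[OF prob _ rb]) measurable
    have "\<bar>(w \<bullet> u) * remainder x u\<bar> \<le> (norm w * (L * \<nu> / 2)) * norm u ^ 3" for u
      using mult_mono[OF Cauchy_Schwarz_ineq2[of w u] rb[of u]] by (simp add: abs_mult numeral_eq_Suc mult_ac)
    then show "integrable gaussian (\<lambda>u. (w \<bullet> u) * remainder x u)"
      by (intro integrable_gaussian_bound[OF prob]) measurable
    show "integrable gaussian (\<lambda>u. ?D u \<bullet> w)"
      by (rule integrable_gaussian_bound[OF prob _ Dw]) measurable
  qed (rule cD)
  also have "\<dots> \<le> (LINT u|gaussian. (L * \<nu> * norm w) * ((real CARD('d) + norm (u :: real ^ 'd) ^ 2) / (2 * ?s)))"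
  proof (rule integral_mono)
    interpret gaussian: prob_space "gaussian :: (real ^ 'd) measure" by (rule prob)
    show "integrable gaussian (\<lambda>u. ?D u \<bullet> w)"
      by (rule integrable_gaussian_bound[OF prob _ Dw]) measurable
    show "integrable gaussian (\<lambda>u :: real ^ 'd. (L * \<nu> * norm w) * ((real CARD('d) + norm u ^ 2) / (2 * ?s)))"
      using integrable_gaussian_norm[OF prob, of 2] by simp
    fix u :: "real ^ 'd"
    \<comment> \<open>The arithmetic-geometric mean inequality in place of Jensen: as the squared
      norm has mean \<open>d\<close>, the right-hand side has mean sqrt d.\<close>
    have "norm u \<le> (real CARD('d) + norm u ^ 2) / (2 * ?s)"
      using zero_le_power2[of "norm u - ?s"] by (simp add: field_simps power2_diff)
    then show "?D u \<bullet> w \<le> (L * \<nu> * norm w) * ((real CARD('d) + norm u ^ 2) / (2 * ?s))"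
      using abs_ge_self[of "?D u \<bullet> w"] Dw[of u] L_pos \<nu>_pos
        mult_left_mono[of "norm u" "(real CARD('d) + norm u ^ 2) / (2 * ?s)" "L * \<nu> * norm w"] by simp
  qed
  also have "\<dots> = (L * \<nu> * norm w) * ((real CARD('d) + real CARD('d)) / (2 * ?s))"
  proof -
    interpret gaussian: prob_space "gaussian :: (real ^ 'd) measure" by (rule prob)
    show ?thesis
      using integrable_gaussian_norm[OF prob, of 2] gaussian.prob_space gaussian_norm_moments(1)[OF prob] by simp
  qed
  also have "(real CARD('d) + real CARD('d)) / (2 * ?s) = ?s"
    by (simp add: real_div_sqrt)
  finally show ?thesis by (simp add: mult_ac)
qed

end

section \<open>The expected descent along the estimator\<close>

context forward_difference
begin

text \<open>The remainder is quadratic in \<open>u\<close>, so the squared direction term has degree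
  6; hence the sixth moments that accompany the directions.\<close>

lemma norm_quot_scaleR_le: "(norm (quot x u *\<^sub>R u))\<^sup>2 \<le> 2 * (norm (gradF x))\<^sup>2 * norm u ^ 4 + L\<^sup>2 * \<nu>\<^sup>2 / 2 * norm u ^ 6"
proof -
  have "(norm (quot x u *\<^sub>R u))\<^sup>2 = (quot x u)\<^sup>2 * (norm u)\<^sup>2" by (simp add: power_mult_distrib)
  also have "\<dots> \<le> (2 * (gradF x \<bullet> u)\<^sup>2 + L\<^sup>2 * \<nu>\<^sup>2 / 2 * norm u ^ 4) * (norm u)\<^sup>2"
    by (intro mult_right_mono quot_square_le) simp
  also have "\<dots> \<le> (2 * ((norm (gradF x))\<^sup>2 * (norm u)\<^sup>2) + L\<^sup>2 * \<nu>\<^sup>2 / 2 * norm u ^ 4) * (norm u)\<^sup>2"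
    using power_mono[OF Cauchy_Schwarz_ineq2[of "gradF x" u], of 2]
    by (intro mult_right_mono add_mono mult_left_mono) (auto simp: power_mult_distrib)
  finally show ?thesis by (simp add: algebra_simps flip: power_add)
qed

text \<open>
  Gaussian and spherical directions are the cases \<open>c = 1\<close> and \<open>c = d\<close>. Writing \<open>b\<close> for the mean of
  the estimator, the identity \<open>2 (\<nabla>F \<bullet> b) = |\<nabla>F|\<^sup>2 + |b|\<^sup>2 - |b - \<nabla>F|\<^sup>2\<close> provides the multiple of
  \<open>|b|\<^sup>2\<close> that absorbs the corresponding term of the second moment.
\<close>

lemma isotropic_bound:
  fixes u :: "nat \<Rightarrow> 'w \<Rightarrow> real ^ 'd"
  assumes "prob_space M" and N: "0 < N" and c: "0 < c" and \<epsilon>: "0 \<le> \<epsilon>" and N': "real N \<le> N'"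
    and ind: "prob_space.indep_vars M (\<lambda>_. borel) u {..<N}"
    and law: "\<And>j. j < N \<Longrightarrow> distr M borel (u j) = D"
    and moment: "integrable D (\<lambda>u. norm u ^ 6)"
    and second: "\<And>v w. (LINT u|D. (v \<bullet> u) * (w \<bullet> u)) = (v \<bullet> w) / c"
    and rem: "\<And>w. (LINT u|D. remainder x u * (w \<bullet> u)) \<le> \<epsilon> * norm w"
    and fourth: "(LINT u|D. (quot x u)\<^sup>2 * (norm u)\<^sup>2) \<le> W"
  defines "g \<equiv> \<lambda>\<omega>. grad_est (c / real N) \<nu> N (\<lambda>j. u j \<omega>) F x"
  shows "(norm (gradF x))\<^sup>2 / 2 - (c * \<epsilon>)\<^sup>2 / 2 - c\<^sup>2 * W / (8 * N')
    \<le> (LINT \<omega>|M. gradF x \<bullet> g \<omega> - real N / (8 * N') * (norm (g \<omega>))\<^sup>2)"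
proof -
  interpret prob_space M by fact
  have u[measurable]: "u j \<in> borel_measurable M" if "j < N" for j
    using ind that by (auto simp: indep_vars_def)
  have D: "prob_space D" "sets D = sets borel"
    using law[OF N] prob_space_distr[OF u[OF N]] by auto
  interpret D: prob_space D by (rule D)
  note [measurable_cong] = D(2)
  let ?X = "\<lambda>u. quot x u *\<^sub>R u"
  have X_meas[measurable]: "?X \<in> borel_measurable borel" by measurable
  define m where "m = (LINT u|D. ?X u)"
  define S where "S = (LINT u|D. (norm (?X u))\<^sup>2)"
  have pow: "integrable D (\<lambda>u. norm u ^ k)" if "k \<le> 6" for k
    by (rule integrable_norm_power_mono[OF D.finite_measure_axioms _ moment that]) measurable
  have sqX: "integrable D (\<lambda>u. (norm (?X u))\<^sup>2)"
  proof (rule Bochner_Integration.integrable_bound)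
    show "integrable D (\<lambda>u. 2 * (norm (gradF x))\<^sup>2 * norm u ^ 4 + L\<^sup>2 * \<nu>\<^sup>2 / 2 * norm u ^ 6)"
      by (intro Bochner_Integration.integrable_add integrable_mult_right pow) simp_all
  qed (use order_trans[OF norm_quot_scaleR_le abs_ge_self] in auto)
  have squ: "integrable D (\<lambda>u. (norm u)\<^sup>2)" by (rule pow) simp
  have X_law: "distr M borel (\<lambda>\<omega>. ?X (u j \<omega>)) = distr D borel ?X" if "j < N" for j
    using distr_distr[OF X_meas u[OF that]] by (simp add: law[OF that] comp_def)
  have X_ind: "indep_vars (\<lambda>_. borel) (\<lambda>j \<omega>. ?X (u j \<omega>)) {..<N}"
    by (rule indep_vars_compose2[OF ind]) measurable
  have D_sq: "integrable (distr D borel ?X) (\<lambda>v. (norm v)\<^sup>2)"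
    and D_S: "(LINT v|distr D borel ?X. (norm v)\<^sup>2) = S" and D_m: "(LINT v|distr D borel ?X. v) = m"
    using sqX by (simp_all add: integrable_distr_eq integral_distr S_def m_def)
  note iid = iid_sum_second_moment[OF X_ind X_law D_sq, unfolded D_S D_m]
  have g: "g \<omega> = (c / real N) *\<^sub>R (\<Sum>j<N. ?X (u j \<omega>))" for \<omega>
    by (simp add: g_def grad_est_quot)
  define gb where "gb = c *\<^sub>R m"
  define e where "e = gb - gradF x"
  have Eg: "(LINT \<omega>|M. gradF x \<bullet> g \<omega>) = gradF x \<bullet> gb" and intg: "integrable M (\<lambda>\<omega>. gradF x \<bullet> g \<omega>)"
    unfolding g using iid(3,4) N by (simp_all add: gb_def inner_sum_right[symmetric] del: scaleR_sum_right)
  have g2: "(norm (g \<omega>))\<^sup>2 = (c / real N)\<^sup>2 * (norm (\<Sum>j<N. ?X (u j \<omega>)))\<^sup>2" for \<omega>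
    by (simp add: g power_mult_distrib power_divide)
  have intg2: "integrable M (\<lambda>\<omega>. (norm (g \<omega>))\<^sup>2)"
    unfolding g2 by (intro integrable_mult_right iid(1))
  have "(LINT \<omega>|M. (norm (g \<omega>))\<^sup>2) = (c / real N)\<^sup>2 * (real N * S + real N * (real N - 1) * (norm m)\<^sup>2)"
    unfolding g2 integral_mult_right_zero by (simp only: iid(2))
  also have "\<dots> = (c\<^sup>2 * S + (real N - 1) * (c\<^sup>2 * (norm m)\<^sup>2)) / real N"
    using N by (simp add: power_divide field_simps power2_eq_square)
  finally have Eg2: "(LINT \<omega>|M. (norm (g \<omega>))\<^sup>2) = (c\<^sup>2 * S + (real N - 1) * (norm gb)\<^sup>2) / real N"
    by (simp add: gb_def power_mult_distrib)
  have S: "S \<le> W" unfolding S_def using fourth by (simp add: power_mult_distrib)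
  have int_inner: "integrable D (\<lambda>u. (v \<bullet> u) * (w \<bullet> u))" for v w
  proof (rule Bochner_Integration.integrable_bound[OF integrable_mult_right[OF squ, of "norm v * norm w"]])
    show "AE u in D. norm ((v \<bullet> u) * (w \<bullet> u)) \<le> norm (norm v * norm w * (norm u)\<^sup>2)"
    proof (intro AE_I2)
      fix u :: "real ^ 'd"
      show "norm ((v \<bullet> u) * (w \<bullet> u)) \<le> norm (norm v * norm w * (norm u)\<^sup>2)"
        using mult_mono[OF Cauchy_Schwarz_ineq2[of v u] Cauchy_Schwarz_ineq2[of w u]]
        by (simp add: abs_mult power2_eq_square mult_ac)
    qed
  qed measurable
  \<comment> \<open>The bias is tested against itself. The linear part of \<open>quot\<close>
    contributes \<open>gradF x \<bullet> e\<close>, because \<open>c\<close> normalizes the second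
    moment, and cancels; only the remainder survives.\<close>
  have "(norm e)\<^sup>2 = c * (e \<bullet> m) - gradF x \<bullet> e"
    by (simp add: power2_norm_eq_inner e_def gb_def inner_diff_left inner_diff_right inner_commute algebra_simps)
  also have "e \<bullet> m = (LINT u|D. e \<bullet> ?X u)"
    unfolding m_def by (rule integral_inner_right[symmetric]) (use D.square_integrable_imp_integrable_norm[OF _ sqX] in auto)
  also have "\<dots> = (LINT u|D. remainder x u * (e \<bullet> u) + (gradF x \<bullet> u) * (e \<bullet> u))"
    by (simp add: remainder_def algebra_simps)
  also have "\<dots> = (LINT u|D. remainder x u * (e \<bullet> u)) + (LINT u|D. (gradF x \<bullet> u) * (e \<bullet> u))"
  proof (rule Bochner_Integration.integral_add[OF _ int_inner])
    have "integrable D (\<lambda>u. e \<bullet> ?X u - (gradF x \<bullet> u) * (e \<bullet> u))"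
      by (intro Bochner_Integration.integrable_diff int_inner integrable_inner_right)
         (use D.square_integrable_imp_integrable_norm[OF _ sqX] in auto)
    then show "integrable D (\<lambda>u. remainder x u * (e \<bullet> u))"
      by (simp add: remainder_def algebra_simps)
  qed
  also have "c * \<dots> - gradF x \<bullet> e = c * (LINT u|D. remainder x u * (e \<bullet> u))"
    using c by (simp add: second distrib_left)
  also have "\<dots> \<le> (c * \<epsilon>) * norm e"
    using mult_left_mono[OF rem[of e], of c] c by (simp add: mult_ac)
  finally have "norm e * norm e \<le> (c * \<epsilon>) * norm e" by (simp add: power2_eq_square)
  then have "norm e \<le> c * \<epsilon>"
    using c \<epsilon> by (cases "norm e = 0") (auto simp: mult_le_cancel_right)
  then have e: "(norm e)\<^sup>2 \<le> (c * \<epsilon>)\<^sup>2" by (intro power_mono) auto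
  have N'_pos: "0 < N'" using N N' by simp
  have "(norm (gradF x))\<^sup>2 / 2 - (c * \<epsilon>)\<^sup>2 / 2 - c\<^sup>2 * W / (8 * N')
      \<le> (norm (gradF x))\<^sup>2 / 2 - (norm e)\<^sup>2 / 2 - c\<^sup>2 * S / (8 * N')"
    using e S N'_pos by (intro diff_mono divide_right_mono mult_left_mono) auto
  \<comment> \<open>The added term is what is left of the squared norm of \<open>gb\<close> after
    the second moment has taken its share, a fraction \<open>(real N - 1) / (8 * N')\<close> below
    1/8.\<close>
  also have "\<dots> \<le> (norm (gradF x))\<^sup>2 / 2 - (norm e)\<^sup>2 / 2 - c\<^sup>2 * S / (8 * N') + (norm gb)\<^sup>2 * (1 / 2 - (real N - 1) / (8 * N'))"
  proof -
    have "0 \<le> 1 / 2 - (real N - 1) / (8 * N')" using N' N'_pos by (simp add: field_simps)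
    then have "0 \<le> (norm gb)\<^sup>2 * (1 / 2 - (real N - 1) / (8 * N'))" by simp
    then show ?thesis by simp
  qed
  also have "\<dots> = gradF x \<bullet> gb - real N / (8 * N') * ((c\<^sup>2 * S + (real N - 1) * (norm gb)\<^sup>2) / real N)"
  proof -
    have "gradF x \<bullet> gb = (norm (gradF x))\<^sup>2 / 2 + (norm gb)\<^sup>2 / 2 - (norm e)\<^sup>2 / 2"
      by (simp add: power2_norm_eq_inner e_def inner_diff_left inner_diff_right inner_commute field_simps)
    moreover have "real N / (8 * N') * ((c\<^sup>2 * S + (real N - 1) * (norm gb)\<^sup>2) / real N)
        = c\<^sup>2 * S / (8 * N') + (real N - 1) * (norm gb)\<^sup>2 / (8 * N')"
    proof -
      have "real N / (8 * N') * (y / real N) = y / (8 * N')" for y using N by simp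
      then show ?thesis by (simp only: add_divide_distrib[symmetric])
    qed
    moreover have "(norm gb)\<^sup>2 * (1 / 2 - (real N - 1) / (8 * N')) = (norm gb)\<^sup>2 / 2 - (real N - 1) * (norm gb)\<^sup>2 / (8 * N')"
      by (simp only: right_diff_distrib) (simp add: mult.commute)
    ultimately show ?thesis by simp
  qed
  also have "\<dots> = (LINT \<omega>|M. gradF x \<bullet> g \<omega> - real N / (8 * N') * (norm (g \<omega>))\<^sup>2)"
    using intg intg2 by (simp add: Eg Eg2)
  finally show ?thesis .
qed


section \<open>Lower bounds with the explicit constants of each method\<close>

lemma grad_est_cong: "(\<And>j. j < N \<Longrightarrow> u j = v j) \<Longrightarrow> grad_est c \<nu> N u \<phi> x = grad_est c \<nu> N v \<phi> x"
  by (simp add: grad_est_def)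

lemma directions_bound_GS:
  fixes u :: "nat \<Rightarrow> 'w \<Rightarrow> real ^ 'd"
  assumes M: "prob_space M" and N: "0 < N" and "0 < \<mu>"
    and ind: "prob_space.indep_vars M (\<lambda>_. borel) u {..<N}"
    and dist: "\<And>j. j < N \<Longrightarrow> distributed M lborel (u j) (\<lambda>v. ennreal (\<Prod>i\<in>UNIV. std_normal_density (v $ i)))"
  defines "d \<equiv> real CARD('d)"
  shows "(norm (gradF x))\<^sup>2 / 4 - \<mu> * neighborhood GS N CARD('d) L \<mu> \<nu> / 2
    \<le> (LINT \<omega>|M. gradF x \<bullet> grad_est (1 / real N) \<nu> N (\<lambda>j. u j \<omega>) F x
          - real N / (8 * (real N + 4.5 * d)) * (norm (grad_est (1 / real N) \<nu> N (\<lambda>j. u j \<omega>) F x))\<^sup>2)"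
    and "\<And>j. j < N \<Longrightarrow> integrable M (\<lambda>\<omega>. norm (u j \<omega>) ^ 6)"
proof -
  interpret prob_space M by fact
  have u[measurable]: "u j \<in> borel_measurable M" if "j < N" for j
    using ind that by (auto simp: indep_vars_def)
  have law: "distr M borel (u j) = gaussian" if "j < N" for j
  proof -
    have "distr M borel (u j) = distr M lborel (u j)" by (rule distr_cong) auto
    then show ?thesis using dist[OF that] by (simp add: distributed_def gaussian_def gauss_def)
  qed
  have prob: "prob_space (gaussian :: (real ^ 'd) measure)"
    using prob_space_distr[OF u[OF N]] by (simp add: law[OF N])
  note int = integrable_gaussian_norm[OF prob]
  show "integrable M (\<lambda>\<omega>. norm (u j \<omega>) ^ 6)" if "j < N" for j
    using int[of 6] integrable_distr_eq[OF u[OF that], of "\<lambda>v. norm v ^ 6"] by (simp add: law[OF that])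
  define a where "a = (norm (gradF x))\<^sup>2"
  define N' where "N' = real N + 4.5 * d"
  \<comment> \<open>Linear part and remainder of \<open>quot\<close> each count twice after
    squaring. The first meets the moment \<open>d + 2\<close>; the second meets the sixth moment,
    the origin of (d + 2) (d + 4) in the neighborhood size.\<close>
  define W where "W = 2 * ((d + 2) * a) + L\<^sup>2 * \<nu>\<^sup>2 / 2 * (d * (d + 2) * (d + 4))"
  have d: "1 \<le> d" and N1: "1 \<le> real N" using N by (simp_all add: d_def)
  have "(LINT u|gaussian. (quot x u)\<^sup>2 * (norm u)\<^sup>2)
    \<le> (LINT u|gaussian. 2 * ((gradF x \<bullet> u)\<^sup>2 * (norm u)\<^sup>2) + L\<^sup>2 * \<nu>\<^sup>2 / 2 * norm u ^ 6)"
  proof (rule integral_mono_AE')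
    show "integrable gaussian (\<lambda>u. 2 * ((gradF x \<bullet> u)\<^sup>2 * (norm u)\<^sup>2) + L\<^sup>2 * \<nu>\<^sup>2 / 2 * norm u ^ 6)"
      using gaussian_inner_norm(1)[OF prob] int by (intro Bochner_Integration.integrable_add integrable_mult_right)
    show "AE u in gaussian. (quot x u)\<^sup>2 * (norm u)\<^sup>2 \<le> 2 * ((gradF x \<bullet> u)\<^sup>2 * (norm u)\<^sup>2) + L\<^sup>2 * \<nu>\<^sup>2 / 2 * norm u ^ 6"
    proof (intro AE_I2)
      fix u :: "real ^ 'd"
      show "(quot x u)\<^sup>2 * (norm u)\<^sup>2 \<le> 2 * ((gradF x \<bullet> u)\<^sup>2 * (norm u)\<^sup>2) + L\<^sup>2 * \<nu>\<^sup>2 / 2 * norm u ^ 6"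
        using mult_right_mono[OF quot_square_le[of x u], of "(norm u)\<^sup>2"] by (simp add: algebra_simps flip: power_add)
    qed
  qed simp
  also have "\<dots> = W"
    unfolding W_def a_def d_def
    by (subst Bochner_Integration.integral_add)
       (simp_all add: gaussian_inner_norm[OF prob] gaussian_norm_moments(3)[OF prob] int)
  finally have W: "(LINT u|gaussian. (quot x u)\<^sup>2 * (norm u)\<^sup>2) \<le> W" .
  have "\<mu> * neighborhood GS N CARD('d) L \<mu> \<nu> / 2
      = (8 * real N + 24 * d + (d + 2) * (d + 4)) / (2 * N') * (\<mu> * Omega4 L \<mu> \<nu> CARD('d) / 2)"
    by (simp add: d_def N'_def)
  also have "\<dots> = (8 * real N + 24 * d + (d + 2) * (d + 4)) / (2 * N') * (d * (3 / 4 * (L * \<nu> / 2)\<^sup>2))"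
    unfolding Omega4_scale[OF \<open>0 < \<mu>\<close>] d_def[symmetric] ..
  finally have "a / 4 - \<mu> * neighborhood GS N CARD('d) L \<mu> \<nu> / 2
      = a / 4 - (8 * real N + 24 * d + (d + 2) * (d + 4)) / (2 * N') * (d * (3 / 4 * (L * \<nu> / 2)\<^sup>2))"
    by simp
  also have "\<dots> \<le> a / 2 - (1 * (L * \<nu> * sqrt d))\<^sup>2 / 2 - 1\<^sup>2 * W / (8 * N')"
  proof -
    define q where "q = L\<^sup>2 * \<nu>\<^sup>2 * d"
    have q: "0 \<le> q" and a: "0 \<le> a" and N': "0 < N'" using d N1 by (simp_all add: q_def a_def N'_def)
    \<comment> \<open>Over the common denominator the coefficient of \<open>a\<close> is 2 N + 7 d -
      4. In the coefficient of \<open>q\<close> the \<open>24 * d\<close> of the neighborhood size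
      cancels exactly against the \<open>4.5 * d\<close> of \<open>N'\<close>, leaving 2 N + (d + 2)
      (d + 4) / 4.\<close>
    have "a / 2 - (1 * (L * \<nu> * sqrt d))\<^sup>2 / 2 - 1\<^sup>2 * W / (8 * N')
        - (a / 4 - (8 * real N + 24 * d + (d + 2) * (d + 4)) / (2 * N') * (d * (3 / 4 * (L * \<nu> / 2)\<^sup>2)))
      = (a * (2 * N' - 2 * (d + 2)) + q * (4 * (8 * real N + 24 * d) * 3 / 16 - 4 * N' + (d + 2) * (d + 4) / 4)) / (8 * N')"
      using N' d by (simp add: q_def W_def power_mult_distrib power_divide field_simps power2_eq_square)
    also have "\<dots> \<ge> 0"
      using N' q a d N1 by (intro divide_nonneg_pos add_nonneg_nonneg mult_nonneg_nonneg) (auto simp: N'_def field_simps)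
    finally show ?thesis by simp
  qed
  also have "\<dots> \<le> (LINT \<omega>|M. gradF x \<bullet> grad_est (1 / real N) \<nu> N (\<lambda>j. u j \<omega>) F x
          - real N / (8 * N') * (norm (grad_est (1 / real N) \<nu> N (\<lambda>j. u j \<omega>) F x))\<^sup>2)"
    unfolding a_def
  proof (rule isotropic_bound[OF M N _ _ _ ind law int _ _ W])
    show "(LINT u|gaussian. remainder x u * (w \<bullet> u)) \<le> L * \<nu> * sqrt d * norm w" for w
      using gaussian_remainder[OF prob] by (simp add: d_def)
  qed (use L_pos \<nu>_pos d in \<open>simp_all add: N'_def gaussian_inner[OF prob]\<close>)
  finally show "(norm (gradF x))\<^sup>2 / 4 - \<mu> * neighborhood GS N CARD('d) L \<mu> \<nu> / 2
    \<le> (LINT \<omega>|M. gradF x \<bullet> grad_est (1 / real N) \<nu> N (\<lambda>j. u j \<omega>) F x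
          - real N / (8 * (real N + 4.5 * d)) * (norm (grad_est (1 / real N) \<nu> N (\<lambda>j. u j \<omega>) F x))\<^sup>2)"
    by (simp add: a_def N'_def)
qed

lemma directions_bound_SS:
  fixes u :: "nat \<Rightarrow> 'w \<Rightarrow> real ^ 'd"
  assumes M: "prob_space M" and N: "0 < N" and "0 < \<mu>"
    and ind: "prob_space.indep_vars M (\<lambda>_. borel) u {..<N}"
    and law: "\<And>j. j < N \<Longrightarrow> distr M borel (u j) = uniform_sphere"
  defines "d \<equiv> real CARD('d)"
  shows "(norm (gradF x))\<^sup>2 / 4 - \<mu> * neighborhood SS N CARD('d) L \<mu> \<nu> / 2
    \<le> (LINT \<omega>|M. gradF x \<bullet> grad_est (d / real N) \<nu> N (\<lambda>j. u j \<omega>) F x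
          - real N / (8 * (real N + 4.5 * d)) * (norm (grad_est (d / real N) \<nu> N (\<lambda>j. u j \<omega>) F x))\<^sup>2)"
    and "\<And>j. j < N \<Longrightarrow> integrable M (\<lambda>\<omega>. norm (u j \<omega>) ^ 6)"
proof -
  interpret prob_space M by fact
  interpret \<sigma>: prob_space "uniform_sphere :: (real ^ 'd) measure" by (rule prob_space_uniform_sphere)
  have u[measurable]: "u j \<in> borel_measurable M" if "j < N" for j
    using ind that by (auto simp: indep_vars_def)
  have int: "integrable uniform_sphere (\<lambda>u :: real ^ 'd. norm u ^ 6)"
    by (rule integrable_uniform_sphere[where C=1]) simp_all
  show "integrable M (\<lambda>\<omega>. norm (u j \<omega>) ^ 6)" if "j < N" for j
    using int integrable_distr_eq[OF u[OF that], of "\<lambda>v. norm v ^ 6"] by (simp add: law[OF that])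
  define a where "a = (norm (gradF x))\<^sup>2"
  define N' where "N' = real N + 4.5 * d"
  define W where "W = 2 * (a / d) + L\<^sup>2 * \<nu>\<^sup>2 / 2"
  have d: "1 \<le> d" and N1: "1 \<le> real N" using N by (simp_all add: d_def)
  have sq: "integrable uniform_sphere (\<lambda>u. (gradF x \<bullet> u)\<^sup>2)" "(LINT u|uniform_sphere. (gradF x \<bullet> u)\<^sup>2) = a / d"
    using integrable_uniform_sphere_inner[of "gradF x" "gradF x"] uniform_sphere_inner[of "gradF x" "gradF x"]
    by (simp_all add: a_def d_def power2_eq_square[of "gradF x \<bullet> _"] power2_norm_eq_inner)
  have "(LINT u|uniform_sphere. (quot x u)\<^sup>2 * (norm u)\<^sup>2)
    \<le> (LINT u|uniform_sphere. 2 * (gradF x \<bullet> u)\<^sup>2 + L\<^sup>2 * \<nu>\<^sup>2 / 2)"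
  proof (rule integral_mono_AE')
    show "integrable uniform_sphere (\<lambda>u. 2 * (gradF x \<bullet> u)\<^sup>2 + L\<^sup>2 * \<nu>\<^sup>2 / 2)"
      using sq(1) by simp
    show "AE u in uniform_sphere. (quot x u)\<^sup>2 * (norm u)\<^sup>2 \<le> 2 * (gradF x \<bullet> u)\<^sup>2 + L\<^sup>2 * \<nu>\<^sup>2 / 2"
      using AE_uniform_sphere
    proof eventually_elim
      case (elim u)
      then show ?case using quot_square_le[of x u] by simp
    qed
  qed simp
  also have "\<dots> = W"
    using sq \<sigma>.prob_space by (simp add: W_def)
  finally have W: "(LINT u|uniform_sphere. (quot x u)\<^sup>2 * (norm u)\<^sup>2) \<le> W" .
  have "\<mu> * neighborhood SS N CARD('d) L \<mu> \<nu> / 2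
      = (8 * real N + 24 * d + d\<^sup>2) / ((2 * real N + 9 * d) * d) * (\<mu> * Omega4 L \<mu> \<nu> CARD('d) / 2)"
    by (simp add: d_def)
  also have "\<dots> = (8 * real N + 24 * d + d\<^sup>2) / (2 * N') * (3 / 4 * (L * \<nu> / 2)\<^sup>2)"
    unfolding Omega4_scale[OF \<open>0 < \<mu>\<close>] d_def[symmetric] using d by (simp add: N'_def)
  finally have nb: "\<mu> * neighborhood SS N CARD('d) L \<mu> \<nu> / 2 = (8 * real N + 24 * d + d\<^sup>2) / (2 * N') * (3 / 4 * (L * \<nu> / 2)\<^sup>2)" .
  have "a / 4 - \<mu> * neighborhood SS N CARD('d) L \<mu> \<nu> / 2 \<le> a / 2 - (d * (L * \<nu> / d))\<^sup>2 / 2 - d\<^sup>2 * W / (8 * N')"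
  proof -
    define q where "q = L\<^sup>2 * \<nu>\<^sup>2"
    have q: "0 \<le> q" and a: "0 \<le> a" and N': "0 < N'" using d N1 by (simp_all add: q_def a_def N'_def)
    \<comment> \<open>The balance is that of the Gaussian case, with coefficients 2 N + 7 d and 2 N
      + d^2 / 4. Here \<open>q\<close> carries no \<open>d\<close>, since the one in
      \<open>Omega4\<close> cancels the extra \<open>d\<close> in the denominator of the
      neighborhood size.\<close>
    have "a / 2 - (d * (L * \<nu> / d))\<^sup>2 / 2 - d\<^sup>2 * W / (8 * N') - (a / 4 - \<mu> * neighborhood SS N CARD('d) L \<mu> \<nu> / 2)
      = (a * (2 * N' - 2 * d) + q * (4 * (8 * real N + 24 * d) * 3 / 16 - 4 * N' + d\<^sup>2 / 4)) / (8 * N')"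
      unfolding nb using N' d by (simp add: q_def W_def power_mult_distrib power_divide field_simps power2_eq_square)
    also have "\<dots> \<ge> 0"
      using N' q a d N1 by (intro divide_nonneg_pos add_nonneg_nonneg mult_nonneg_nonneg) (auto simp: N'_def field_simps)
    finally show ?thesis by simp
  qed
  also have "\<dots> \<le> (LINT \<omega>|M. gradF x \<bullet> grad_est (d / real N) \<nu> N (\<lambda>j. u j \<omega>) F x
          - real N / (8 * N') * (norm (grad_est (d / real N) \<nu> N (\<lambda>j. u j \<omega>) F x))\<^sup>2)"
    unfolding a_def
  proof (rule isotropic_bound[OF M N _ _ _ ind law int _ _ W])
    show "(LINT u|uniform_sphere. remainder x u * (w \<bullet> u)) \<le> L * \<nu> / d * norm w" for w
      using uniform_sphere_remainder[of x w] by (simp add: d_def)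
  qed (use L_pos \<nu>_pos d in \<open>simp_all add: N'_def uniform_sphere_inner d_def[symmetric]\<close>)
  finally show "(norm (gradF x))\<^sup>2 / 4 - \<mu> * neighborhood SS N CARD('d) L \<mu> \<nu> / 2
    \<le> (LINT \<omega>|M. gradF x \<bullet> grad_est (d / real N) \<nu> N (\<lambda>j. u j \<omega>) F x
          - real N / (8 * (real N + 4.5 * d)) * (norm (grad_est (d / real N) \<nu> N (\<lambda>j. u j \<omega>) F x))\<^sup>2)"
    by (simp add: a_def N'_def)
qed


text \<open>The weight of the squared estimator is 1/8 of the factor in front of
  \<open>Omega1\<close>, so \<open>\<theta>\<close> cancels and each method falls under one of the
  bounds above. The sixth moments feed the integrability proofs for one iteration.\<close>

lemma directions_bound:
  fixes u :: "nat \<Rightarrow> 'w \<Rightarrow> real ^ 'd" and x :: "real ^ 'd"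
  assumes M: "prob_space M" and N: "0 < N" and \<mu>: "0 < \<mu>" and dir: "directions m M N u"
    and u[measurable]: "\<And>j. j < N \<Longrightarrow> u j \<in> borel_measurable M"
  defines "g \<equiv> \<lambda>\<omega>. grad_est (scaling m N CARD('d)) \<nu> N (\<lambda>j. u j \<omega>) F x"
  shows "(norm (gradF x))\<^sup>2 / 4 - \<mu> * neighborhood m N CARD('d) L \<mu> \<nu> / 2
    \<le> (LINT \<omega>|M. gradF x \<bullet> g \<omega> - step_size m N CARD('d) \<theta> L * L * (1 + \<theta>\<^sup>2) / 2 * (norm (g \<omega>))\<^sup>2)" (is ?bound)
    and "\<And>j. j < N \<Longrightarrow> integrable M (\<lambda>\<omega>. norm (u j \<omega>) ^ 6)" (is "\<And>j. _ \<Longrightarrow> ?int j")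
proof -
  interpret prob_space M by fact
  have step: "b * Omega1 \<theta> L * L * (1 + \<theta>\<^sup>2) / 2 = b / 8" for b
  proof -
    have "b * Omega1 \<theta> L * L * (1 + \<theta>\<^sup>2) / 2 = b * (Omega1 \<theta> L * L * (1 + \<theta>\<^sup>2)) / 2" by (simp only: mult.assoc)
    then show ?thesis unfolding Omega1_scale[OF L_pos] by simp
  qed
  have unit: "?int j" if "\<And>\<omega>. \<omega> \<in> space M \<Longrightarrow> norm (u j \<omega>) = 1" for j
    by (subst Bochner_Integration.integrable_cong[of M M _ "\<lambda>_. 1 :: real"]) (simp_all add: that)
  \<comment> \<open>Serves RC with the constant standard basis and RS with the random one.\<close>
  have sampling: "?bound \<and> (\<forall>j<N. ?int j)"
    if m: "m = RC \<or> m = RS" and "N \<le> CARD('d)" "sampled_without_replacement M N B u"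
      "\<And>\<omega> i j. \<omega> \<in> space M \<Longrightarrow> B i \<omega> \<bullet> B j \<omega> = (if i = j then 1 else 0)" for B
  proof -
    note b = sampling_bound[OF M N that(2,4,3)]
    have "real N / real CARD('d) * Omega1 \<theta> L * L * (1 + \<theta>\<^sup>2) / 2 = 1 / (8 * (real CARD('d) / real N))"
      unfolding step by simp
    then have "step_size m N CARD('d) \<theta> L * L * (1 + \<theta>\<^sup>2) / 2 = 1 / (8 * (real CARD('d) / real N))"
      using m by (elim disjE) simp_all
    moreover have "scaling m N CARD('d) = real CARD('d) / real N" using m by auto
    moreover have "\<mu> * neighborhood m N CARD('d) L \<mu> \<nu> / 2 = real CARD('d) * (3 / 4 * (L * \<nu> / 2)\<^sup>2)"
      using m Omega4_scale[OF \<mu>] by (elim disjE) simp_all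
    ultimately show ?thesis
      using b(1)[of x] unit[OF b(2)] by (simp only: g_def) blast
  qed
  have "?bound \<and> (\<forall>j<N. ?int j)"
  proof (cases m)
    case FD
    then obtain e where N: "N = CARD('d)" and e: "bij_betw e {..<N} (Basis :: (real ^ 'd) set)"
      and ue: "\<And>j \<omega>. j < N \<Longrightarrow> \<omega> \<in> space M \<Longrightarrow> u j \<omega> = e j"
      using dir by auto
    have B: "b \<bullet> b' = (if b = b' then 1 else 0)" if "b \<in> Basis" "b' \<in> Basis" for b b' :: "real ^ 'd"
      using that by (simp add: inner_Basis)
    have k: "step_size m N CARD('d) \<theta> L * L * (1 + \<theta>\<^sup>2) / 2 = 1 / 8"
      unfolding FD step_size.simps using step[of 1] by (simp only: mult_1)
    have "(norm (gradF x))\<^sup>2 / 4 - \<mu> * neighborhood m N CARD('d) L \<mu> \<nu> / 2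
        = (norm (gradF x))\<^sup>2 / 4 - real CARD('d) * (3 / 4 * (L * \<nu> / 2)\<^sup>2)"
      using Omega4_scale[OF \<mu>] FD by simp
    also have "\<dots> \<le> (\<Sum>b\<in>Basis. quot x b * (gradF x \<bullet> b) - (quot x b)\<^sup>2 / 8)"
      using orthonormal_bound[of Basis "\<lambda>b. b" x] B by (simp add: DIM_cart)
    also have "\<dots> = gradF x \<bullet> grad_est 1 \<nu> N e F x - 1 / 8 * (norm (grad_est 1 \<nu> N e F x))\<^sup>2"
      using orthonormal_estimate[of Basis "\<lambda>b. b" e N 1 x] B e by simp
    also have "\<dots> = (LINT \<omega>|M. gradF x \<bullet> grad_est 1 \<nu> N e F x - 1 / 8 * (norm (grad_est 1 \<nu> N e F x))\<^sup>2)"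
      using prob_space by simp
    also have "\<dots> = (LINT \<omega>|M. gradF x \<bullet> g \<omega> - step_size m N CARD('d) \<theta> L * L * (1 + \<theta>\<^sup>2) / 2 * (norm (g \<omega>))\<^sup>2)"
    proof (rule Bochner_Integration.integral_cong[OF refl])
      fix \<omega> assume "\<omega> \<in> space M"
      then have "g \<omega> = grad_est 1 \<nu> N e F x"
        using ue FD by (auto simp: g_def intro!: grad_est_cong)
      then show "gradF x \<bullet> grad_est 1 \<nu> N e F x - 1 / 8 * (norm (grad_est 1 \<nu> N e F x))\<^sup>2
        = gradF x \<bullet> g \<omega> - step_size m N CARD('d) \<theta> L * L * (1 + \<theta>\<^sup>2) / 2 * (norm (g \<omega>))\<^sup>2"
        by (simp only: k)
    qed
    finally have ?bound .
    moreover have "?int j" if "j < N" for j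
    proof (rule unit)
      show "norm (u j \<omega>) = 1" if "\<omega> \<in> space M" for \<omega>
        using bij_betw_apply[OF e, of j] ue[OF \<open>j < N\<close> that] \<open>j < N\<close> by simp
    qed
    ultimately show ?thesis by blast
  next
    case GS
    have k: "step_size m N CARD('d) \<theta> L * L * (1 + \<theta>\<^sup>2) / 2 = real N / (8 * (real N + 4.5 * real CARD('d)))"
      using step[of "real N / (real N + 4.5 * real CARD('d))"] GS by simp
    show ?thesis
      using directions_bound_GS(1)[OF M N \<mu>, where u=u and x=x] directions_bound_GS(2)[OF M N \<mu>, where u=u] dir unfolding g_def k by (simp add: GS)
  next
    case SS
    have k: "step_size m N CARD('d) \<theta> L * L * (1 + \<theta>\<^sup>2) / 2 = real N / (8 * (real N + 4.5 * real CARD('d)))"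
      using step[of "real N / (real N + 4.5 * real CARD('d))"] SS by simp
    show ?thesis
      using directions_bound_SS(1)[OF M N \<mu>, where u=u and x=x] directions_bound_SS(2)[OF M N \<mu>, where u=u] dir unfolding g_def k by (simp add: SS)
  next
    case RC
    then show ?thesis
      using dir by (intro sampling[of "\<lambda>i \<omega>. axis i 1"]) (auto simp: inner_axis_axis)
  next
    case RS
    then show ?thesis
      using dir sampling by auto
  qed
  then show ?bound "\<And>j. j < N \<Longrightarrow> ?int j" by blast+
qed

end

section \<open>Sample sizes and the sampling error\<close>

text \<open>Replacing \<open>y\<close> by a nearby point of a countable dense sequence gives
  functions that are measurable piece by piece; continuity in \<open>y\<close> makes them converge
  pointwise.\<close>

lemma borel_measurable_Caratheodory:
  fixes f :: "'a::{metric_space, second_countable_topology} \<Rightarrow> 'z \<Rightarrow> 'b::metric_space"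
  assumes meas: "\<And>y. f y \<in> borel_measurable P"
    and cont: "\<And>z. z \<in> space P \<Longrightarrow> continuous_on UNIV (\<lambda>y. f y z)"
  shows "(\<lambda>(y, z). f y z) \<in> borel_measurable (borel \<Otimes>\<^sub>M P)"
proof -
  obtain D :: "'a set" where D: "countable D" "\<And>X. open X \<Longrightarrow> X \<noteq> {} \<Longrightarrow> \<exists>d\<in>D. d \<in> X"
    using countable_dense_setE by blast
  have "D \<noteq> {}" using D(2)[of UNIV] by auto
  define d where "d = from_nat_into D"
  have dense: "\<exists>i. dist (d i) y < inverse (real (Suc n))" for y n
  proof -
    obtain e where "e \<in> D" "e \<in> ball y (inverse (real (Suc n)))"
      using D(2)[of "ball y (inverse (real (Suc n)))"] by auto
    then show ?thesis
      using from_nat_into_surj[OF \<open>countable D\<close>, of e] unfolding d_def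
      by (metis dist_commute mem_ball)
  qed
  \<comment> \<open>Taking the least index of a dense point within 1 / (n + 1) makes the choice of
    the approximation measurable in \<open>y\<close>.\<close>
  define q where "q n y = (LEAST i. dist (d i) y < inverse (real (Suc n)))" for n y
  have qd: "dist (d (q n y)) y < inverse (real (Suc n))" for n y
    unfolding q_def by (rule LeastI_ex[OF dense])
  have lim: "(\<lambda>n. d (q n y)) \<longlonglongrightarrow> y" for y
  proof (rule metric_LIMSEQ_I)
    fix r :: real assume "0 < r"
    then obtain m where m: "inverse (real (Suc m)) < r" using reals_Archimedean by auto
    have "dist (d (q n y)) y < r" if "m \<le> n" for n
    proof -
      have "inverse (real (Suc n)) \<le> inverse (real (Suc m))" using that by (simp add: field_simps)
      then show ?thesis using qd[of n y] m by linarith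
    qed
    then show "\<exists>no. \<forall>n\<ge>no. dist (d (q n y)) y < r" by auto
  qed
  show ?thesis
  proof (rule borel_measurable_LIMSEQ_metric)
    fix n
    have [measurable]: "q n \<in> measurable borel (count_space UNIV)"
      unfolding q_def[abs_def] by measurable
    show "(\<lambda>p. f (d (q n (fst p))) (snd p)) \<in> borel_measurable (borel \<Otimes>\<^sub>M P)"
      by (rule measurable_compose_countable[where f="\<lambda>i p. f (d i) (snd p)" and g="\<lambda>p. q n (fst p)"])
         (use meas in measurable)
  next
    fix p assume "p \<in> space ((borel :: 'a measure) \<Otimes>\<^sub>M P)"
    then have "snd p \<in> space P" by (auto simp: space_pair_measure)
    then show "(\<lambda>n. f (d (q n (fst p))) (snd p)) \<longlonglongrightarrow> (case p of (y, z) \<Rightarrow> f y z)"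
      using continuous_on_tendsto_compose[OF cont lim, of "snd p" "fst p"] by (simp add: case_prod_beta)
  qed
qed

text \<open>Each coordinate of the gradient is a limit of measurable difference quotients along the
  steps 1 / (n + 1).\<close>

lemma borel_measurable_gradient:
  fixes f :: "'a::euclidean_space \<Rightarrow> 'z \<Rightarrow> real"
  assumes meas[measurable]: "\<And>y. f y \<in> borel_measurable P"
    and G: "\<And>z. z \<in> space P \<Longrightarrow> GDERIV (\<lambda>y. f y z) y :> g z"
  shows "g \<in> borel_measurable P"
proof (subst borel_measurable_euclidean_space, intro ballI)
  fix b :: 'a assume b: "b \<in> Basis"
  show "(\<lambda>z. g z \<bullet> b) \<in> borel_measurable P"
  proof (rule borel_measurable_LIMSEQ_real)
    fix z assume z: "z \<in> space P"
    have "((\<lambda>t. f (y + t *\<^sub>R b) z) has_derivative (\<lambda>s. (s *\<^sub>R b) \<bullet> g z)) (at 0)"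
      by (rule has_derivative_compose[of "\<lambda>t. y + t *\<^sub>R b" "\<lambda>s. s *\<^sub>R b" 0 UNIV "\<lambda>y. f y z"])
         (use G[OF z] in \<open>auto intro!: derivative_eq_intros simp: gderiv_def\<close>)
    then have "((\<lambda>t. f (y + t *\<^sub>R b) z) has_real_derivative (g z \<bullet> b)) (at 0)"
      by (rule has_derivative_imp_has_field_derivative) (simp add: inner_commute)
    then have "((\<lambda>h. (f (y + h *\<^sub>R b) z - f y z) / h) \<longlongrightarrow> g z \<bullet> b) (at 0)"
      by (simp add: DERIV_def)
    moreover have "filterlim (\<lambda>n. inverse (real (Suc n))) (at 0) sequentially"
      using LIMSEQ_inverse_real_of_nat by (auto simp: filterlim_at)
    ultimately show "(\<lambda>n. (f (y + inverse (real (Suc n)) *\<^sub>R b) z - f y z) / inverse (real (Suc n)))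
        \<longlonglongrightarrow> g z \<bullet> b"
      by (rule filterlim_compose)
  qed measurable
qed

context prob_space
begin

text \<open>The first two conditions can be integrated as they stand. In the third, \<open>V\<close>
  has been averaged over the current directions while \<open>n\<close> may still depend on them; a
  \<open>G\<close>-measurable weight above \<open>1 / n\<close> that respects the same bound allows
  \<open>V\<close> to be exchanged with its conditional expectation.\<close>

lemma sample_size_bound:
  fixes V B :: "'a \<Rightarrow> real" and n :: "'a \<Rightarrow> nat"
  assumes sub: "subalgebra M G"
    and V: "integrable M V" "\<And>\<omega>. 0 \<le> V \<omega>" and B: "integrable M B" "\<And>\<omega>. 0 \<le> B \<omega>"
    and n[measurable]: "n \<in> measurable M (count_space UNIV)" and n_pos: "\<And>\<omega>. \<omega> \<in> space M \<Longrightarrow> 0 < n \<omega>"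
    and cond: "(AE \<omega> in M. V \<omega> / real (n \<omega>) \<le> \<theta>\<^sup>2 * B \<omega>)
       \<or> (AE \<omega> in M. V \<omega> / real (n \<omega>) \<le> \<theta>\<^sup>2 * real_cond_exp M G B \<omega>)
       \<or> (AE \<omega> in M. real_cond_exp M G V \<omega> / real (n \<omega>) \<le> \<theta>\<^sup>2 * real_cond_exp M G B \<omega>)"
  shows "integrable M (\<lambda>\<omega>. V \<omega> / real (n \<omega>))"
    and "(LINT \<omega>|M. V \<omega> / real (n \<omega>)) \<le> \<theta>\<^sup>2 * (LINT \<omega>|M. B \<omega>)"
proof -
  interpret finite_measure_subalgebra M G by unfold_locales (rule sub)
  have [measurable]: "V \<in> borel_measurable M" "B \<in> borel_measurable M" using V B by auto
  have n1: "1 \<le> real (n \<omega>)" if "\<omega> \<in> space M" for \<omega> using n_pos[OF that] by simp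
  show int: "integrable M (\<lambda>\<omega>. V \<omega> / real (n \<omega>))"
  proof (rule Bochner_Integration.integrable_bound[OF V(1)])
    show "AE \<omega> in M. norm (V \<omega> / real (n \<omega>)) \<le> norm (V \<omega>)"
    proof (intro AE_I2)
      fix \<omega> assume "\<omega> \<in> space M"
      then have "V \<omega> / real (n \<omega>) \<le> V \<omega> / 1"
        using n1[of \<omega>] V(2) by (intro divide_left_mono) auto
      then show "norm (V \<omega> / real (n \<omega>)) \<le> norm (V \<omega>)" using V(2) by simp
    qed
  qed measurable
  note cB = real_cond_exp_int[OF B(1)] and cV = real_cond_exp_int[OF V(1)]
  from cond show "(LINT \<omega>|M. V \<omega> / real (n \<omega>)) \<le> \<theta>\<^sup>2 * (LINT \<omega>|M. B \<omega>)"
  proof (elim disjE)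
    assume "AE \<omega> in M. V \<omega> / real (n \<omega>) \<le> \<theta>\<^sup>2 * B \<omega>"
    then have "(LINT \<omega>|M. V \<omega> / real (n \<omega>)) \<le> (LINT \<omega>|M. \<theta>\<^sup>2 * B \<omega>)"
      using B by (intro integral_mono_AE int) auto
    then show ?thesis by simp
  next
    assume "AE \<omega> in M. V \<omega> / real (n \<omega>) \<le> \<theta>\<^sup>2 * real_cond_exp M G B \<omega>"
    then have "(LINT \<omega>|M. V \<omega> / real (n \<omega>)) \<le> (LINT \<omega>|M. \<theta>\<^sup>2 * real_cond_exp M G B \<omega>)"
      using cB by (intro integral_mono_AE int) auto
    then show ?thesis using cB by simp
  next
    assume ae: "AE \<omega> in M. real_cond_exp M G V \<omega> / real (n \<omega>) \<le> \<theta>\<^sup>2 * real_cond_exp M G B \<omega>"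
    define EV where "EV = real_cond_exp M G V"
    define EB where "EB = real_cond_exp M G B"
    have EB0: "AE \<omega> in M. 0 \<le> EB \<omega>"
      unfolding EB_def using B by (intro real_cond_exp_pos) auto
    have [measurable]: "EV \<in> borel_measurable G" "EB \<in> borel_measurable G" by (simp_all add: EV_def EB_def)
    \<comment> \<open>a bounded \<open>G\<close>-measurable majorant of \<open>1 / n\<close>, although \<open>n\<close> itself need not be \<open>G\<close>-measurable\<close>
    define w where "w \<omega> = (if EV \<omega> \<le> 0 then 1 else max 0 (min 1 (\<theta>\<^sup>2 * EB \<omega> / EV \<omega>)))" for \<omega>
    have wG[measurable]: "w \<in> borel_measurable G" unfolding w_def by measurable
    have wM[measurable]: "w \<in> borel_measurable M" by (rule measurable_from_subalg[OF sub wG])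
    \<comment> \<open>Clamping to the unit interval gives these bounds at every outcome, although
      \<open>EB\<close> is known to be nonnegative only almost everywhere.\<close>
    have w01: "0 \<le> w \<omega>" "w \<omega> \<le> 1" for \<omega> by (auto simp: w_def)
    have intw: "integrable M (\<lambda>\<omega>. w \<omega> * V \<omega>)"
      by (rule Bochner_Integration.integrable_bound[OF V(1)])
         (use w01 in \<open>auto simp: abs_mult mult_left_le_one_le\<close>)
    note wE = real_cond_exp_intg[OF intw wG, folded EV_def]
    have "(LINT \<omega>|M. V \<omega> / real (n \<omega>)) \<le> (LINT \<omega>|M. w \<omega> * V \<omega>)"
    proof (intro integral_mono_AE int intw)
      show "AE \<omega> in M. V \<omega> / real (n \<omega>) \<le> w \<omega> * V \<omega>"
        using ae EB0 AE_space
      proof eventually_elim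
        case (elim \<omega>)
        have "1 / real (n \<omega>) \<le> w \<omega>"
        proof (cases "EV \<omega> \<le> 0")
          case False
          then have "1 / real (n \<omega>) \<le> \<theta>\<^sup>2 * EB \<omega> / EV \<omega>"
            using elim(1) by (simp add: EV_def EB_def field_simps)
          moreover have "1 / real (n \<omega>) \<le> 1" using n1[OF elim(3)] by simp
          ultimately show ?thesis using False by (simp add: w_def le_max_iff_disj)
        qed (use n1[OF elim(3)] in \<open>simp add: w_def\<close>)
        then show ?case using mult_right_mono[OF _ V(2)] by fastforce
      qed
    qed
    also have "\<dots> = (LINT \<omega>|M. w \<omega> * EV \<omega>)" using wE V by simp
    also have "\<dots> \<le> (LINT \<omega>|M. \<theta>\<^sup>2 * EB \<omega>)"
    proof (rule integral_mono_AE)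
      show "integrable M (\<lambda>\<omega>. w \<omega> * EV \<omega>)" using wE V by simp
      show "integrable M (\<lambda>\<omega>. \<theta>\<^sup>2 * EB \<omega>)" using cB by (simp add: EB_def)
      show "AE \<omega> in M. w \<omega> * EV \<omega> \<le> \<theta>\<^sup>2 * EB \<omega>"
        using EB0
      proof eventually_elim
        case (elim \<omega>)
        show ?case
        proof (cases "EV \<omega> \<le> 0")
          case True
          then show ?thesis using elim by (simp add: w_def order_trans[OF True])
        next
          case False
          then have "w \<omega> \<le> \<theta>\<^sup>2 * EB \<omega> / EV \<omega>" using elim by (simp add: w_def)
          then show ?thesis using False by (simp add: field_simps)
        qed
      qed
    qed
    also have "\<dots> = \<theta>\<^sup>2 * (LINT \<omega>|M. B \<omega>)" using cB by (simp add: EB_def)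
    finally show ?thesis .
  qed
qed

end

section \<open>One iteration: conditional mean and variance of the estimator\<close>

context forward_difference
begin

text \<open>Cauchy-Schwarz over the directions, at the price of a factor \<open>N\<close>; the bound
  serves integrability only.\<close>

lemma grad_est_norm_le:
  "(norm (grad_est c \<nu> N u F x))\<^sup>2
    \<le> c\<^sup>2 * real N * (\<Sum>j<N. 2 * (norm (gradF x))\<^sup>2 * norm (u j) ^ 4 + L\<^sup>2 * \<nu>\<^sup>2 / 2 * norm (u j) ^ 6)"
proof -
  have "(norm (grad_est c \<nu> N u F x))\<^sup>2 = c\<^sup>2 * (norm (\<Sum>j<N. quot x (u j) *\<^sub>R u j))\<^sup>2"
    by (simp add: grad_est_quot power_mult_distrib)
  also have "\<dots> \<le> c\<^sup>2 * (\<Sum>j<N. norm (quot x (u j) *\<^sub>R u j))\<^sup>2"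
    by (intro mult_left_mono power_mono norm_sum) auto
  also have "\<dots> \<le> c\<^sup>2 * ((\<Sum>j<N. (norm (quot x (u j) *\<^sub>R u j))\<^sup>2) * real (card {..<N}))"
    by (intro mult_left_mono sum_squared_le_sum_of_squares) auto
  also have "\<dots> \<le> c\<^sup>2 * ((\<Sum>j<N. 2 * (norm (gradF x))\<^sup>2 * norm (u j) ^ 4 + L\<^sup>2 * \<nu>\<^sup>2 / 2 * norm (u j) ^ 6) * real (card {..<N}))"
    by (intro mult_left_mono mult_right_mono sum_mono norm_quot_scaleR_le) auto
  finally show ?thesis by (simp add: mult_ac)
qed

end

text \<open>\<open>G0\<close> is the past, \<open>G1\<close> the past together with the current
  directions. The samples are an infinite i.i.d. family independent of \<open>G1\<close>, of which
  the first \<open>n\<close> are used, so a size determined by \<open>G1\<close> leaves their law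
  unchanged. \<open>grad_int\<close> is the integrability handed on by the induction over the
  iterations.\<close>

locale stochastic_step = forward_difference F gradF L \<nu> + prob_space M
  for F :: "real ^ 'd::finite \<Rightarrow> real" and gradF L \<nu> and M :: "'w measure" +
  fixes P :: "'z measure" and f :: "real ^ 'd \<Rightarrow> 'z \<Rightarrow> real" and gradf :: "real ^ 'd \<Rightarrow> 'z \<Rightarrow> real ^ 'd"
    and Lf \<beta>1 \<beta>2 c :: real and N :: nat and u :: "nat \<Rightarrow> 'w \<Rightarrow> real ^ 'd" and z :: "nat \<Rightarrow> 'w \<Rightarrow> 'z"
    and n :: "'w \<Rightarrow> nat" and x :: "'w \<Rightarrow> real ^ 'd" and G0 G1 :: "'w measure"
  assumes P: "prob_space P"
    and f_integrable: "\<And>y. integrable P (f y)" and F_def: "\<And>y. F y = (LINT \<zeta>|P. f y \<zeta>)"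
    and gradf: "\<And>y \<zeta>. \<zeta> \<in> space P \<Longrightarrow> GDERIV (\<lambda>y. f y \<zeta>) y :> gradf y \<zeta>"
    and gradf_lipschitz: "\<And>y y' \<zeta>. \<zeta> \<in> space P \<Longrightarrow> norm (gradf y \<zeta> - gradf y' \<zeta>) \<le> Lf * norm (y - y')"
    and Lf_pos: "0 < Lf" and \<beta>: "0 \<le> \<beta>1" "0 \<le> \<beta>2"
    and gradf_variance: "\<And>y. (\<integral>\<^sup>+ \<zeta>. ennreal ((norm (gradf y \<zeta> - gradF y))\<^sup>2) \<partial>P)
                              \<le> ennreal (\<beta>1 * (norm (gradF y))\<^sup>2 + \<beta>2)"
    and sub0: "subalgebra M G0" and sub1: "subalgebra M G1" and sub01: "sets G0 \<subseteq> sets G1"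
    and x_meas[measurable]: "x \<in> borel_measurable G0"
    and u_meas[measurable]: "\<And>j. j < N \<Longrightarrow> u j \<in> borel_measurable G1"
    and u_fresh: "indep_set (sets G0)
           (sets (vimage_algebra (space M) (\<lambda>\<omega>. \<lambda>j\<in>{..<N}. u j \<omega>) (PiM {..<N} (\<lambda>_. borel))))"
    and u_moment: "\<And>j. j < N \<Longrightarrow> integrable M (\<lambda>\<omega>. norm (u j \<omega>) ^ 6)"
    and z_iid: "indep_vars (\<lambda>_. P) z UNIV" "\<And>i. distr M P (z i) = P"
    and z_fresh: "indep_set (sets G1)
           (sets (vimage_algebra (space M) (\<lambda>\<omega> i. z i \<omega>) (PiM UNIV (\<lambda>_. P))))"
    and n_meas[measurable]: "n \<in> measurable G1 (count_space UNIV)"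
    and n_pos: "\<And>\<omega>. \<omega> \<in> space M \<Longrightarrow> 0 < n \<omega>"
    and grad_int: "integrable M (\<lambda>\<omega>. (norm (gradF (x \<omega>)))\<^sup>2)"
begin

interpretation P: prob_space P by (rule P)

definition g1 :: "'w \<Rightarrow> 'z \<Rightarrow> real ^ 'd" where
  "g1 \<omega> \<zeta> = grad_est c \<nu> N (\<lambda>j. u j \<omega>) (\<lambda>y. f y \<zeta>) (x \<omega>)"
definition gF :: "'w \<Rightarrow> real ^ 'd" where
  "gF \<omega> = grad_est c \<nu> N (\<lambda>j. u j \<omega>) F (x \<omega>)"
definition gS :: "'w \<Rightarrow> real ^ 'd" where
  "gS \<omega> = grad_est c \<nu> N (\<lambda>j. u j \<omega>) (\<lambda>y. (\<Sum>i<n \<omega>. f y (z i \<omega>)) / real (n \<omega>)) (x \<omega>)"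
text \<open>Centred at the explicit function \<open>gF\<close>, a version of the conditional mean,
  so that no null sets intervene.\<close>

definition v :: "'w \<Rightarrow> real" where
  "v \<omega> = (LINT \<zeta>|P. (norm (g1 \<omega> \<zeta> - gF \<omega>))\<^sup>2)"
text \<open>\<open>gS\<close> with the sample sequence as a separate argument: the form needed to
  integrate out the samples with everything else frozen.\<close>

definition \<Gamma> :: "'w \<Rightarrow> (nat \<Rightarrow> 'z) \<Rightarrow> real ^ 'd" where
  "\<Gamma> \<omega> t = (1 / real (n \<omega>)) *\<^sub>R (\<Sum>i<n \<omega>. g1 \<omega> (t i))"

lemma space_G: "space G0 = space M" "space G1 = space M"
  using sub0 sub1 by (auto simp: subalgebra_def)

lemma x_meas1[measurable]: "x \<in> borel_measurable G1"
  by (rule measurable_from_subalg[OF _ x_meas]) (use sub01 in \<open>simp add: subalgebra_def space_G\<close>)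

lemma meas_M: "\<phi> \<in> measurable G1 S \<Longrightarrow> \<phi> \<in> measurable M S"
  by (rule measurable_from_subalg[OF sub1])

lemma z_meas[measurable]: "z i \<in> measurable M P"
  using z_iid(1) by (auto simp: indep_vars_def)

lemma zf_meas[measurable]: "(\<lambda>\<omega> i. z i \<omega>) \<in> measurable M (PiM UNIV (\<lambda>_. P))"
  by (rule measurable_PiM_single') (auto simp: space_PiM dest: measurable_space[OF z_meas])

lemma f_meas[measurable]: "(\<lambda>(y, \<zeta>). f y \<zeta>) \<in> borel_measurable (borel \<Otimes>\<^sub>M P)"
proof (rule borel_measurable_Caratheodory)
  show "continuous_on UNIV (\<lambda>y. f y \<zeta>)" if "\<zeta> \<in> space P" for \<zeta>
    using gradf[OF that] by (auto intro!: continuous_at_imp_continuous_on has_derivative_continuous simp: gderiv_def)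
qed (use f_integrable in auto)

lemma F_meas[measurable]: "F \<in> borel_measurable borel"
  by (rule borel_measurable_continuous_onI[OF continuous_F])

lemma gradF_meas[measurable]: "gradF \<in> borel_measurable borel"
  by (rule borel_measurable_continuous_onI[OF continuous_gradF])

lemma g1_meas[measurable]: "case_prod g1 \<in> borel_measurable (G1 \<Otimes>\<^sub>M P)"
  unfolding g1_def grad_est_def by measurable

lemma gF_meas[measurable]: "gF \<in> borel_measurable G1"
  unfolding gF_def grad_est_def by measurable

lemma v_meas[measurable]: "v \<in> borel_measurable G1"
  unfolding v_def by measurable

text \<open>The number of summands varies with the outcome but takes countably many values, so it
  can be fixed first.\<close>

lemma \<Gamma>_meas[measurable]: "case_prod \<Gamma> \<in> borel_measurable (G1 \<Otimes>\<^sub>M PiM UNIV (\<lambda>_. P))"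
proof -
  have "(\<lambda>p. (1 / real (n (fst p))) *\<^sub>R (\<Sum>i<n (fst p). g1 (fst p) (snd p i))) \<in> borel_measurable (G1 \<Otimes>\<^sub>M PiM UNIV (\<lambda>_. P))"
    by (rule measurable_compose_countable[where g="\<lambda>p. n (fst p)" and f="\<lambda>k p. (1 / real k) *\<^sub>R (\<Sum>i<k. g1 (fst p) (snd p i))"])
       measurable
  then show ?thesis by (simp add: \<Gamma>_def[abs_def] case_prod_beta')
qed

lemma gS_eq: "gS \<omega> = \<Gamma> \<omega> (\<lambda>i. z i \<omega>)"
proof -
  have "((\<Sum>i<n \<omega>. f (x \<omega> + \<nu> *\<^sub>R u j \<omega>) (z i \<omega>)) / real (n \<omega>) - (\<Sum>i<n \<omega>. f (x \<omega>) (z i \<omega>)) / real (n \<omega>)) / \<nu>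
      = (1 / real (n \<omega>)) * (\<Sum>i<n \<omega>. (f (x \<omega> + \<nu> *\<^sub>R u j \<omega>) (z i \<omega>) - f (x \<omega>) (z i \<omega>)) / \<nu>)" for j
    by (simp add: sum_subtractf diff_divide_distrib mult.commute[of \<nu>] flip: sum_divide_distrib)
  then have "gS \<omega> = c *\<^sub>R (\<Sum>j<N. ((1 / real (n \<omega>)) * (\<Sum>i<n \<omega>. (f (x \<omega> + \<nu> *\<^sub>R u j \<omega>) (z i \<omega>) - f (x \<omega>) (z i \<omega>)) / \<nu>)) *\<^sub>R u j \<omega>)"
    by (simp only: gS_def grad_est_def)
  also have "\<dots> = (1 / real (n \<omega>)) *\<^sub>R c *\<^sub>R (\<Sum>j<N. \<Sum>i<n \<omega>. ((f (x \<omega> + \<nu> *\<^sub>R u j \<omega>) (z i \<omega>) - f (x \<omega>) (z i \<omega>)) / \<nu>) *\<^sub>R u j \<omega>)"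
    by (simp add: scaleR_sum_right scaleR_sum_left sum_distrib_left mult_ac)
  also have "\<dots> = \<Gamma> \<omega> (\<lambda>i. z i \<omega>)"
    unfolding \<Gamma>_def g1_def grad_est_def by (subst sum.swap) (simp add: scaleR_sum_right)
  finally show ?thesis .
qed

lemma gS_meas[measurable]: "gS \<in> borel_measurable M"
proof -
  have [measurable]: "(\<lambda>\<omega>. \<omega>) \<in> measurable M G1"
    using sub1 by (auto simp: measurable_def subalgebra_def)
  have "(\<lambda>\<omega>. case_prod \<Gamma> (\<omega>, \<lambda>i. z i \<omega>)) \<in> borel_measurable M" by measurable
  then show ?thesis by (simp add: gS_eq[abs_def])
qed

text \<open>The variance assumption bounds a nonnegative integral, so it yields integrability along
  with the estimate; the triangle inequality removes the centring.\<close>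

lemma gradf_sq: "integrable P (\<lambda>\<zeta>. (norm (gradf y \<zeta>))\<^sup>2)"
  and gradf_sq_le: "(LINT \<zeta>|P. (norm (gradf y \<zeta>))\<^sup>2) \<le> 2 * (\<beta>1 + 1) * (norm (gradF y))\<^sup>2 + 2 * \<beta>2"
proof -
  have [measurable]: "gradf y \<in> borel_measurable P"
    by (rule borel_measurable_gradient[OF _ gradf]) (use f_integrable in auto)
  have i: "integrable P (\<lambda>\<zeta>. (norm (gradf y \<zeta> - gradF y))\<^sup>2)"
    using le_less_trans[OF gradf_variance ennreal_less_top] by (intro integrableI_bounded) auto
  have "ennreal (LINT \<zeta>|P. (norm (gradf y \<zeta> - gradF y))\<^sup>2) \<le> ennreal (\<beta>1 * (norm (gradF y))\<^sup>2 + \<beta>2)"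
    using gradf_variance[of y] by (subst (asm) nn_integral_eq_integral[OF i]) auto
  then have le: "(LINT \<zeta>|P. (norm (gradf y \<zeta> - gradF y))\<^sup>2) \<le> \<beta>1 * (norm (gradF y))\<^sup>2 + \<beta>2"
    by (subst (asm) ennreal_le_iff) (use \<beta> in auto)
  have b: "(norm (gradf y \<zeta>))\<^sup>2 \<le> 2 * (norm (gradf y \<zeta> - gradF y))\<^sup>2 + 2 * (norm (gradF y))\<^sup>2" for \<zeta>
    using sum_squares_bound[of "norm (gradf y \<zeta> - gradF y)" "norm (gradF y)"]
      power_mono[OF norm_triangle_ineq[of "gradf y \<zeta> - gradF y" "gradF y"], of 2] by (simp add: power2_sum)
  have ib: "integrable P (\<lambda>\<zeta>. 2 * (norm (gradf y \<zeta> - gradF y))\<^sup>2 + 2 * (norm (gradF y))\<^sup>2)" using i by simp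
  show s: "integrable P (\<lambda>\<zeta>. (norm (gradf y \<zeta>))\<^sup>2)"
    by (rule Bochner_Integration.integrable_bound[OF ib]) (use b in \<open>auto intro: order_trans[OF _ abs_ge_self]\<close>)
  have "(LINT \<zeta>|P. (norm (gradf y \<zeta>))\<^sup>2) \<le> (LINT \<zeta>|P. 2 * (norm (gradf y \<zeta> - gradF y))\<^sup>2 + 2 * (norm (gradF y))\<^sup>2)"
    by (rule integral_mono[OF s ib b])
  also have "\<dots> \<le> 2 * (\<beta>1 + 1) * (norm (gradF y))\<^sup>2 + 2 * \<beta>2"
    using i le P.prob_space by (simp add: algebra_simps)
  finally show "(LINT \<zeta>|P. (norm (gradf y \<zeta>))\<^sup>2) \<le> 2 * (\<beta>1 + 1) * (norm (gradF y))\<^sup>2 + 2 * \<beta>2" .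
qed

text \<open>The right-hand side of \<open>grad_est_norm_le\<close> with the squared gradient norm as
  a parameter \<open>A\<close>. It is affine in \<open>A\<close>, so integrating over the samples
  merely replaces \<open>A\<close> by its mean.\<close>

definition bound :: "real \<Rightarrow> real \<Rightarrow> 'w \<Rightarrow> real" where
  "bound K A \<omega> = c\<^sup>2 * real N * (\<Sum>j<N. 2 * A * norm (u j \<omega>) ^ 4 + K\<^sup>2 * \<nu>\<^sup>2 / 2 * norm (u j \<omega>) ^ 6)"

text \<open>Each sample function satisfies \<open>forward_difference\<close> with constant
  \<open>Lf\<close>, so the deterministic bound holds sample by sample; the mean is
  \<open>gF\<close> because the estimator is linear in the objective.\<close>

lemma g1_sample:
  assumes "\<omega> \<in> space M"
  shows g1_meas': "g1 \<omega> \<in> borel_measurable P"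
    and g1_sq: "integrable P (\<lambda>\<zeta>. (norm (g1 \<omega> \<zeta>))\<^sup>2)"
    and g1_sq_le: "(LINT \<zeta>|P. (norm (g1 \<omega> \<zeta>))\<^sup>2) \<le> bound Lf (2 * (\<beta>1 + 1) * (norm (gradF (x \<omega>)))\<^sup>2 + 2 * \<beta>2) \<omega>"
    and g1_int: "integrable P (g1 \<omega>)" and g1_mean: "(LINT \<zeta>|P. g1 \<omega> \<zeta>) = gF \<omega>"
proof -
  show m[measurable]: "g1 \<omega> \<in> borel_measurable P"
    using measurable_Pair2[OF g1_meas, of \<omega>] assms by (simp add: space_G)
  let ?b = "\<lambda>\<zeta>. bound Lf ((norm (gradf (x \<omega>) \<zeta>))\<^sup>2) \<omega>"
  have b: "(norm (g1 \<omega> \<zeta>))\<^sup>2 \<le> ?b \<zeta>" if "\<zeta> \<in> space P" for \<zeta>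
  proof -
    interpret f: forward_difference "\<lambda>y. f y \<zeta>" "\<lambda>y. gradf y \<zeta>" Lf \<nu>
      by unfold_locales (use that gradf gradf_lipschitz Lf_pos \<nu>_pos in auto)
    show ?thesis unfolding g1_def bound_def by (rule f.grad_est_norm_le)
  qed
  have ib: "integrable P ?b"
    unfolding bound_def by (intro integrable_mult_right Bochner_Integration.integrable_sum Bochner_Integration.integrable_add
      integrable_mult_left integrable_const) (use gradf_sq in auto)
  show s: "integrable P (\<lambda>\<zeta>. (norm (g1 \<omega> \<zeta>))\<^sup>2)"
    by (rule Bochner_Integration.integrable_bound[OF ib]) (use b in \<open>auto intro!: AE_I2 intro: order_trans[OF _ abs_ge_self]\<close>)
  have "(LINT \<zeta>|P. (norm (g1 \<omega> \<zeta>))\<^sup>2) \<le> (LINT \<zeta>|P. ?b \<zeta>)"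
    by (rule integral_mono[OF s ib b])
  also have "\<dots> = bound Lf (LINT \<zeta>|P. (norm (gradf (x \<omega>) \<zeta>))\<^sup>2) \<omega>"
    unfolding bound_def using gradf_sq P.prob_space by simp
  also have "\<dots> \<le> bound Lf (2 * (\<beta>1 + 1) * (norm (gradF (x \<omega>)))\<^sup>2 + 2 * \<beta>2) \<omega>"
    unfolding bound_def by (intro mult_left_mono mult_right_mono sum_mono add_right_mono gradf_sq_le) auto
  finally show "(LINT \<zeta>|P. (norm (g1 \<omega> \<zeta>))\<^sup>2) \<le> bound Lf (2 * (\<beta>1 + 1) * (norm (gradF (x \<omega>)))\<^sup>2 + 2 * \<beta>2) \<omega>" .
  show "integrable P (g1 \<omega>)" by (rule P.square_integrable_imp_integrable_norm[OF m s])
  show "(LINT \<zeta>|P. g1 \<omega> \<zeta>) = gF \<omega>"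
    unfolding g1_def gF_def grad_est_def using f_integrable by (simp add: F_def)
qed

text \<open>With \<open>\<omega>\<close> frozen the size is a constant and the centred terms are
  i.i.d.: mixed products vanish and the variance is divided by the size.\<close>

lemma \<Gamma>_sample:
  assumes \<omega>: "\<omega> \<in> space M"
  shows "integrable M (\<lambda>\<omega>'. (norm (\<Gamma> \<omega> (\<lambda>i. z i \<omega>') - gF \<omega>))\<^sup>2)"
    and "(LINT \<omega>'|M. (norm (\<Gamma> \<omega> (\<lambda>i. z i \<omega>') - gF \<omega>))\<^sup>2) = v \<omega> / real (n \<omega>)"
    and "integrable M (\<lambda>\<omega>'. \<Gamma> \<omega> (\<lambda>i. z i \<omega>'))"
    and "(LINT \<omega>'|M. \<Gamma> \<omega> (\<lambda>i. z i \<omega>')) = gF \<omega>"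
proof -
  note [measurable] = g1_meas'[OF \<omega>]
  let ?Y = "\<lambda>\<zeta>. g1 \<omega> \<zeta> - gF \<omega>"
  have n: "0 < n \<omega>" by (rule n_pos[OF \<omega>])
  have Y[measurable]: "?Y \<in> borel_measurable P" by measurable
  have Ysq: "integrable P (\<lambda>\<zeta>. (norm (?Y \<zeta>))\<^sup>2)"
  proof (rule Bochner_Integration.integrable_bound[of P "\<lambda>\<zeta>. 2 * (norm (g1 \<omega> \<zeta>))\<^sup>2 + 2 * (norm (gF \<omega>))\<^sup>2"])
    have "(norm (?Y \<zeta>))\<^sup>2 \<le> 2 * (norm (g1 \<omega> \<zeta>))\<^sup>2 + 2 * (norm (gF \<omega>))\<^sup>2" for \<zeta>
      using sum_squares_bound[of "norm (g1 \<omega> \<zeta>)" "norm (gF \<omega>)"]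
        power_mono[OF norm_triangle_ineq4[of "g1 \<omega> \<zeta>" "gF \<omega>"], of 2] by (simp add: power2_sum)
    then show "AE \<zeta> in P. norm ((norm (?Y \<zeta>))\<^sup>2) \<le> norm (2 * (norm (g1 \<omega> \<zeta>))\<^sup>2 + 2 * (norm (gF \<omega>))\<^sup>2)"
      by (intro AE_I2) (auto intro: order_trans[OF _ abs_ge_self])
  qed (use g1_sq[OF \<omega>] in auto)
  have ind: "indep_vars (\<lambda>_. borel) (\<lambda>i \<omega>'. ?Y (z i \<omega>')) {..<n \<omega>}"
    by (rule indep_vars_compose2[OF indep_vars_subset[OF z_iid(1)]]) auto
  have law: "distr M borel (\<lambda>\<omega>'. ?Y (z i \<omega>')) = distr P borel ?Y" for i
    using distr_distr[OF Y z_meas[of i]] by (simp add: z_iid(2) comp_def)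
  have sq: "integrable (distr P borel ?Y) (\<lambda>v. (norm v)\<^sup>2)"
    and S: "(LINT v|distr P borel ?Y. (norm v)\<^sup>2) = v \<omega>" and mean: "(LINT v|distr P borel ?Y. v) = 0"
    using Ysq g1_int[OF \<omega>] g1_mean[OF \<omega>] P.prob_space
    by (simp_all add: integrable_distr_eq integral_distr v_def)
  note iid = iid_sum_second_moment[OF ind law sq, unfolded S mean]
  have eq: "\<Gamma> \<omega> t - gF \<omega> = (1 / real (n \<omega>)) *\<^sub>R (\<Sum>i<n \<omega>. ?Y (t i))" for t
    using n by (simp add: \<Gamma>_def sum_subtractf scaleR_diff_right sum_constant_scaleR del: sum_constant)
  then have eq2: "(norm (\<Gamma> \<omega> t - gF \<omega>))\<^sup>2 = (1 / real (n \<omega>))\<^sup>2 * (norm (\<Sum>i<n \<omega>. ?Y (t i)))\<^sup>2" for t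
    by (simp add: power_mult_distrib power_divide)
  show "integrable M (\<lambda>\<omega>'. (norm (\<Gamma> \<omega> (\<lambda>i. z i \<omega>') - gF \<omega>))\<^sup>2)"
    unfolding eq2 by (intro integrable_mult_right iid(1))
  have "(LINT \<omega>'|M. (norm (\<Gamma> \<omega> (\<lambda>i. z i \<omega>') - gF \<omega>))\<^sup>2) = (1 / real (n \<omega>))\<^sup>2 * (real (n \<omega>) * v \<omega>)"
    unfolding eq2 integral_mult_right_zero by (simp add: iid(2))
  then show "(LINT \<omega>'|M. (norm (\<Gamma> \<omega> (\<lambda>i. z i \<omega>') - gF \<omega>))\<^sup>2) = v \<omega> / real (n \<omega>)"
    using n by (simp add: power_divide power2_eq_square)
  have eq3: "\<Gamma> \<omega> t = (1 / real (n \<omega>)) *\<^sub>R (\<Sum>i<n \<omega>. ?Y (t i)) + gF \<omega>" for t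
    using eq[of t] by (simp add: algebra_simps)
  have i: "integrable M (\<lambda>\<omega>'. (1 / real (n \<omega>)) *\<^sub>R (\<Sum>i<n \<omega>. ?Y (z i \<omega>')))"
    by (intro integrable_scaleR_right iid(4))
  show "integrable M (\<lambda>\<omega>'. \<Gamma> \<omega> (\<lambda>i. z i \<omega>'))"
    unfolding eq3 by (intro Bochner_Integration.integrable_add i) simp
  have "(LINT \<omega>'|M. \<Gamma> \<omega> (\<lambda>i. z i \<omega>')) = (1 / real (n \<omega>)) *\<^sub>R (LINT \<omega>'|M. (\<Sum>i<n \<omega>. ?Y (z i \<omega>'))) + gF \<omega>"
    unfolding eq3 using prob_space by (subst Bochner_Integration.integral_add[OF i]) (simp_all del: sum_subtractf)
  then show "(LINT \<omega>'|M. \<Gamma> \<omega> (\<lambda>i. z i \<omega>')) = gF \<omega>"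
    using iid(3) by simp
qed

lemma uf_meas: "(\<lambda>\<omega>. \<lambda>j\<in>{..<N}. u j \<omega>) \<in> measurable M (PiM {..<N} (\<lambda>_. borel))"
  by (rule measurable_restrict) (auto intro: meas_M)

text \<open>Independence of the past and the current directions factors the integral into the mean
  of \<open>A\<close> and a moment of the direction, so a first moment of \<open>A\<close>
  suffices.\<close>

lemma integrable_mult_fresh:
  assumes A[measurable]: "A \<in> borel_measurable G0" and A0: "\<And>\<omega>. 0 \<le> A \<omega>" and int: "integrable M A"
    and j: "j < N" and k: "k \<le> 6"
  shows "integrable M (\<lambda>\<omega>. A \<omega> * norm (u j \<omega>) ^ k)"
proof -
  have [measurable]: "A \<in> borel_measurable M" "u j \<in> borel_measurable M"
    using int meas_M[OF u_meas[OF j]] by auto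
  have ik: "integrable M (\<lambda>\<omega>. norm (u j \<omega>) ^ k)"
    by (rule integrable_norm_power_mono[OF finite_measure_axioms _ u_moment[OF j] k]) simp
  show ?thesis
  proof (rule integrableI_bounded)
    let ?h = "\<lambda>\<omega> t. ennreal (A \<omega>) * ennreal (norm (t j :: real ^ 'd) ^ k)"
    have [measurable]: "(\<lambda>p. snd p j) \<in> borel_measurable (G0 \<Otimes>\<^sub>M PiM {..<N} (\<lambda>_. borel))"
      using j by (intro measurable_compose[OF measurable_snd measurable_component_singleton]) simp
    have h: "case_prod ?h \<in> borel_measurable (G0 \<Otimes>\<^sub>M PiM {..<N} (\<lambda>_. borel))"
      by (simp add: case_prod_beta')
    have "(\<integral>\<^sup>+\<omega>. ennreal (norm (A \<omega> * norm (u j \<omega>) ^ k)) \<partial>M) = (\<integral>\<^sup>+\<omega>. ?h \<omega> (\<lambda>j\<in>{..<N}. u j \<omega>) \<partial>M)"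
      using A0 j by (intro nn_integral_cong) (simp add: ennreal_mult abs_mult)
    also have "\<dots> = (\<integral>\<^sup>+\<omega>. (\<integral>\<^sup>+\<omega>'. ?h \<omega> (\<lambda>j\<in>{..<N}. u j \<omega>') \<partial>M) \<partial>M)"
      by (rule nn_integral_independent[OF sub0 uf_meas u_fresh h])
    also have "\<dots> = (\<integral>\<^sup>+\<omega>. ennreal (A \<omega>) * (\<integral>\<^sup>+\<omega>'. ennreal (norm (u j \<omega>') ^ k) \<partial>M) \<partial>M)"
      using j by (intro nn_integral_cong) (simp add: nn_integral_cmult)
    also have "\<dots> = ennreal (LINT \<omega>|M. A \<omega>) * ennreal (LINT \<omega>|M. norm (u j \<omega>) ^ k)"
      using A0 int ik by (simp add: nn_integral_multc nn_integral_eq_integral)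
    also have "\<dots> < \<infinity>" by (simp add: ennreal_mult_less_top)
    finally show "(\<integral>\<^sup>+\<omega>. ennreal (norm (A \<omega> * norm (u j \<omega>) ^ k)) \<partial>M) < \<infinity>" .
  qed measurable
qed

lemma bound_integrable:
  assumes "A \<in> borel_measurable G0" "\<And>\<omega>. 0 \<le> A \<omega>" "integrable M A"
  shows "integrable M (\<lambda>\<omega>. bound K (A \<omega>) \<omega>)"
proof -
  have "integrable M (\<lambda>\<omega>. 2 * A \<omega> * norm (u j \<omega>) ^ 4 + K\<^sup>2 * \<nu>\<^sup>2 / 2 * norm (u j \<omega>) ^ 6)" if "j < N" for j
    using integrable_mult_right[OF integrable_mult_fresh[OF assms that, of 4], of 2] u_moment[OF that]
    by (intro Bochner_Integration.integrable_add integrable_mult_right) (simp_all add: mult.assoc)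
  then show ?thesis
    unfolding bound_def by (intro integrable_mult_right Bochner_Integration.integrable_sum) auto
qed

lemma gF_sq_int: "integrable M (\<lambda>\<omega>. (norm (gF \<omega>))\<^sup>2)"
proof (rule Bochner_Integration.integrable_bound)
  show "integrable M (\<lambda>\<omega>. bound L ((norm (gradF (x \<omega>)))\<^sup>2) \<omega>)"
    by (rule bound_integrable) (use grad_int in auto)
  show "AE \<omega> in M. norm ((norm (gF \<omega>))\<^sup>2) \<le> norm (bound L ((norm (gradF (x \<omega>)))\<^sup>2) \<omega>)"
    using grad_est_norm_le unfolding gF_def bound_def
    by (intro AE_I2) (auto intro: order_trans[OF _ abs_ge_self])
  show "(\<lambda>\<omega>. (norm (gF \<omega>))\<^sup>2) \<in> borel_measurable M" by (rule meas_M) measurable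
qed

lemma v_nonneg: "0 \<le> v \<omega>"
  unfolding v_def by (rule Bochner_Integration.integral_nonneg) simp

lemma v_int: "integrable M v"
proof (rule Bochner_Integration.integrable_bound)
  let ?A = "\<lambda>\<omega>. 2 * (\<beta>1 + 1) * (norm (gradF (x \<omega>)))\<^sup>2 + 2 * \<beta>2"
  show "integrable M (\<lambda>\<omega>. 2 * bound Lf (?A \<omega>) \<omega> + 2 * (norm (gF \<omega>))\<^sup>2)"
    by (intro Bochner_Integration.integrable_add integrable_mult_right gF_sq_int bound_integrable)
       (use grad_int \<beta> in auto)
  show "AE \<omega> in M. norm (v \<omega>) \<le> norm (2 * bound Lf (?A \<omega>) \<omega> + 2 * (norm (gF \<omega>))\<^sup>2)"
  proof (intro AE_I2)
    fix \<omega> assume \<omega>: "\<omega> \<in> space M"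
    have "v \<omega> \<le> (LINT \<zeta>|P. 2 * (norm (g1 \<omega> \<zeta>))\<^sup>2 + 2 * (norm (gF \<omega>))\<^sup>2)"
      unfolding v_def
    proof (rule integral_mono')
      show "integrable P (\<lambda>\<zeta>. 2 * (norm (g1 \<omega> \<zeta>))\<^sup>2 + 2 * (norm (gF \<omega>))\<^sup>2)"
        using g1_sq[OF \<omega>] by simp
      show "(norm (g1 \<omega> \<zeta> - gF \<omega>))\<^sup>2 \<le> 2 * (norm (g1 \<omega> \<zeta>))\<^sup>2 + 2 * (norm (gF \<omega>))\<^sup>2" for \<zeta>
        using sum_squares_bound[of "norm (g1 \<omega> \<zeta>)" "norm (gF \<omega>)"]
          power_mono[OF norm_triangle_ineq4[of "g1 \<omega> \<zeta>" "gF \<omega>"], of 2] by (simp add: power2_sum)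
    qed simp
    also have "\<dots> = 2 * (LINT \<zeta>|P. (norm (g1 \<omega> \<zeta>))\<^sup>2) + 2 * (norm (gF \<omega>))\<^sup>2"
      using g1_sq[OF \<omega>] P.prob_space by simp
    also have "\<dots> \<le> 2 * bound Lf (?A \<omega>) \<omega> + 2 * (norm (gF \<omega>))\<^sup>2"
      using g1_sq_le[OF \<omega>] by simp
    finally show "norm (v \<omega>) \<le> norm (2 * bound Lf (?A \<omega>) \<omega> + 2 * (norm (gF \<omega>))\<^sup>2)"
      using v_nonneg[of \<omega>] by simp
  qed
  show "v \<in> borel_measurable M" by (rule meas_M) measurable
qed

lemma vn_int: "integrable M (\<lambda>\<omega>. v \<omega> / real (n \<omega>))"
proof (rule Bochner_Integration.integrable_bound[OF v_int])
  show "AE \<omega> in M. norm (v \<omega> / real (n \<omega>)) \<le> norm (v \<omega>)"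
  proof (intro AE_I2)
    fix \<omega> assume "\<omega> \<in> space M"
    then have "v \<omega> / real (n \<omega>) \<le> v \<omega> / 1"
      using n_pos[of \<omega>] v_nonneg[of \<omega>] by (intro divide_left_mono) auto
    then show "norm (v \<omega> / real (n \<omega>)) \<le> norm (v \<omega>)" using v_nonneg[of \<omega>] by simp
  qed
  show "(\<lambda>\<omega>. v \<omega> / real (n \<omega>)) \<in> borel_measurable M" by (rule meas_M) measurable
qed

text \<open>The nonnegative integral is computed first, because square integrability of the error is
  itself one of the claims.\<close>

lemma gS_error:
  shows "integrable M (\<lambda>\<omega>. (norm (gS \<omega> - gF \<omega>))\<^sup>2)"
    and "(LINT \<omega>|M. (norm (gS \<omega> - gF \<omega>))\<^sup>2) = (LINT \<omega>|M. v \<omega> / real (n \<omega>))"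
proof -
  have [measurable]: "gF \<in> borel_measurable M" by (rule meas_M) measurable
  let ?h = "\<lambda>\<omega> t. ennreal ((norm (\<Gamma> \<omega> t - gF \<omega>))\<^sup>2)"
  have h: "case_prod ?h \<in> borel_measurable (G1 \<Otimes>\<^sub>M PiM UNIV (\<lambda>_. P))"
  proof -
    have "(\<lambda>p. ennreal ((norm (case_prod \<Gamma> p - gF (fst p)))\<^sup>2)) \<in> borel_measurable (G1 \<Otimes>\<^sub>M PiM UNIV (\<lambda>_. P))"
      by measurable
    then show ?thesis by (simp add: case_prod_beta')
  qed
  have "(\<integral>\<^sup>+\<omega>. ennreal ((norm (gS \<omega> - gF \<omega>))\<^sup>2) \<partial>M) = (\<integral>\<^sup>+\<omega>. ?h \<omega> (\<lambda>i. z i \<omega>) \<partial>M)"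
    by (simp add: gS_eq)
  also have "\<dots> = (\<integral>\<^sup>+\<omega>. (\<integral>\<^sup>+\<omega>'. ?h \<omega> (\<lambda>i. z i \<omega>') \<partial>M) \<partial>M)"
    by (rule nn_integral_independent[OF sub1 zf_meas z_fresh h])
  also have "\<dots> = (\<integral>\<^sup>+\<omega>. ennreal (v \<omega> / real (n \<omega>)) \<partial>M)"
    by (intro nn_integral_cong, subst nn_integral_eq_integral) (auto simp: \<Gamma>_sample)
  also have "\<dots> = ennreal (LINT \<omega>|M. v \<omega> / real (n \<omega>))"
    using v_nonneg by (intro nn_integral_eq_integral vn_int) auto
  finally have nn: "(\<integral>\<^sup>+\<omega>. ennreal ((norm (gS \<omega> - gF \<omega>))\<^sup>2) \<partial>M) = ennreal (LINT \<omega>|M. v \<omega> / real (n \<omega>))" .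
  show i: "integrable M (\<lambda>\<omega>. (norm (gS \<omega> - gF \<omega>))\<^sup>2)"
    by (rule integrableI_bounded) (simp_all add: nn)
  have "0 \<le> (LINT \<omega>|M. v \<omega> / real (n \<omega>))"
    using v_nonneg by (intro Bochner_Integration.integral_nonneg) simp
  then show "(LINT \<omega>|M. (norm (gS \<omega> - gF \<omega>))\<^sup>2) = (LINT \<omega>|M. v \<omega> / real (n \<omega>))"
    using nn nn_integral_eq_integral[OF i] by simp
qed

lemma gF_meas_M[measurable]: "gF \<in> borel_measurable M"
  by (rule meas_M) measurable

lemma gS_sq_int: "integrable M (\<lambda>\<omega>. (norm (gS \<omega>))\<^sup>2)"
proof (rule Bochner_Integration.integrable_bound)
  show "integrable M (\<lambda>\<omega>. 2 * (norm (gS \<omega> - gF \<omega>))\<^sup>2 + 2 * (norm (gF \<omega>))\<^sup>2)"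
    using gS_error(1) gF_sq_int by simp
  have "(norm (gS \<omega>))\<^sup>2 \<le> 2 * (norm (gS \<omega> - gF \<omega>))\<^sup>2 + 2 * (norm (gF \<omega>))\<^sup>2" for \<omega>
    using sum_squares_bound[of "norm (gS \<omega> - gF \<omega>)" "norm (gF \<omega>)"]
      power_mono[OF norm_triangle_ineq[of "gS \<omega> - gF \<omega>" "gF \<omega>"], of 2] by (simp add: power2_sum)
  then show "AE \<omega> in M. norm ((norm (gS \<omega>))\<^sup>2) \<le> norm (2 * (norm (gS \<omega> - gF \<omega>))\<^sup>2 + 2 * (norm (gF \<omega>))\<^sup>2)"
    by (intro AE_I2) (auto intro: order_trans[OF _ abs_ge_self])
qed measurable

text \<open>Unbiasedness in weak form: the samples are integrated out with \<open>y\<close> frozen.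
  It is used for the gradient at \<open>x\<close> and for \<open>gF\<close> itself.\<close>

lemma inner_gS:
  assumes [measurable]: "y \<in> borel_measurable G1" and sq: "integrable M (\<lambda>\<omega>. (norm (y \<omega>))\<^sup>2)"
  shows "integrable M (\<lambda>\<omega>. y \<omega> \<bullet> gS \<omega>)" and "(LINT \<omega>|M. y \<omega> \<bullet> gS \<omega>) = (LINT \<omega>|M. y \<omega> \<bullet> gF \<omega>)"
proof -
  show i: "integrable M (\<lambda>\<omega>. y \<omega> \<bullet> gS \<omega>)"
    by (rule square_integrable_inner[OF meas_M gS_meas sq gS_sq_int]) simp
  let ?h = "\<lambda>\<omega> t. y \<omega> \<bullet> \<Gamma> \<omega> t"
  have h: "case_prod ?h \<in> borel_measurable (G1 \<Otimes>\<^sub>M PiM UNIV (\<lambda>_. P))"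
  proof -
    have "(\<lambda>p. y (fst p) \<bullet> case_prod \<Gamma> p) \<in> borel_measurable (G1 \<Otimes>\<^sub>M PiM UNIV (\<lambda>_. P))"
      by measurable
    then show ?thesis by (simp add: case_prod_beta')
  qed
  have "(LINT \<omega>|M. y \<omega> \<bullet> gS \<omega>) = (LINT \<omega>|M. LINT \<omega>'|M. ?h \<omega> (\<lambda>i. z i \<omega>'))"
    using integral_independent[OF sub1 zf_meas z_fresh h] i by (simp add: gS_eq)
  also have "\<dots> = (LINT \<omega>|M. y \<omega> \<bullet> gF \<omega>)"
    by (intro Bochner_Integration.integral_cong refl) (simp add: \<Gamma>_sample)
  finally show "(LINT \<omega>|M. y \<omega> \<bullet> gS \<omega>) = (LINT \<omega>|M. y \<omega> \<bullet> gF \<omega>)" .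
qed

text \<open>Pythagoras: by \<open>inner_gS\<close> the cross term equals the second moment of
  \<open>gF\<close>.\<close>

lemma gS_second_moment:
  "(LINT \<omega>|M. (norm (gS \<omega>))\<^sup>2) = (LINT \<omega>|M. v \<omega> / real (n \<omega>)) + (LINT \<omega>|M. (norm (gF \<omega>))\<^sup>2)"
proof -
  have ii: "integrable M (\<lambda>\<omega>. gF \<omega> \<bullet> gS \<omega>)" "(LINT \<omega>|M. gF \<omega> \<bullet> gS \<omega>) = (LINT \<omega>|M. (norm (gF \<omega>))\<^sup>2)"
    using inner_gS[OF gF_meas gF_sq_int] by (simp_all add: power2_norm_eq_inner)
  have "(LINT \<omega>|M. v \<omega> / real (n \<omega>)) = (LINT \<omega>|M. (norm (gS \<omega>))\<^sup>2 - 2 * (gF \<omega> \<bullet> gS \<omega>) + (norm (gF \<omega>))\<^sup>2)"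
    unfolding gS_error(2)[symmetric]
    by (intro Bochner_Integration.integral_cong refl)
       (simp add: power2_norm_eq_inner inner_diff_left inner_diff_right inner_commute)
  then show ?thesis using ii gS_sq_int gF_sq_int by simp
qed

text \<open>Links the abstract conditional expectation, in which the size conditions are phrased, to
  the explicit function with which the estimates work.\<close>

lemma vec_cond_exp_gS: "AE \<omega> in M. vec_cond_exp M G1 gS \<omega> = gF \<omega>"
proof -
  have "AE \<omega> in M. \<forall>i. real_cond_exp M G1 (\<lambda>\<omega>'. gS \<omega>' $ i) \<omega> = gF \<omega> $ i"
  proof (rule AE_all_countable[THEN iffD2], intro allI)
    fix i
    have int: "integrable M gS"
      by (rule square_integrable_imp_integrable_norm[OF gS_meas gS_sq_int])
    have vi: "\<phi> \<bullet> axis i 1 = \<phi> $ i" for \<phi> :: "real ^ 'd" by (simp add: inner_axis)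
    let ?h = "\<lambda>\<omega> t. \<Gamma> \<omega> t \<bullet> axis i 1"
    have h: "case_prod ?h \<in> borel_measurable (G1 \<Otimes>\<^sub>M PiM UNIV (\<lambda>_. P))"
    proof -
      have "(\<lambda>p. case_prod \<Gamma> p \<bullet> axis i 1) \<in> borel_measurable (G1 \<Otimes>\<^sub>M PiM UNIV (\<lambda>_. P))"
        by measurable
      then show ?thesis by (simp add: case_prod_beta')
    qed
    have "AE \<omega> in M. real_cond_exp M G1 (\<lambda>\<omega>. ?h \<omega> (\<lambda>i. z i \<omega>)) \<omega> = (LINT \<omega>'|M. ?h \<omega> (\<lambda>i. z i \<omega>'))"
      by (rule real_cond_exp_independent[OF sub1 zf_meas z_fresh h]) (use int in \<open>simp add: gS_eq[symmetric]\<close>)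
    then show "AE \<omega> in M. real_cond_exp M G1 (\<lambda>\<omega>'. gS \<omega>' $ i) \<omega> = gF \<omega> $ i"
      using AE_space
    proof eventually_elim
      case (elim \<omega>)
      then have "(LINT \<omega>'|M. ?h \<omega> (\<lambda>i. z i \<omega>')) = gF \<omega> \<bullet> axis i 1"
        using \<Gamma>_sample(3,4)[OF elim(2)] by simp
      then show ?case using elim(1) by (simp add: vi gS_eq[symmetric])
    qed
  qed
  then show ?thesis
    by eventually_elim (simp add: vec_cond_exp_def vec_eq_iff)
qed

end

text \<open>A descent of \<open>\<alpha>\<close> times a quarter of the squared gradient is worth
  \<open>\<alpha> * \<mu> / 2\<close> times the gap.\<close>

lemma rate_eq: "rate m N d \<theta> L \<mu> = step_size m N d \<theta> L * \<mu> / 2"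
  by (cases m) (simp_all add: Omega1_def Omega3_def)

lemma step_size_nonneg: "0 \<le> L \<Longrightarrow> 0 \<le> step_size m N d \<theta> L"
  by (cases m) (simp_all add: Omega1_def add_nonneg_nonneg)

lemma directions_card_le:
  assumes "directions m M N (u :: nat \<Rightarrow> 'w \<Rightarrow> real ^ 'd)" "m = RC \<or> m = RS"
  shows "N \<le> CARD('d)"
  using assms by auto

text \<open>Keeps \<open>1 - \<rho>\<close> nonnegative, so that the one-step inequality can be
  iterated; for RC and RS this rests on \<open>N / d\<close> being at most 1.\<close>

lemma rate_le_1:
  assumes "0 < L" "0 < \<mu>" "\<mu> \<le> L" and N: "m = RC \<or> m = RS \<Longrightarrow> N \<le> d"
  shows "rate m N d \<theta> L \<mu> \<le> 1"
proof -
  have p: "0 < 1 + \<theta>\<^sup>2" by (simp add: add_pos_nonneg)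
  have "\<mu> \<le> 1 * L" using assms by simp
  also have "\<dots> \<le> 8 * (1 + \<theta>\<^sup>2) * L" using assms by (intro mult_right_mono) auto
  finally have O: "Omega3 \<theta> L \<mu> \<le> 1" using p assms by (simp add: Omega3_def divide_le_eq)
  have O0: "0 \<le> Omega3 \<theta> L \<mu>" using p assms by (simp add: Omega3_def)
  have q: "q * Omega3 \<theta> L \<mu> \<le> 1" if "q \<le> 1" for q
    using mult_mono[OF that O _ O0] by simp
  have "real N / (real N + 4.5 * real d) \<le> 1"
    by (cases "real N + 4.5 * real d = 0") (auto simp: divide_le_eq_1)
  moreover have "real N / real d \<le> 1" if "m = RC \<or> m = RS" using N[OF that] by (cases "d = 0") (simp_all add: divide_le_eq_1)
  ultimately show ?thesis
    using O q by (cases m) (simp_all only: rate.simps simp_thms)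
qed

section \<open>Expected decrease in one iteration\<close>

context stochastic_step
begin

interpretation P: prob_space P by (rule P)

definition gT :: "'w \<Rightarrow> real ^ 'd" where
  "gT = vec_cond_exp M G1 gS"
definition V :: "'w \<Rightarrow> real" where
  "V \<omega> = (LINT \<zeta>|P. (norm (g1 \<omega> \<zeta> - gT \<omega>))\<^sup>2)"

lemma gT_meas[measurable]: "gT \<in> borel_measurable G1"
  by (subst borel_measurable_euclidean_space) (auto simp: gT_def vec_cond_exp_def Basis_vec_def inner_axis)

lemma AE_gT: "AE \<omega> in M. gT \<omega> = gF \<omega>"
  unfolding gT_def by (rule vec_cond_exp_gS)

text \<open>\<open>V\<close> and \<open>gT\<close> agree almost everywhere with \<open>v\<close> and
  \<open>gF\<close>, so the integrated size condition carries over to the explicit versions.\<close>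

lemma sampling_error_bound:
  assumes "(AE \<omega> in M. V \<omega> / real (n \<omega>) \<le> \<theta>\<^sup>2 * (norm (gT \<omega>))\<^sup>2)
       \<or> (AE \<omega> in M. V \<omega> / real (n \<omega>) \<le> \<theta>\<^sup>2 * real_cond_exp M G0 (\<lambda>\<omega>'. (norm (gT \<omega>'))\<^sup>2) \<omega>)
       \<or> (AE \<omega> in M. real_cond_exp M G0 V \<omega> / real (n \<omega>)
              \<le> \<theta>\<^sup>2 * real_cond_exp M G0 (\<lambda>\<omega>'. (norm (gT \<omega>'))\<^sup>2) \<omega>)"
  shows "(LINT \<omega>|M. v \<omega> / real (n \<omega>)) \<le> \<theta>\<^sup>2 * (LINT \<omega>|M. (norm (gF \<omega>))\<^sup>2)"
proof -
  have "V \<in> borel_measurable G1" unfolding V_def by measurable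
  then have [measurable]: "V \<in> borel_measurable M" "gT \<in> borel_measurable M" "v \<in> borel_measurable M"
      "n \<in> measurable M (count_space UNIV)"
    using v_int n_meas gT_meas by (auto intro: meas_M)
  have aV: "AE \<omega> in M. V \<omega> = v \<omega>" using AE_gT by eventually_elim (simp add: V_def v_def)
  have aB: "AE \<omega> in M. (norm (gT \<omega>))\<^sup>2 = (norm (gF \<omega>))\<^sup>2" using AE_gT by eventually_elim simp
  have iV: "integrable M V"
    using v_int by (rule integrable_cong_AE_imp) (use aV in auto)
  have iB: "integrable M (\<lambda>\<omega>. (norm (gT \<omega>))\<^sup>2)"
    using gF_sq_int by (rule integrable_cong_AE_imp) (use aB in auto)
  have V0: "0 \<le> V \<omega>" for \<omega> unfolding V_def by (rule Bochner_Integration.integral_nonneg) simp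
  have "(LINT \<omega>|M. v \<omega> / real (n \<omega>)) = (LINT \<omega>|M. V \<omega> / real (n \<omega>))"
    by (rule integral_cong_AE) (use aV in auto)
  also have "\<dots> \<le> \<theta>\<^sup>2 * (LINT \<omega>|M. (norm (gT \<omega>))\<^sup>2)"
    using assms by (intro sample_size_bound(2)[OF sub0 iV V0 iB _ _ n_pos]) auto
  also have "(LINT \<omega>|M. (norm (gT \<omega>))\<^sup>2) = (LINT \<omega>|M. (norm (gF \<omega>))\<^sup>2)"
    by (rule integral_cong_AE) (use aB in auto)
  finally show ?thesis .
qed

lemma expected_descent:
  fixes m :: estimator and \<theta> \<mu> :: real and xs :: "real ^ 'd"
  defines "\<alpha> \<equiv> step_size m N CARD('d) \<theta> L"
    and "\<rho> \<equiv> rate m N CARD('d) \<theta> L \<mu>" and "\<eta> \<equiv> neighborhood m N CARD('d) L \<mu> \<nu>"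
  assumes N: "0 < N" and \<mu>: "0 < \<mu>" and dir: "directions m M N u" and c: "c = scaling m N CARD('d)"
    and minimizer: "\<And>y. F xs \<le> F y" and PL: "\<And>y. 2 * \<mu> * (F y - F xs) \<le> (norm (gradF y))\<^sup>2"
    and F_int: "integrable M (\<lambda>\<omega>. F (x \<omega>) - F xs)"
    and error: "(LINT \<omega>|M. v \<omega> / real (n \<omega>)) \<le> \<theta>\<^sup>2 * (LINT \<omega>|M. (norm (gF \<omega>))\<^sup>2)"
  shows "integrable M (\<lambda>\<omega>. F (x \<omega> - \<alpha> *\<^sub>R gS \<omega>) - F xs)"
    and "(LINT \<omega>|M. F (x \<omega> - \<alpha> *\<^sub>R gS \<omega>) - F xs) \<le> (1 - \<rho>) * (LINT \<omega>|M. F (x \<omega>) - F xs) + \<rho> * \<eta>"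
proof -
  have x_M[measurable]: "x \<in> borel_measurable M" by (rule meas_M) measurable
  have u_M: "u j \<in> borel_measurable M" if "j < N" for j by (rule meas_M[OF u_meas[OF that]])
  have \<alpha>: "0 \<le> \<alpha>" unfolding \<alpha>_def using L_pos by (intro step_size_nonneg) simp
  \<comment> \<open>The weight of the squared norm of \<open>gF\<close> once the sampling error has
    inflated the second moment by \<open>1 + \<theta>\<^sup>2\<close> and one factor
    \<open>\<alpha>\<close> has been taken out.\<close>
  define k where "k = \<alpha> * L * (1 + \<theta>\<^sup>2) / 2"
  let ?R = "\<lambda>\<omega>. (F (x \<omega>) - F xs) - \<alpha> * (gradF (x \<omega>) \<bullet> gS \<omega>) + L / 2 * \<alpha>\<^sup>2 * (norm (gS \<omega>))\<^sup>2"
  have le: "F (x \<omega> - \<alpha> *\<^sub>R gS \<omega>) - F xs \<le> ?R \<omega>" for \<omega>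
    using abs_le_D1[OF lipschitz_gradient_bound[OF gradF lipschitz, of "x \<omega>" "- \<alpha> *\<^sub>R gS \<omega>"]]
    by (simp add: power_mult_distrib mult.assoc)
  have gx: "(\<lambda>\<omega>. gradF (x \<omega>)) \<in> borel_measurable G1" by measurable
  note ig = inner_gS[OF gx grad_int]
  have iR: "integrable M ?R"
    by (intro Bochner_Integration.integrable_add Bochner_Integration.integrable_diff integrable_mult_right F_int ig(1) gS_sq_int)
  \<comment> \<open>The gap is nonnegative because \<open>xs\<close> is a minimizer, so the upper
    bound \<open>?R\<close> also dominates its absolute value.\<close>
  show i: "integrable M (\<lambda>\<omega>. F (x \<omega> - \<alpha> *\<^sub>R gS \<omega>) - F xs)"
  proof (rule Bochner_Integration.integrable_bound[OF iR])
    show "AE \<omega> in M. norm (F (x \<omega> - \<alpha> *\<^sub>R gS \<omega>) - F xs) \<le> norm (?R \<omega>)"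
    proof (intro AE_I2)
      show "norm (F (x \<omega> - \<alpha> *\<^sub>R gS \<omega>) - F xs) \<le> norm (?R \<omega>)" for \<omega>
        using order_trans[OF le[of \<omega>] abs_ge_self] minimizer[of "x \<omega> - \<alpha> *\<^sub>R gS \<omega>"] by simp
    qed
  qed measurable
  let ?\<Psi> = "\<lambda>\<omega>. gradF (x \<omega>) \<bullet> gF \<omega> - k * (norm (gF \<omega>))\<^sup>2"
  have igF: "integrable M (\<lambda>\<omega>. gradF (x \<omega>) \<bullet> gF \<omega>)"
    by (rule square_integrable_inner[OF _ gF_meas_M grad_int gF_sq_int]) measurable
  have i\<Psi>: "integrable M ?\<Psi>" using igF gF_sq_int by simp
  let ?h = "\<lambda>\<omega> t. gradF (x \<omega>) \<bullet> grad_est c \<nu> N t F (x \<omega>) - k * (norm (grad_est c \<nu> N t F (x \<omega>)))\<^sup>2"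
  have [measurable]: "(\<lambda>p. snd p j) \<in> borel_measurable (G0 \<Otimes>\<^sub>M PiM {..<N} (\<lambda>_. borel :: (real ^ 'd) measure))" if "j < N" for j
    using that by (intro measurable_compose[OF measurable_snd measurable_component_singleton]) simp
  have h: "case_prod ?h \<in> borel_measurable (G0 \<Otimes>\<^sub>M PiM {..<N} (\<lambda>_. borel))"
    unfolding case_prod_beta' grad_est_def by measurable
  have cong: "grad_est c \<nu> N (\<lambda>j\<in>{..<N}. u j \<omega>') F y = grad_est c \<nu> N (\<lambda>j. u j \<omega>') F y" for \<omega>' y
    by (rule grad_est_cong) simp
  \<comment> \<open>The directions are integrated out with \<open>x\<close> frozen, so that
    \<open>directions_bound\<close>, a statement about a fixed point, applies inside the
    integral.\<close>
  have "(LINT \<omega>|M. ?\<Psi> \<omega>) = (LINT \<omega>|M. LINT \<omega>'|M. ?h \<omega> (\<lambda>j\<in>{..<N}. u j \<omega>'))"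
    using integral_independent[OF sub0 uf_meas u_fresh h] i\<Psi> by (simp add: cong gF_def)
  moreover have "(LINT \<omega>|M. (norm (gradF (x \<omega>)))\<^sup>2 / 4 - \<mu> * \<eta> / 2) \<le> \<dots>"
  proof (rule integral_mono)
    show "integrable M (\<lambda>\<omega>. (norm (gradF (x \<omega>)))\<^sup>2 / 4 - \<mu> * \<eta> / 2)" using grad_int by simp
    show "integrable M (\<lambda>\<omega>. LINT \<omega>'|M. ?h \<omega> (\<lambda>j\<in>{..<N}. u j \<omega>'))"
      using integrable_integral_independent[OF sub0 uf_meas u_fresh h] i\<Psi> by (simp add: cong gF_def)
    show "(norm (gradF (x \<omega>)))\<^sup>2 / 4 - \<mu> * \<eta> / 2 \<le> (LINT \<omega>'|M. ?h \<omega> (\<lambda>j\<in>{..<N}. u j \<omega>'))" for \<omega>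
      unfolding cong using directions_bound(1)[OF prob_space_axioms N \<mu> dir u_M, of "x \<omega>" \<theta>]
      by (simp only: c k_def \<alpha>_def \<eta>_def)
  qed
  \<comment> \<open>Strong convexity turns a quarter of the squared gradient into
    \<open>\<mu> / 2\<close> times the gap.\<close>
  moreover have "(LINT \<omega>|M. (norm (gradF (x \<omega>)))\<^sup>2 / 4 - \<mu> * \<eta> / 2)
      \<ge> (LINT \<omega>|M. \<mu> / 2 * (F (x \<omega>) - F xs) - \<mu> * \<eta> / 2)"
  proof (rule integral_mono)
    show "integrable M (\<lambda>\<omega>. \<mu> / 2 * (F (x \<omega>) - F xs) - \<mu> * \<eta> / 2)" using F_int by simp
    show "integrable M (\<lambda>\<omega>. (norm (gradF (x \<omega>)))\<^sup>2 / 4 - \<mu> * \<eta> / 2)" using grad_int by simp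
    show "\<mu> / 2 * (F (x \<omega>) - F xs) - \<mu> * \<eta> / 2 \<le> (norm (gradF (x \<omega>)))\<^sup>2 / 4 - \<mu> * \<eta> / 2" for \<omega>
      using PL[of "x \<omega>"] by simp
  qed
  ultimately have \<Psi>: "\<mu> / 2 * (LINT \<omega>|M. F (x \<omega>) - F xs) - \<mu> * \<eta> / 2 \<le> (LINT \<omega>|M. ?\<Psi> \<omega>)"
    using F_int prob_space by simp
  have sm: "(LINT \<omega>|M. (norm (gS \<omega>))\<^sup>2) \<le> (1 + \<theta>\<^sup>2) * (LINT \<omega>|M. (norm (gF \<omega>))\<^sup>2)"
    using error by (simp add: gS_second_moment distrib_right)
  have lin: "(LINT \<omega>|M. A \<omega> - a * B \<omega> + b * C \<omega>) = (LINT \<omega>|M. A \<omega>) - a * (LINT \<omega>|M. B \<omega>) + b * (LINT \<omega>|M. C \<omega>)"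
    if "integrable M A" "integrable M B" "integrable M C" for A B C :: "'w \<Rightarrow> real" and a b
    using that by simp
  have "(LINT \<omega>|M. F (x \<omega> - \<alpha> *\<^sub>R gS \<omega>) - F xs) \<le> (LINT \<omega>|M. ?R \<omega>)"
    by (rule integral_mono[OF i iR le])
  also have "\<dots> = (LINT \<omega>|M. F (x \<omega>) - F xs) - \<alpha> * (LINT \<omega>|M. gradF (x \<omega>) \<bullet> gF \<omega>) + L / 2 * \<alpha>\<^sup>2 * (LINT \<omega>|M. (norm (gS \<omega>))\<^sup>2)"
    by (simp only: lin[OF F_int ig(1) gS_sq_int] ig(2))
  also have "\<dots> \<le> (LINT \<omega>|M. F (x \<omega>) - F xs) - \<alpha> * (LINT \<omega>|M. gradF (x \<omega>) \<bullet> gF \<omega>)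
      + L / 2 * \<alpha>\<^sup>2 * ((1 + \<theta>\<^sup>2) * (LINT \<omega>|M. (norm (gF \<omega>))\<^sup>2))"
    using L_pos by (intro add_left_mono mult_left_mono[OF sm]) auto
  also have "\<dots> = (LINT \<omega>|M. F (x \<omega>) - F xs) - \<alpha> * (LINT \<omega>|M. ?\<Psi> \<omega>)"
    using igF gF_sq_int by (simp add: k_def power2_eq_square algebra_simps)
  also have "\<dots> \<le> (LINT \<omega>|M. F (x \<omega>) - F xs) - \<alpha> * (\<mu> / 2 * (LINT \<omega>|M. F (x \<omega>) - F xs) - \<mu> * \<eta> / 2)"
    using mult_left_mono[OF \<Psi> \<alpha>] by simp
  also have "\<dots> = (1 - \<rho>) * (LINT \<omega>|M. F (x \<omega>) - F xs) + \<rho> * \<eta>"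
    by (simp add: \<rho>_def \<alpha>_def rate_eq algebra_simps)
  finally show "(LINT \<omega>|M. F (x \<omega> - \<alpha> *\<^sub>R gS \<omega>) - F xs) \<le> (1 - \<rho>) * (LINT \<omega>|M. F (x \<omega>) - F xs) + \<rho> * \<eta>" .
qed

end

section \<open>The iteration\<close>

lemma space_history: "space (history M P N U Z n a b) = space M"
  by (simp add: history_def space_measure_of_conv)

lemma sets_history:
  "sets (history M P N U Z n a b) = sigma_sets (space M)
     ({U l j -` A \<inter> space M | l j A. l < a \<and> j < N \<and> A \<in> sets borel} \<union>
      {{\<omega> \<in> space M. i < n l \<omega> \<and> Z l i \<omega> \<in> A} | l i A. l < b \<and> A \<in> sets P})"
  unfolding history_def by (rule sets_measure_of) auto

lemma sets_history_mono:
  "a \<le> a' \<Longrightarrow> b \<le> b' \<Longrightarrow> sets (history M P N U Z n a b) \<subseteq> sets (history M P N U Z n a' b')"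
  unfolding sets_history by (rule sigma_sets_mono') (auto, (blast intro: less_le_trans)+)

lemma measurable_history_mono:
  "\<phi> \<in> measurable (history M P N U Z n a b) S \<Longrightarrow> a \<le> a' \<Longrightarrow> b \<le> b' \<Longrightarrow> \<phi> \<in> measurable (history M P N U Z n a' b') S"
  using sets_history_mono[of a a' b b' M P N U Z n]
  by (auto simp: measurable_def space_history)

lemma history_direction: "l < a \<Longrightarrow> j < N \<Longrightarrow> U l j \<in> borel_measurable (history M P N U Z n a b)"
  by (rule measurableI) (auto simp: space_history sets_history intro!: sigma_sets.Basic)

text \<open>
  The history records only the members of a sample set, so \<open>Z l i\<close> has to be truncated where
  \<open>i \<ge> n l\<close>.
\<close>

lemma history_sample:
  assumes "l < b" and z0: "z0 \<in> space P" and Z: "\<And>\<omega>. \<omega> \<in> space M \<Longrightarrow> Z l i \<omega> \<in> space P"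
  shows "(\<lambda>\<omega>. if i < n l \<omega> then Z l i \<omega> else z0) \<in> measurable (history M P N U Z n a b) P"
proof (rule measurableI)
  let ?H = "history M P N U Z n a b"
  have ev: "{\<omega> \<in> space M. i < n l \<omega> \<and> Z l i \<omega> \<in> A} \<in> sets ?H" if "A \<in> sets P" for A
    unfolding sets_history using assms(1) that by (intro sigma_sets.Basic) blast
  fix A assume A: "A \<in> sets P"
  have "{\<omega> \<in> space M. i < n l \<omega> \<and> Z l i \<omega> \<in> A} \<union>
      (if z0 \<in> A then space ?H - {\<omega> \<in> space M. i < n l \<omega> \<and> Z l i \<omega> \<in> space P} else {}) \<in> sets ?H"
    using ev[OF A] ev[of "space P"] by auto
  also have "{\<omega> \<in> space M. i < n l \<omega> \<and> Z l i \<omega> \<in> A} \<union>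
      (if z0 \<in> A then space ?H - {\<omega> \<in> space M. i < n l \<omega> \<and> Z l i \<omega> \<in> space P} else {})
    = (\<lambda>\<omega>. if i < n l \<omega> then Z l i \<omega> else z0) -` A \<inter> space ?H"
    using Z by (auto simp: space_history split: if_splits)
  finally show "(\<lambda>\<omega>. if i < n l \<omega> then Z l i \<omega> else z0) -` A \<inter> space ?H \<in> sets ?H" .
qed (use z0 Z in \<open>auto simp: space_history\<close>)

lemma borel_measurable_grad_est_sample_mean:
  fixes x :: "'w \<Rightarrow> real ^ 'd::finite" and f :: "real ^ 'd \<Rightarrow> 'z \<Rightarrow> real"
  assumes f[measurable]: "(\<lambda>(y, z). f y z) \<in> borel_measurable (borel \<Otimes>\<^sub>M P)"
    and [measurable]: "x \<in> borel_measurable H" "\<And>j. j < N \<Longrightarrow> u j \<in> borel_measurable H"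
      "\<And>i. z i \<in> measurable H P" "n \<in> measurable H (count_space UNIV)"
  shows "(\<lambda>\<omega>. grad_est c \<nu> N (\<lambda>j. u j \<omega>) (\<lambda>y. (\<Sum>i<n \<omega>. f y (z i \<omega>)) / real (n \<omega>)) (x \<omega>)) \<in> borel_measurable H"
  by (rule measurable_compose_countable[where g=n
        and f="\<lambda>k \<omega>. grad_est c \<nu> N (\<lambda>j. u j \<omega>) (\<lambda>y. (\<Sum>i<k. f y (z i \<omega>)) / real k) (x \<omega>)"])
     (unfold grad_est_def, measurable)

text \<open>Integrability is asserted together with the inequality: the integral of a non-integrable
  function has the default value 0, and the next iteration needs the integrability of the current
  gap.\<close>

theorem theorem3p5:
  fixes M :: "'w measure" and P :: "'z measure"
    and f :: "real ^ 'd::finite \<Rightarrow> 'z \<Rightarrow> real" and gradf :: "real ^ 'd \<Rightarrow> 'z \<Rightarrow> real ^ 'd"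
    and F :: "real ^ 'd \<Rightarrow> real" and gradF :: "real ^ 'd \<Rightarrow> real ^ 'd"
    and m :: estimator and N :: nat
    and U :: "nat \<Rightarrow> nat \<Rightarrow> 'w \<Rightarrow> real ^ 'd" and Z :: "nat \<Rightarrow> nat \<Rightarrow> 'w \<Rightarrow> 'z"
    and n :: "nat \<Rightarrow> 'w \<Rightarrow> nat" and x :: "nat \<Rightarrow> 'w \<Rightarrow> real ^ 'd"
    and gS gT :: "nat \<Rightarrow> 'w \<Rightarrow> real ^ 'd" and V :: "nat \<Rightarrow> 'w \<Rightarrow> real"
    and \<H> :: "nat \<Rightarrow> nat \<Rightarrow> 'w measure"
    and x0 xstar :: "real ^ 'd" and \<theta> \<nu> \<mu> Lf LF \<beta>1 \<beta>2 \<alpha> \<rho> \<eta> :: real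
  defines "\<H> \<equiv> history M P N U Z n"
    and "gS \<equiv> \<lambda>k \<omega>. grad_est (scaling m N CARD('d)) \<nu> N (\<lambda>j. U k j \<omega>)
                 (\<lambda>y. (\<Sum>i<n k \<omega>. f y (Z k i \<omega>)) / real (n k \<omega>)) (x k \<omega>)"
    and "gT \<equiv> \<lambda>k. vec_cond_exp M (\<H> (Suc k) k) (gS k)"
    and "V \<equiv> \<lambda>k \<omega>. (LINT z|P. (norm (grad_est (scaling m N CARD('d)) \<nu> N (\<lambda>j. U k j \<omega>)
                 (\<lambda>y. f y z) (x k \<omega>) - gT k \<omega>))\<^sup>2)"
    and "\<alpha> \<equiv> step_size m N CARD('d) \<theta> LF"
    and "\<rho> \<equiv> rate m N CARD('d) \<theta> LF \<mu>"
    and "\<eta> \<equiv> neighborhood m N CARD('d) LF \<mu> \<nu>"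
  assumes "prob_space M" and "prob_space P"
    and "0 < \<theta>" and "0 < \<nu>" and "0 < \<mu>" and "0 < N"
    \<comment> \<open>the objective and its minimizer\<close>
    and f_integrable: "\<And>y. integrable P (f y)"
    and F_def: "\<And>y. F y = (LINT z|P. f y z)"
    and gradF: "\<And>y. GDERIV F y :> gradF y" "continuous_on UNIV gradF"
    and minimizer: "\<And>y. F xstar \<le> F y"
    \<comment> \<open>(A4)\<close>
    and gradf: "\<And>y z. z \<in> space P \<Longrightarrow> GDERIV (\<lambda>y. f y z) y :> gradf y z"
               "\<And>z. z \<in> space P \<Longrightarrow> continuous_on UNIV (\<lambda>y. gradf y z)"
    and gradf_lipschitz: "\<And>y y' z. z \<in> space P \<Longrightarrow> norm (gradf y z - gradf y' z) \<le> Lf * norm (y - y')"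
    and gradF_lipschitz: "\<And>y y'. norm (gradF y - gradF y') \<le> LF * norm (y - y')"
    and "0 < LF" and "LF \<le> Lf"
    \<comment> \<open>(A5); stated with the nonnegative integral, so that it includes finiteness of the variance\<close>
    and "0 \<le> \<beta>1" and "0 \<le> \<beta>2"
    and gradf_variance: "\<And>y. (\<integral>\<^sup>+ z. ennreal ((norm (gradf y z - gradF y))\<^sup>2) \<partial>P)
                              \<le> ennreal (\<beta>1 * (norm (gradF y))\<^sup>2 + \<beta>2)"
    \<comment> \<open>strong convexity\<close>
    and strongly_convex: "\<And>y. (norm (gradF y))\<^sup>2 \<ge> 2 * \<mu> * (F y - F xstar)" and "\<mu> \<le> LF"
    \<comment> \<open>directions: law prescribed by the method, independent of the past\<close>
    and directions: "\<And>k. directions m M N (U k)"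
    and directions_fresh: "\<And>k. prob_space.indep_set M (sets (\<H> k k))
           (sets (vimage_algebra (space M) (\<lambda>\<omega>. \<lambda>j\<in>{..<N}. U k j \<omega>) (PiM {..<N} (\<lambda>_. borel))))"
    \<comment> \<open>(A1), (A2): i.i.d. samples, independent of the past and of the current directions\<close>
    and samples_iid: "\<And>k. prob_space.indep_vars M (\<lambda>_. P) (Z k) UNIV"
                     "\<And>k i. distr M P (Z k i) = P"
    and samples_fresh: "\<And>k. prob_space.indep_set M (sets (\<H> (Suc k) k))
           (sets (vimage_algebra (space M) (\<lambda>\<omega> i. Z k i \<omega>) (PiM UNIV (\<lambda>_. P))))"
    \<comment> \<open>sample sizes\<close>
    and size_measurable: "\<And>k. n k \<in> measurable (\<H> (Suc k) k) (count_space UNIV)"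
    and size_pos: "\<And>k \<omega>. \<omega> \<in> space M \<Longrightarrow> 0 < n k \<omega>"
    and size_condition: "\<And>k.
         (AE \<omega> in M. V k \<omega> / real (n k \<omega>) \<le> \<theta>\<^sup>2 * (norm (gT k \<omega>))\<^sup>2)
       \<or> (AE \<omega> in M. V k \<omega> / real (n k \<omega>)
                       \<le> \<theta>\<^sup>2 * real_cond_exp M (\<H> k k) (\<lambda>\<omega>'. (norm (gT k \<omega>'))\<^sup>2) \<omega>)
       \<or> (AE \<omega> in M. real_cond_exp M (\<H> k k) (V k) \<omega> / real (n k \<omega>)
                       \<le> \<theta>\<^sup>2 * real_cond_exp M (\<H> k k) (\<lambda>\<omega>'. (norm (gT k \<omega>'))\<^sup>2) \<omega>)"
    \<comment> \<open>the iterates\<close>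
    and x_0: "\<And>\<omega>. \<omega> \<in> space M \<Longrightarrow> x 0 \<omega> = x0"
    and x_Suc: "\<And>k \<omega>. \<omega> \<in> space M \<Longrightarrow> x (Suc k) \<omega> = x k \<omega> - \<alpha> *\<^sub>R gS k \<omega>"
  shows "\<forall>k. integrable M (\<lambda>\<omega>. F (x k \<omega>) - F xstar) \<and>
             (LINT \<omega>|M. F (x k \<omega>) - F xstar) \<le> (1 - \<rho>) ^ k * (F x0 - F xstar - \<eta>) + \<eta>"
proof -
  interpret prob_space M by fact
  interpret P: prob_space P by fact
  have dir_le: "m = RC \<or> m = RS \<Longrightarrow> N \<le> CARD('d)"
    by (rule directions_card_le[OF directions[of 0]])
  have Lf_pos: "0 < Lf" using \<open>0 < LF\<close> \<open>LF \<le> Lf\<close> by simp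
  interpret fd: forward_difference F gradF LF \<nu>
    by unfold_locales fact+
  have sub0: "subalgebra M (\<H> k k)" for k
    using indep_setD_ev1[OF directions_fresh[of k]] by (simp add: subalgebra_def \<H>_def space_history)
  have sub1: "subalgebra M (\<H> (Suc k) k)" for k
    using indep_setD_ev1[OF samples_fresh[of k]] by (simp add: subalgebra_def \<H>_def space_history)
  have sp: "space (\<H> a b) = space M" for a b by (simp add: \<H>_def space_history)
  have U_H: "U k j \<in> borel_measurable (\<H> a b)" if "k < a" "j < N" for k j a b
    using history_direction[OF that] by (simp add: \<H>_def)
  have Z_M: "Z k i \<in> measurable M P" for k i using samples_iid(1)[of k] by (auto simp: indep_vars_def)
  obtain z0 where z0: "z0 \<in> space P" using P.not_empty by auto
  have f_meas: "(\<lambda>(y, z). f y z) \<in> borel_measurable (borel \<Otimes>\<^sub>M P)"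
  proof (rule borel_measurable_Caratheodory)
    show "continuous_on UNIV (\<lambda>y. f y z)" if "z \<in> space P" for z
      using gradf(1)[OF that] by (auto intro!: continuous_at_imp_continuous_on has_derivative_continuous simp: gderiv_def)
  qed (use f_integrable in auto)
  have x_meas: "x k \<in> borel_measurable (\<H> k k)" for k
  proof (induction k)
    case 0
    have "(\<lambda>_. x0) \<in> borel_measurable (\<H> 0 0)" by simp
    then show ?case by (subst measurable_cong[of _ _ "\<lambda>_. x0"]) (simp_all add: sp x_0)
  next
    case (Suc k)
    let ?H = "\<H> (Suc k) (Suc k)"
    \<comment> \<open>The estimator reads only indices below \<open>n k\<close>, where the truncated
      family agrees with \<open>Z k\<close>; the truncated one is measurable with respect to the
      history.\<close>
    let ?Z = "\<lambda>i \<omega>. if i < n k \<omega> then Z k i \<omega> else z0"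
    have x1: "x k \<in> borel_measurable ?H"
      using measurable_history_mono[OF Suc[unfolded \<H>_def], of "Suc k" "Suc k"] by (simp add: \<H>_def)
    have Z1: "?Z i \<in> measurable ?H P" for i
      unfolding \<H>_def by (rule history_sample) (use z0 measurable_space[OF Z_M] in auto)
    have n1: "n k \<in> measurable ?H (count_space UNIV)"
      using measurable_history_mono[OF size_measurable[of k, unfolded \<H>_def], of "Suc k" "Suc k"] by (simp add: \<H>_def)
    have "(\<lambda>\<omega>. grad_est (scaling m N CARD('d)) \<nu> N (\<lambda>j. U k j \<omega>)
        (\<lambda>y. (\<Sum>i<n k \<omega>. f y (?Z i \<omega>)) / real (n k \<omega>)) (x k \<omega>)) \<in> borel_measurable ?H"
      by (rule borel_measurable_grad_est_sample_mean[OF f_meas x1 _ Z1 n1]) (use U_H in auto)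
    then have "gS k \<in> borel_measurable ?H" by (simp add: gS_def)
    then have "(\<lambda>\<omega>. x k \<omega> - \<alpha> *\<^sub>R gS k \<omega>) \<in> borel_measurable ?H" using x1 by measurable
    then show ?case by (subst measurable_cong[OF x_Suc]) (simp_all add: sp)
  qed
  have step: "integrable M (\<lambda>\<omega>. F (x (Suc k) \<omega>) - F xstar) \<and>
      (LINT \<omega>|M. F (x (Suc k) \<omega>) - F xstar) \<le> (1 - \<rho>) * (LINT \<omega>|M. F (x k \<omega>) - F xstar) + \<rho> * \<eta>"
    if IH: "integrable M (\<lambda>\<omega>. F (x k \<omega>) - F xstar)" for k
  proof -
    have u_M: "U k j \<in> borel_measurable M" if "j < N" for j
      by (rule measurable_from_subalg[OF sub1 U_H]) (use that in auto)
    \<comment> \<open>The squared gradient is at most \<open>2 * LF\<close> times the gap, so the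
      induction hypothesis supplies the integrability that the one-step analysis asks for.\<close>
    have grad_int: "integrable M (\<lambda>\<omega>. (norm (gradF (x k \<omega>)))\<^sup>2)"
    proof (rule Bochner_Integration.integrable_bound)
      show "integrable M (\<lambda>\<omega>. 2 * LF * (F (x k \<omega>) - F xstar))" using IH by simp
      have "x k \<in> borel_measurable M" by (rule measurable_from_subalg[OF sub0 x_meas])
      then show "(\<lambda>\<omega>. (norm (gradF (x k \<omega>)))\<^sup>2) \<in> borel_measurable M"
        using borel_measurable_continuous_onI[OF gradF(2)] by measurable
      show "AE \<omega> in M. norm ((norm (gradF (x k \<omega>)))\<^sup>2) \<le> norm (2 * LF * (F (x k \<omega>) - F xstar))"
        using gradient_square_le[OF gradF(1) gradF_lipschitz \<open>0 < LF\<close> minimizer]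
        by (intro AE_I2) (auto intro: order_trans[OF _ abs_ge_self])
    qed
    interpret s: stochastic_step F gradF LF \<nu> M P f gradf Lf \<beta>1 \<beta>2 "scaling m N CARD('d)" N "U k" "Z k" "n k" "x k" "\<H> k k" "\<H> (Suc k) k"
    proof unfold_locales
      show "sets (\<H> k k) \<subseteq> sets (\<H> (Suc k) k)" unfolding \<H>_def by (rule sets_history_mono) auto
      show "U k j \<in> borel_measurable (\<H> (Suc k) k)" if "j < N" for j by (rule U_H) (use that in auto)
      show "integrable M (\<lambda>\<omega>. norm (U k j \<omega>) ^ 6)" if "j < N" for j
        by (rule fd.directions_bound(2)[OF prob_space_axioms \<open>0 < N\<close> \<open>0 < \<mu>\<close> directions u_M that])
    qed (fact sub0 sub1 x_meas Lf_pos grad_int assms directions_fresh samples_fresh samples_iid size_measurable | rule assms grad_int; assumption)+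
    have gS: "s.gS = gS k" by (simp add: fun_eq_iff s.gS_def gS_def)
    have gT: "s.gT = gT k" by (simp add: s.gT_def gT_def gS)
    have V: "s.V = V k" by (simp add: fun_eq_iff s.V_def V_def s.g1_def gT)
    have "(LINT \<omega>|M. s.v \<omega> / real (n k \<omega>)) \<le> \<theta>\<^sup>2 * (LINT \<omega>|M. (norm (s.gF \<omega>))\<^sup>2)"
      by (rule s.sampling_error_bound) (use size_condition[of k] in \<open>simp only: gT V\<close>)
    from s.expected_descent[OF \<open>0 < N\<close> \<open>0 < \<mu>\<close> directions refl minimizer strongly_convex IH this]
    have d: "integrable M (\<lambda>\<omega>. F (x k \<omega> - \<alpha> *\<^sub>R gS k \<omega>) - F xstar)"
      "(LINT \<omega>|M. F (x k \<omega> - \<alpha> *\<^sub>R gS k \<omega>) - F xstar) \<le> (1 - \<rho>) * (LINT \<omega>|M. F (x k \<omega>) - F xstar) + \<rho> * \<eta>"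
      by (simp_all only: gS \<alpha>_def \<rho>_def \<eta>_def)
    have e: "F (x (Suc k) \<omega>) - F xstar = F (x k \<omega> - \<alpha> *\<^sub>R gS k \<omega>) - F xstar" if "\<omega> \<in> space M" for \<omega>
      by (simp add: x_Suc[OF that])
    show ?thesis
      using d by (simp only: e cong: Bochner_Integration.integrable_cong Bochner_Integration.integral_cong)
  qed
  have \<rho>: "\<rho> \<le> 1"
    unfolding \<rho>_def by (rule rate_le_1[OF \<open>0 < LF\<close> \<open>0 < \<mu>\<close> \<open>\<mu> \<le> LF\<close> dir_le])
  show ?thesis
  proof
    fix k
    show "integrable M (\<lambda>\<omega>. F (x k \<omega>) - F xstar) \<and>
        (LINT \<omega>|M. F (x k \<omega>) - F xstar) \<le> (1 - \<rho>) ^ k * (F x0 - F xstar - \<eta>) + \<eta>"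
    proof (induction k)
      case 0
      have e: "F (x 0 \<omega>) - F xstar = F x0 - F xstar" if "\<omega> \<in> space M" for \<omega> by (simp add: x_0[OF that])
      show ?case
        using prob_space by (simp add: e cong: Bochner_Integration.integrable_cong Bochner_Integration.integral_cong)
    next
      case (Suc k)
      have "(1 - \<rho>) * (LINT \<omega>|M. F (x k \<omega>) - F xstar) + \<rho> * \<eta>
          \<le> (1 - \<rho>) * ((1 - \<rho>) ^ k * (F x0 - F xstar - \<eta>) + \<eta>) + \<rho> * \<eta>"
        using Suc \<rho> by (intro add_right_mono mult_left_mono) auto
      also have "\<dots> = (1 - \<rho>) ^ Suc k * (F x0 - F xstar - \<eta>) + \<eta>" by (simp add: algebra_simps)
      finally show ?case using step[of k] Suc by auto
    qed
  qed
qed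

end
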